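(* Let $n\ge2$ and let $\lambda=\sum_{k=1}^{n-1}a_k\omega_k$ be a dominant weight for the root system $\Phi$ of type $A_{n-1}$. Then $L_{A_{n-1}}(\lambda)$ is a rank symmetric and rank unimodal splitting distributive lattice for the $A_{n-1}$-Weyl bialternant $\chi^{A_{n-1}}_\lambda$. Moreover, $$\mathrm{RGF}(L_{A_{n-1}}(\lambda),q)=\frac{\prod_{\alpha\in\Phi^+}\bigl(1-q^{\langle\lambda+\varrho,\alpha^\vee\rangle}\bigr)}{\prod_{\alpha\in\Phi^+}\bigl(1-q^{\langle\varrho,\alpha^\vee\rangle}\bigr)}.$$
   Context: $\Phi$ is the root system of type $A_{n-1}$ with simple roots $\{\alpha_i\}_{i\in I}$, $I=\{1,\dots,n-1\}$ numbered in the usual way along the Dynkin diagram, positive roots $\Phi^+$, $\alpha^\vee=2\alpha/\langle\alpha,\alpha\rangle$, fundamental weights $\omega_i$ dual to simple coroots, $\Lambda=\bigoplus\mathbb Z\omega_i$, Weyl group $W$, $\varrho=\sum\omega_i$. $\mathbb Z[\Lambda]$ is the group ring with basis $\{e^\mu\}$; $\mathcal A(e^\mu)=\sum_{w\in W}\det(w)e^{w(\mu)}$. The Weyl bialternant $\chi_\lambda$ is the unique element of $\mathbb Z[\Lambda]$ with $\mathcal A(e^\varrho)\chi_\lambda=\mathcal A(e^{\lambda+\varrho})$. The lattice. A special linear ideal pattern of size $n-1$ bounded by $\lambda=\sum a_k\omega_k$ ($a_k\in\mathbb Z_{\ge0}$) is an integer array $(g_{i,j})_{1\le j\le i\le n}$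 with $g_{n,j}=\sum_{k=n+1-j}^{n-1}a_k$ for $1\le j\le n$ (so $g_{n,1}=0$) and $g_{i+1,j}\le g_{i,j}\le g_{i+1,j+1}$ for all $1\le j\le i\le n-1$. $L_{A_{n-1}}(\lambda)$ is the set of these patterns, partially ordered by componentwise comparison (it is a distributive lattice). A covering relation $\mathbf s\to\mathbf t$ increases exactly one entry $g_{i,j}$ by 1 (with $1\le i\le n-1$), and this Hasse edge is given color $i\in I$. For a ranked poset $R$ (finite; there is a surjection $\rho:R\to\{0,\dots,l\}$ increasing by 1 along covering relations) with Hasse edges colored by $I$, $\mathrm{comp}_i(\mathbf x)$ is the connected component of $\mathbf x$ using only color $i$ edges; $\rho_i(\mathbf x)$ is the rank of $\mathbf x$ there, $l_i(\mathbf x)$ its length, $m_i=2\rho_i-l_i$, $wt(\mathbf x)=\sum_im_i(\mathbf x)\omega_i$. $R$ is a splitting poset for $\chi_\lambda$ (splitting distributive lattice if it is a distributive lattice) if $wt(\mathbf s)+\alpha_i=wt(\mathbf t)$ whenever $\mathbf s\xrightarrow{i}\mathbf t$ and $\sum_{\mathbf x\in R}e^{wt(\mathbf x)}=\chi_\lambda$. $\mathrm{RGF}(R,q)=\sum_{\mathbf x\in R}q^{\rho(\mathbf x)}$. $R$ is rank symmetric if $|\rho^{-1}(i)|=|\rho^{-1}(l-i)|$ for all $i$, and rank unimodal if $|\rho^{-1}(0)|\le\cdots\le|\rho^{-1}(m)|\ge\cdots\ge|\rho^{-1}(l)|$ for some $m$. *)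

theory Defs
  imports
    "HOL-Library.Poly_Mapping"
    "HOL-Algebra.Lattice"
    "HOL-Computational_Algebra.Polynomial_Factorial"
    "Jordan_Normal_Form.Determinant"
begin

section \<open>The root system of type A\<close>

text \<open>
  The root system of type \<open>A\<^bsub>n-1\<^esub>\<close> in its standard realisation: the Euclidean space is the
  hyperplane of coordinate sum zero in \<open>n\<close>-space, and the roots are the differences of distinct
  standard basis vectors \<open>\<epsilon>\<^sub>1, \<dots>, \<epsilon>\<^sub>n\<close>. Vectors are finitely supported functions on \<open>nat\<close>,
  with support in \<open>{1..n}\<close>, so that \<open>n\<close> can be an ordinary variable and the group ring
  of the weight lattice is available as a type of polynomial mappings.
\<close>

type_synonym vect = "nat \<Rightarrow>\<^sub>0 real"

definition scal :: "real \<Rightarrow> vect \<Rightarrow> vect" where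
  "scal c v = Poly_Mapping.map (\<lambda>x. c * x) v"

definition inprod :: "vect \<Rightarrow> vect \<Rightarrow> real" where
  "inprod u v =
     (\<Sum>k\<in>Poly_Mapping.keys u \<union> Poly_Mapping.keys v. Poly_Mapping.lookup u k * Poly_Mapping.lookup v k)"

definition eps :: "nat \<Rightarrow> vect" where
  "eps k = Poly_Mapping.single k 1"

definition euclid_space :: "nat \<Rightarrow> vect set" where
  "euclid_space n = {v. Poly_Mapping.keys v \<subseteq> {1..n} \<and> (\<Sum>k=1..n. Poly_Mapping.lookup v k) = 0}"

definition roots :: "nat \<Rightarrow> vect set" where
  "roots n = {eps i - eps j | i j. i \<in> {1..n} \<and> j \<in> {1..n} \<and> i \<noteq> j}"

definition simple_root :: "nat \<Rightarrow> vect" where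
  "simple_root i = eps i - eps (Suc i)"

definition pos_roots :: "nat \<Rightarrow> vect set" where
  "pos_roots n =
     {\<alpha> \<in> roots n. \<exists>c :: nat \<Rightarrow> nat. \<alpha> = (\<Sum>i=1..n-1. scal (real (c i)) (simple_root i))}"

definition coroot :: "vect \<Rightarrow> vect" where
  "coroot \<alpha> = scal (2 / inprod \<alpha> \<alpha>) \<alpha>"

definition fund_weight :: "nat \<Rightarrow> nat \<Rightarrow> vect" where
  "fund_weight n i =
     (THE v. v \<in> euclid_space n \<and>
        (\<forall>j\<in>{1..n-1}. inprod v (coroot (simple_root j)) = (if i = j then 1 else 0)))"

definition weight_lattice :: "nat \<Rightarrow> vect set" where
  "weight_lattice n = {\<Sum>i=1..n-1. scal (of_int (m i)) (fund_weight n i) | m :: nat \<Rightarrow> int. True}"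

definition weyl_vector :: "nat \<Rightarrow> vect" where
  "weyl_vector n = (\<Sum>i=1..n-1. fund_weight n i)"

definition reflection :: "vect \<Rightarrow> vect \<Rightarrow> vect" where
  "reflection \<alpha> v = v - scal (inprod v (coroot \<alpha>)) \<alpha>"

inductive_set weyl_group :: "nat \<Rightarrow> (vect \<Rightarrow> vect) set" for n :: nat where
  weyl_id: "id \<in> weyl_group n"
| weyl_refl: "w \<in> weyl_group n \<Longrightarrow> \<alpha> \<in> roots n \<Longrightarrow> reflection \<alpha> \<circ> w \<in> weyl_group n"

text \<open>
  The elements of the Weyl group act on all of \<open>n\<close>-space and fix \<open>\<epsilon>\<^sub>1 + \<dots> + \<epsilon>\<^sub>n\<close>, so the
  determinant may be taken with respect to \<open>\<epsilon>\<^sub>1, \<dots>, \<epsilon>\<^sub>n\<close>. It is \<open>1\<close> or \<open>-1\<close>; the floor only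
  turns the real number into an integer.
\<close>

definition weyl_det :: "nat \<Rightarrow> (vect \<Rightarrow> vect) \<Rightarrow> int" where
  "weyl_det n w =
     \<lfloor>det (mat n n (\<lambda>(i, j). Poly_Mapping.lookup (w (eps (Suc j))) (Suc i)))\<rfloor>"

section \<open>The group ring and Weyl bialternants\<close>

text \<open>
  Multiplication of polynomial mappings is convolution, so the mappings supported on the weight
  lattice form its group ring over the integers, and \<open>e\<^sup>\<mu>\<close> is the mapping \<open>\<mu> \<mapsto> 1\<close>.
\<close>

type_synonym group_ring_elt = "vect \<Rightarrow>\<^sub>0 int"

definition group_ring :: "nat \<Rightarrow> group_ring_elt set" where
  "group_ring n = {f. Poly_Mapping.keys f \<subseteq> weight_lattice n}"

definition expo :: "vect \<Rightarrow> group_ring_elt" where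
  "expo \<mu> = Poly_Mapping.single \<mu> 1"

definition alternant :: "nat \<Rightarrow> vect \<Rightarrow> group_ring_elt" where
  "alternant n \<mu> = (\<Sum>w\<in>weyl_group n. of_int (weyl_det n w) * expo (w \<mu>))"

definition weyl_bialternant :: "nat \<Rightarrow> vect \<Rightarrow> group_ring_elt" where
  "weyl_bialternant n lam =
     (THE \<chi>. \<chi> \<in> group_ring n \<and>
        alternant n (weyl_vector n) * \<chi> = alternant n (lam + weyl_vector n))"

section \<open>Ranked posets with coloured edges\<close>

definition covers :: "'a::order set \<Rightarrow> 'a \<Rightarrow> 'a \<Rightarrow> bool" where
  "covers R x y \<longleftrightarrow> x \<in> R \<and> y \<in> R \<and> x < y \<and> \<not> (\<exists>z\<in>R. x < z \<and> z < y)"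

text \<open>
  Rank functions are defined for a set of vertices with a set of directed edges, so that they
  apply both to a poset with its covering relations and to the components
  in a single colour. \<open>rank_of\<close> and \<open>length_of\<close> presuppose that the rank function is unique,
  as it is when the graph is connected (see \<open>rank_function_unique\<close> below).
\<close>

definition is_rank_function ::
    "'a set \<Rightarrow> ('a \<Rightarrow> 'a \<Rightarrow> bool) \<Rightarrow> ('a \<Rightarrow> nat) \<Rightarrow> nat \<Rightarrow> bool" where
  "is_rank_function V E \<rho> l \<longleftrightarrow>
     \<rho> ` V = {0..l} \<and> (\<forall>x\<in>V. \<forall>y\<in>V. E x y \<longrightarrow> \<rho> y = \<rho> x + 1)"

definition rank_of :: "'a set \<Rightarrow> ('a \<Rightarrow> 'a \<Rightarrow> bool) \<Rightarrow> 'a \<Rightarrow> nat" where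
  "rank_of V E x = (THE r. \<exists>\<rho> l. is_rank_function V E \<rho> l \<and> \<rho> x = r)"

definition length_of :: "'a set \<Rightarrow> ('a \<Rightarrow> 'a \<Rightarrow> bool) \<Rightarrow> nat" where
  "length_of V E = (THE l. \<exists>\<rho>. is_rank_function V E \<rho> l)"

definition ranked_poset :: "'a::order set \<Rightarrow> bool" where
  "ranked_poset R \<longleftrightarrow> finite R \<and> (\<exists>\<rho> l. is_rank_function R (covers R) \<rho> l)"

definition rank_number :: "'a::order set \<Rightarrow> nat \<Rightarrow> nat" where
  "rank_number R r = card {x \<in> R. rank_of R (covers R) x = r}"

definition rank_symmetric :: "'a::order set \<Rightarrow> bool" where
  "rank_symmetric R \<longleftrightarrow>
     (let l = length_of R (covers R) in \<forall>i\<le>l. rank_number R i = rank_number R (l - i))"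

definition rank_unimodal :: "'a::order set \<Rightarrow> bool" where
  "rank_unimodal R \<longleftrightarrow>
     (let l = length_of R (covers R) in
      \<exists>m\<le>l. (\<forall>i<m. rank_number R i \<le> rank_number R (Suc i)) \<and>
             (\<forall>i. m \<le> i \<and> i < l \<longrightarrow> rank_number R (Suc i) \<le> rank_number R i))"

definition RGF :: "'a::order set \<Rightarrow> int poly" where
  "RGF R = (\<Sum>x\<in>R. Polynomial.monom 1 (rank_of R (covers R) x))"

definition distributive_lattice :: "'a::order set \<Rightarrow> bool" where
  "distributive_lattice R \<longleftrightarrow>
     (let L = \<lparr>carrier = R, eq = (=), le = (\<le>)\<rparr> in
      lattice L \<and>
      (\<forall>x\<in>R. \<forall>y\<in>R. \<forall>z\<in>R. x \<sqinter>\<^bsub>L\<^esub> (y \<squnion>\<^bsub>L\<^esub> z) = (x \<sqinter>\<^bsub>L\<^esub> y) \<squnion>\<^bsub>L\<^esub> (x \<sqinter>\<^bsub>L\<^esub> z)))"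

text \<open>A colouring \<open>clr\<close> assigns a colour to each pair in the covering relation; its values on
  other pairs are irrelevant.\<close>

definition color_edge ::
    "'a::order set \<Rightarrow> ('a \<Rightarrow> 'a \<Rightarrow> nat) \<Rightarrow> nat \<Rightarrow> 'a \<Rightarrow> 'a \<Rightarrow> bool" where
  "color_edge R clr i x y \<longleftrightarrow> covers R x y \<and> clr x y = i"

definition color_component :: "'a::order set \<Rightarrow> ('a \<Rightarrow> 'a \<Rightarrow> nat) \<Rightarrow> nat \<Rightarrow> 'a \<Rightarrow> 'a set" where
  "color_component R clr i x =
     {y. (\<lambda>u v. color_edge R clr i u v \<or> color_edge R clr i v u)\<^sup>*\<^sup>* x y}"

definition m_of :: "'a::order set \<Rightarrow> ('a \<Rightarrow> 'a \<Rightarrow> nat) \<Rightarrow> nat \<Rightarrow> 'a \<Rightarrow> int" where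
  "m_of R clr i x =
     2 * int (rank_of (color_component R clr i x) (color_edge R clr i) x)
       - int (length_of (color_component R clr i x) (color_edge R clr i))"

definition weight_of :: "nat \<Rightarrow> 'a::order set \<Rightarrow> ('a \<Rightarrow> 'a \<Rightarrow> nat) \<Rightarrow> 'a \<Rightarrow> vect" where
  "weight_of n R clr x = (\<Sum>i=1..n-1. scal (of_int (m_of R clr i x)) (fund_weight n i))"

definition splitting_poset ::
    "nat \<Rightarrow> vect \<Rightarrow> 'a::order set \<Rightarrow> ('a \<Rightarrow> 'a \<Rightarrow> nat) \<Rightarrow> bool" where
  "splitting_poset n lam R clr \<longleftrightarrow>
     ranked_poset R \<and>
     (\<forall>s t. covers R s t \<longrightarrow> clr s t \<in> {1..n-1}) \<and>
     (\<forall>i s t. color_edge R clr i s t \<longrightarrow> weight_of n R clr s + simple_root i = weight_of n R clr t) \<and>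
     (\<Sum>x\<in>R. expo (weight_of n R clr x)) = weyl_bialternant n lam"

definition splitting_distributive_lattice ::
    "nat \<Rightarrow> vect \<Rightarrow> 'a::order set \<Rightarrow> ('a \<Rightarrow> 'a \<Rightarrow> nat) \<Rightarrow> bool" where
  "splitting_distributive_lattice n lam R clr \<longleftrightarrow>
     splitting_poset n lam R clr \<and> distributive_lattice R"

section \<open>Special linear ideal patterns\<close>

text \<open>
  Arrays are extended by zero outside \<open>1 \<le> j \<le> i \<le> n\<close>, so that the pointwise order on
  functions is the componentwise order on patterns.
\<close>

definition sl_patterns :: "nat \<Rightarrow> (nat \<Rightarrow> nat) \<Rightarrow> (nat \<Rightarrow> nat \<Rightarrow> int) set" where
  "sl_patterns n a =
     {g. (\<forall>j\<in>{1..n}. g n j = (\<Sum>k=n+1-j..n-1. int (a k))) \<and>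
         (\<forall>i j. 1 \<le> j \<and> j \<le> i \<and> i \<le> n - 1 \<longrightarrow> g (i+1) j \<le> g i j \<and> g i j \<le> g (i+1) (j+1)) \<and>
         (\<forall>i j. \<not> (1 \<le> j \<and> j \<le> i \<and> i \<le> n) \<longrightarrow> g i j = 0)}"

definition pattern_color :: "(nat \<Rightarrow> nat \<Rightarrow> int) \<Rightarrow> (nat \<Rightarrow> nat \<Rightarrow> int) \<Rightarrow> nat" where
  "pattern_color s t = (THE i. \<exists>j. t = s(i := (s i)(j := s i j + 1)))"

section \<open>Well-definedness of fundamental weights and rank functions\<close>

lemma lookup_scal [simp]: "Poly_Mapping.lookup (scal c v) k = c * Poly_Mapping.lookup v k"
  by (simp add: scal_def Poly_Mapping.map.rep_eq when_def)

lemma inprod_coroot_simple: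
  "inprod v (coroot (simple_root j)) = Poly_Mapping.lookup v j - Poly_Mapping.lookup v (Suc j)"
proof -
  have sup: "inprod u w = (\<Sum>k\<in>A. Poly_Mapping.lookup u k * Poly_Mapping.lookup w k)"
    if "finite A" "Poly_Mapping.keys w \<subseteq> A" for u w A
    unfolding inprod_def using that
    by (intro sum.mono_neutral_cong) (auto simp: in_keys_iff)
  have l: "Poly_Mapping.lookup (simple_root j) k = (if k = j then 1 else if k = Suc j then -1 else 0)" for k
    by (auto simp: simple_root_def eps_def lookup_minus lookup_single)
  have k1: "Poly_Mapping.keys (simple_root j) \<subseteq> {j, Suc j}"
    by (auto simp: in_keys_iff l split: if_splits)
  have k2: "Poly_Mapping.keys (coroot (simple_root j)) \<subseteq> {j, Suc j}"
    by (auto simp: in_keys_iff l coroot_def split: if_splits)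
  have "inprod (simple_root j) (simple_root j) = 2"
    by (subst sup[OF _ k1]) (auto simp: l)
  then show ?thesis
    by (subst sup[OF _ k2]) (auto simp: l coroot_def)
qed

lemma fund_weight_unique:
  assumes i: "i \<in> {1..n-1}"
  shows "\<exists>!v. v \<in> euclid_space n \<and>
           (\<forall>j\<in>{1..n-1}. inprod v (coroot (simple_root j)) = (if i = j then 1 else 0))"
proof (rule ex_ex1I)
  define f where "f k = (if k \<in> {1..n} then (if k \<le> i then 1 else 0) - real i / real n else 0)" for k
  define v where "v = Poly_Mapping.Abs_poly_mapping f"
  have "finite {k. f k \<noteq> 0}"
    by (rule finite_subset[of _ "{1..n}"]) (auto simp: f_def)
  then have lv: "Poly_Mapping.lookup v = f"
    by (simp add: v_def)
  have "(\<Sum>k=1..n. f k) = (\<Sum>k=1..n. (if k \<le> i then 1 else 0)) - real i"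
    using i by (auto simp: f_def sum_subtractf)
  also have "(\<Sum>k=1..n. (if k \<le> i then 1 else 0)) = (\<Sum>k=1..i. 1 :: real)"
    using i by (intro sum.mono_neutral_cong_right) auto
  finally have "(\<Sum>k=1..n. f k) = 0" by simp
  moreover have "Poly_Mapping.keys v \<subseteq> {1..n}"
    by (auto simp: in_keys_iff lv f_def split: if_splits)
  moreover have "f j - f (Suc j) = (if i = j then 1 else 0)" if "j \<in> {1..n-1}" for j
    using that i by (auto simp: f_def)
  ultimately show "\<exists>v. v \<in> euclid_space n \<and>
      (\<forall>j\<in>{1..n-1}. inprod v (coroot (simple_root j)) = (if i = j then 1 else 0))"
    by (intro exI[of _ v]) (auto simp: euclid_space_def inprod_coroot_simple lv)
next
  fix u v
  assume u: "u \<in> euclid_space n \<and>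
      (\<forall>j\<in>{1..n-1}. inprod u (coroot (simple_root j)) = (if i = j then 1 else 0))"
    and v: "v \<in> euclid_space n \<and>
      (\<forall>j\<in>{1..n-1}. inprod v (coroot (simple_root j)) = (if i = j then 1 else 0))"
  define d where "d k = Poly_Mapping.lookup u k - Poly_Mapping.lookup v k" for k
  have n: "1 \<le> n" using i by auto
  have step: "d (Suc j) = d j" if "j \<in> {1..n-1}" for j
  proof -
    have "inprod u (coroot (simple_root j)) = inprod v (coroot (simple_root j))"
      using u v that by simp
    then show ?thesis
      by (simp add: inprod_coroot_simple d_def)
  qed
  have const: "Suc k \<le> n \<Longrightarrow> d (Suc k) = d 1" for k
  proof (induction k)
    case (Suc k)
    then show ?case using step[of "Suc k"] by auto
  qed simp
  have const': "d k = d 1" if "k \<in> {1..n}" for k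
    using const[of "k - 1"] that by auto
  have "(\<Sum>k=1..n. d k) = real n * d 1"
    by (subst sum.cong[OF refl const']) simp_all
  moreover have "(\<Sum>k=1..n. d k) = 0"
    using u v by (simp add: d_def sum_subtractf euclid_space_def)
  ultimately have "d 1 = 0" using n by simp
  moreover have "d k = 0" if "k \<notin> {1..n}" for k
  proof -
    have "k \<notin> Poly_Mapping.keys u" "k \<notin> Poly_Mapping.keys v"
      using u v that by (auto simp: euclid_space_def)
    then show ?thesis by (simp add: d_def in_keys_iff)
  qed
  ultimately have "d k = 0" for k by (cases "k \<in> {1..n}") (use const'[of k] in metis, blast)
  then show "u = v" by (intro poly_mapping_eqI) (simp add: d_def)
qed

lemma rank_function_unique:
  assumes r: "is_rank_function V E \<rho> l" "is_rank_function V E \<rho>' l'"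
    and conn: "\<And>x y. x \<in> V \<Longrightarrow> y \<in> V \<Longrightarrow>
                 (\<lambda>u v. u \<in> V \<and> v \<in> V \<and> (E u v \<or> E v u))\<^sup>*\<^sup>* x y"
  shows "l = l'" and "x \<in> V \<Longrightarrow> \<rho> x = \<rho>' x"
proof -
  have diff: "int (\<rho> y) - int (\<rho>' y) = int (\<rho> x) - int (\<rho>' x)" if "x \<in> V" "y \<in> V" for x y
    using conn[OF that]
  proof (induction rule: rtranclp_induct)
    case (step y z)
    then have "E y z \<Longrightarrow> \<rho> z = \<rho> y + 1 \<and> \<rho>' z = \<rho>' y + 1"
      and "E z y \<Longrightarrow> \<rho> y = \<rho> z + 1 \<and> \<rho>' y = \<rho>' z + 1"
      using r unfolding is_rank_function_def by blast+
    with step show ?case by linarith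
  qed simp
  have im: "\<rho> ` V = {0..l}" "\<rho>' ` V = {0..l'}"
    using r by (auto simp: is_rank_function_def)
  then have "0 \<in> \<rho> ` V" "0 \<in> \<rho>' ` V" by simp_all
  then obtain p p' where p: "p \<in> V" "\<rho> p = 0" "p' \<in> V" "\<rho>' p' = 0"
    unfolding image_iff by auto
  have eq: "\<rho> x = \<rho>' x" if "x \<in> V" for x
    using diff[OF p(1) that] diff[OF p(3) that] diff[OF p(1) p(3)] p by linarith
  then show "x \<in> V \<Longrightarrow> \<rho> x = \<rho>' x" by simp
  have "\<rho> ` V = \<rho>' ` V" using eq by (intro image_cong) auto
  then have "{0..l} = {0..l'}" using im by simp
  then show "l = l'" by auto
qed

end

(*
  The bialternant identity is the branching rule iterated: after column operations the determinant
  of the powers x_i^(l_j) in n + 1 variables expands along its last row into the corresponding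
  determinants in n variables, one for each row interlacing with l, and the factors split off
  multiply up to the Vandermonde determinant. The weight of a pattern has coordinates S_k - S_(k-1),
  where S_k is the sum of row k, so these monomials are exactly the exponentials of the weights.

  Setting x_i = q^(n-i) turns both determinants into Vandermonde products. This gives the product
  formula for the rank generating function, which is visibly a self-reciprocal polynomial.

  Unimodality comes from a principal sl_2 acting on the span of the patterns by rational forms of the
  Gelfand-Tsetlin formulas. Only the relation [E, F] = H is needed. Its off-diagonal part is checked
  on each square of the distributive lattice, its diagonal part is a sum of residues, and it makes E
  injective below the middle rank.
*)

theory Submission
  imports Defs
begin

section \<open>Determinants of powers\<close>

text \<open>The identity \<open>power_det_eq_sum_patterns\<close> holds over every commutative ring.
  It is used in the group ring for the bialternant and again for polynomials in q, so no
  specialisation map between the two rings has to be built.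

  For one colour the raising and lowering operators E_i and F_i satisfy [E_i, F_i] = H_i with
  eigenvalue m_i. Taking E as the sum of the E_i and F as the sum of the c_i F_i gives the sum of
  the c_i H_i as commutator. This is 2 \<rho> - l when 2 c_i - c_(i-1) - c_(i+1) = 2 and c_0 = c_n =
  0, that is, for c_i = i (n - i).

  The obstacle is the boundary of the set of patterns: the formulas may prescribe moves that leave
  it, and the residue sums may have vanishing denominators. Forbidden moves turn out to have
  vanishing numerators, and two poles collide only where the interlacing conditions force the
  numerator to vanish twice.\<close>

definition power_det :: "nat \<Rightarrow> (nat \<Rightarrow> 'a::comm_ring_1) \<Rightarrow> (nat \<Rightarrow> nat) \<Rightarrow> 'a" where
  "power_det n x l = det (mat n n (\<lambda>(i, j). x i ^ l j))"

lemma power_det_0 [simp]: "power_det 0 x l = 1"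
  by (simp add: power_det_def)

lemma power_det_cong:
  "(\<And>i. i < n \<Longrightarrow> x i = x' i) \<Longrightarrow> (\<And>j. j < n \<Longrightarrow> l j = l' j) \<Longrightarrow> power_det n x l = power_det n x' l'"
  unfolding power_det_def by (intro arg_cong[of _ _ det] eq_matI) auto

lemma permutes_lessI:
  fixes n :: nat
  shows "p permutes {0..<n} \<Longrightarrow> j < n \<Longrightarrow> p j < n"
  using permutes_in_image[of p "{0..<n}" j] by simp

lemma power_det_Leibniz:
  "power_det n x l = (\<Sum>p | p permutes {0..<n}. of_int (sign p) * (\<Prod>j<n. x (p j) ^ l j))"
proof -
  have "power_det n x l = (\<Sum>p | p permutes {0..<n}. of_int (sign p) *
          (\<Prod>j<n. mat n n (\<lambda>(i, j). x i ^ l j) $$ (p j, j)))"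
    unfolding power_det_def by (rule det_col[of _ n]) simp
  also have "\<dots> = (\<Sum>p | p permutes {0..<n}. of_int (sign p) * (\<Prod>j<n. x (p j) ^ l j))"
    by (intro sum.cong refl arg_cong2[of _ _ _ _ "(*)"] prod.cong)
       (auto dest: permutes_lessI)
  finally show ?thesis .
qed

text \<open>Multilinearity in the columns, with one choice \<open>m j\<close> of a summand per
  column, and in the rows for the factors \<open>c i\<close>. Both come from the Leibniz expansion,
  since a permutation only reorders the product of the \<open>c i\<close>.\<close>

lemma det_sum_columns:
  fixes f :: "nat \<Rightarrow> 'b \<Rightarrow> 'a::comm_ring_1"
  assumes M: "\<And>j. j < n \<Longrightarrow> finite (M j)"
  shows "det (mat n n (\<lambda>(i, j). c i * (\<Sum>m\<in>M j. f i m * g j m))) =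
    (\<Prod>i<n. c i) * (\<Sum>m\<in>Pi\<^sub>E {..<n} M. (\<Prod>j<n. g j (m j)) * det (mat n n (\<lambda>(i, j). f i (m j))))"
proof -
  let ?P = "{p. p permutes {0..<n}}"
  have L: "det (mat n n (\<lambda>(i, j). h i j)) = (\<Sum>p\<in>?P. of_int (sign p) * (\<Prod>j<n. h (p j) j))"
    for h :: "nat \<Rightarrow> nat \<Rightarrow> 'a"
    by (subst det_col[of _ n]) (auto intro!: sum.cong prod.cong dest: permutes_lessI)
  have pc: "(\<Prod>j<n. c (p j)) = (\<Prod>i<n. c i)" if "p \<in> ?P" for p
    using prod.permute[of p "{..<n}" c] that by (simp add: lessThan_atLeast0 o_def)
  have "(\<Prod>j<n. c (p j) * (\<Sum>m\<in>M j. f (p j) m * g j m)) =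
      (\<Prod>i<n. c i) * (\<Sum>m\<in>Pi\<^sub>E {..<n} M. (\<Prod>j<n. g j (m j)) * (\<Prod>j<n. f (p j) (m j)))"
    if "p \<in> ?P" for p
    by (subst prod.distrib, subst prod_sum_PiE) (use M in \<open>auto simp: pc[OF that] prod.distrib mult.commute\<close>)
  then have "det (mat n n (\<lambda>(i, j). c i * (\<Sum>m\<in>M j. f i m * g j m))) =
      (\<Sum>p\<in>?P. of_int (sign p) * ((\<Prod>i<n. c i) *
         (\<Sum>m\<in>Pi\<^sub>E {..<n} M. (\<Prod>j<n. g j (m j)) * (\<Prod>j<n. f (p j) (m j)))))"
    unfolding L by (intro sum.cong refl) simp
  also have "\<dots> = (\<Prod>i<n. c i) * (\<Sum>m\<in>Pi\<^sub>E {..<n} M. \<Sum>p\<in>?P. (\<Prod>j<n. g j (m j)) *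
      (of_int (sign p) * (\<Prod>j<n. f (p j) (m j))))"
    by (subst sum.swap) (simp add: sum_distrib_left mult_ac)
  finally show ?thesis
    unfolding L by (simp add: sum_distrib_left)
qed

text \<open>The geometric sum is indexed by the actual exponent \<open>m\<close> of
  \<open>x\<close>. Its range {a..<b} becomes the interlacing condition between two rows of a
  pattern.\<close>

lemma shifted_power_diff:
  fixes x y :: "'a::comm_ring_1"
  assumes "a \<le> b"
  shows "x ^ b - x ^ a * y ^ (b - a) = (x - y) * (\<Sum>m\<in>{a..<b}. x ^ m * y ^ (b - 1 - m))"
proof -
  have "x ^ b - x ^ a * y ^ (b - a) = x ^ a * (x ^ (b - a) - y ^ (b - a))"
    using assms by (simp add: algebra_simps flip: power_add)
  also have "\<dots> = (x - y) * (\<Sum>i<b - a. x ^ (a + i) * y ^ (b - a - Suc i))"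
    by (simp add: power_diff_sumr2 sum_distrib_left power_add mult_ac)
  also have "(\<Sum>i<b - a. x ^ (a + i) * y ^ (b - a - Suc i)) = (\<Sum>m\<in>{a..<b}. x ^ m * y ^ (b - 1 - m))"
    using assms
    by (intro sum.reindex_bij_witness[of _ "\<lambda>m. m - a" "\<lambda>i. a + i"]) auto
  finally show ?thesis .
qed

text \<open>Subtracting a multiple of each column from the next one clears all but the first entry of the
  last row, and the remaining minor splits by multilinearity in its columns.\<close>

lemma power_det_branching:
  fixes x :: "nat \<Rightarrow> 'a::comm_ring_1"
  assumes l: "\<And>j. j < n \<Longrightarrow> l j \<le> l (Suc j)"
  shows "power_det (Suc n) x l = (\<Prod>i<n. x n - x i) *
    (\<Sum>m\<in>(\<Pi>\<^sub>E j\<in>{..<n}. {l j..<l (Suc j)}).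
       x n ^ (l 0 + (\<Sum>j<n. l (Suc j) - 1 - m j)) * power_det n x m)"
proof -
  define y where "y = x n"
  define A where "A = mat (Suc n) (Suc n) (\<lambda>(i, j). x i ^ l j)"
  define U where "U = mat (Suc n) (Suc n) (\<lambda>(i, j). if i = j then 1 else if Suc i = j then - (y ^ (l j - l i)) else 0)"
  define B where "B = A * U"
  have car [simp]: "A \<in> carrier_mat (Suc n) (Suc n)" "U \<in> carrier_mat (Suc n) (Suc n)" "B \<in> carrier_mat (Suc n) (Suc n)"
    by (auto simp: A_def U_def B_def)
  have "det U = prod_list (diag_mat U)"
    by (rule det_upper_triangular) (auto simp: U_def upper_triangular_def)
  also have "\<dots> = 1"
    by (simp add: prod_list_diag_prod U_def)
  finally have detB: "det B = power_det (Suc n) x l"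
    by (simp only: B_def det_mult[OF car(1,2)]) (simp add: power_det_def A_def)
  have Bent: "B $$ (i, j) = (\<Sum>k<Suc n. x i ^ l k * (if k = j then 1 else if Suc k = j then - (y ^ (l j - l k)) else 0))"
    if "i < Suc n" "j < Suc n" for i j
    using that by (auto simp: B_def A_def U_def scalar_prod_def lessThan_atLeast0 intro!: sum.cong)
  have B0: "B $$ (i, 0) = x i ^ l 0" if "i < Suc n" for i
    using that by (simp add: Bent if_distrib cong: if_cong)
  have BS: "B $$ (i, Suc j) = (x i - y) * (\<Sum>m\<in>{l j..<l (Suc j)}. x i ^ m * y ^ (l (Suc j) - 1 - m))"
    if "i < Suc n" "j < n" for i j
  proof -
    have "B $$ (i, Suc j) = (\<Sum>k\<in>{j, Suc j}. x i ^ l k * (if k = Suc j then 1 else if Suc k = Suc j then - (y ^ (l (Suc j) - l k)) else 0))"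
      using that by (simp only: Bent Suc_less_eq) (rule sum.mono_neutral_right, auto)
    also have "\<dots> = x i ^ l (Suc j) - x i ^ l j * y ^ (l (Suc j) - l j)"
      by simp
    finally show ?thesis
      using shifted_power_diff[OF l[OF that(2)]] by simp
  qed
  have "det B = (\<Sum>j<Suc n. B $$ (n, j) * cofactor B n j)"
    by (rule laplace_expansion_row) simp_all
  also have "\<dots> = (\<Sum>j\<in>{0}. B $$ (n, j) * cofactor B n j)"
  proof (rule sum.mono_neutral_right)
    show "\<forall>i\<in>{..<Suc n} - {0}. B $$ (n, i) * cofactor B n i = 0"
    proof
      fix i assume "i \<in> {..<Suc n} - {0}"
      then obtain j where "i = Suc j" "j < n" by (cases i) auto
      then show "B $$ (n, i) * cofactor B n i = 0"
        using BS[of n j] by (simp add: y_def)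
    qed
  qed auto
  also have "\<dots> = y ^ l 0 * ((-1) ^ n * det (mat_delete B n 0))"
    by (simp add: B0 cofactor_def y_def)
  also have "mat_delete B n 0 = mat n n (\<lambda>(i, j). (x i - y) *
      (\<Sum>m\<in>{l j..<l (Suc j)}. x i ^ m * y ^ (l (Suc j) - 1 - m)))"
    using carrier_matD[OF car(3)]
    by (intro eq_matI) (auto simp: mat_delete_def BS)
  also have "det \<dots> = (\<Prod>i<n. x i - y) * (\<Sum>m\<in>(\<Pi>\<^sub>E j\<in>{..<n}. {l j..<l (Suc j)}).
      (\<Prod>j<n. y ^ (l (Suc j) - 1 - m j)) * power_det n x m)"
    unfolding power_det_def by (rule det_sum_columns) simp
  \<comment> \<open>This sign cancels the one of the cofactor in the corner (n, 0).\<close>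
  also have "(\<Prod>i<n. x i - y) = (-1) ^ n * (\<Prod>i<n. y - x i)"
    using prod.distrib[of "\<lambda>_. -1" "\<lambda>i. y - x i" "{..<n}"] by simp
  finally show ?thesis
    unfolding detB
    by (simp add: y_def sum_distrib_left mult_ac power_add power_sum flip: power_mult_distrib)
qed

section \<open>Patterns and the branching rule\<close>

text \<open>\<open>sl_patterns\<close> forces the top row to start with 0. The lower rows need not
  do so, hence the branching induction works with a free top row \<open>t\<close>.\<close>

definition patterns :: "nat \<Rightarrow> (nat \<Rightarrow> int) \<Rightarrow> (nat \<Rightarrow> nat \<Rightarrow> int) set" where
  "patterns n t = {g. (\<forall>j\<in>{1..n}. g n j = t j) \<and>
     (\<forall>i j. 1 \<le> j \<and> j \<le> i \<and> i < n \<longrightarrow> g (Suc i) j \<le> g i j \<and> g i j \<le> g (Suc i) (Suc j)) \<and>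
     (\<forall>i j. \<not> (1 \<le> j \<and> j \<le> i \<and> i \<le> n) \<longrightarrow> g i j = 0)}"

definition row_sum :: "(nat \<Rightarrow> nat \<Rightarrow> int) \<Rightarrow> nat \<Rightarrow> int" where
  "row_sum g i = (\<Sum>j=1..i. g i j)"

lemma row_sum_0 [simp]: "row_sum g 0 = 0"
  by (simp add: row_sum_def)

lemma patternsD:
  assumes "g \<in> patterns n t"
  shows "1 \<le> j \<Longrightarrow> j \<le> n \<Longrightarrow> g n j = t j"
    and "1 \<le> j \<Longrightarrow> j \<le> i \<Longrightarrow> i < n \<Longrightarrow> g (Suc i) j \<le> g i j"
    and "1 \<le> j \<Longrightarrow> j \<le> i \<Longrightarrow> i < n \<Longrightarrow> g i j \<le> g (Suc i) (Suc j)"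
    and "\<not> (1 \<le> j \<and> j \<le> i \<and> i \<le> n) \<Longrightarrow> g i j = 0"
  using assms unfolding patterns_def by auto

lemma patternsI:
  assumes "\<And>j. 1 \<le> j \<Longrightarrow> j \<le> n \<Longrightarrow> g n j = t j"
    and "\<And>i j. 1 \<le> j \<Longrightarrow> j \<le> i \<Longrightarrow> i < n \<Longrightarrow> g (Suc i) j \<le> g i j"
    and "\<And>i j. 1 \<le> j \<Longrightarrow> j \<le> i \<Longrightarrow> i < n \<Longrightarrow> g i j \<le> g (Suc i) (Suc j)"
    and "\<And>i j. \<not> (1 \<le> j \<and> j \<le> i \<and> i \<le> n) \<Longrightarrow> g i j = 0"
  shows "g \<in> patterns n t"
  unfolding patterns_def mem_Collect_eq by (intro conjI ballI allI impI) (use assms in auto)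

lemma sl_patterns_eq:
  "n \<ge> 1 \<Longrightarrow> sl_patterns n a = patterns n (\<lambda>j. \<Sum>k=n+1-j..n-1. int (a k))"
  unfolding sl_patterns_def patterns_def
  by (intro Collect_cong conj_cong refl all_cong iff_allI imp_cong) auto

text \<open>The interlacing inequalities are chained along the two diagonals up to row
  \<open>n\<close>. For increasing \<open>t\<close> the lower bounds are attained together by
  \<open>bottom\<close>, the upper ones by \<open>top\<close>.\<close>

lemma pattern_bounds:
  assumes g: "g \<in> patterns n t" and "i \<le> n" "1 \<le> j" "j \<le> i"
  shows "t j \<le> g i j" and "g i j \<le> t (j + n - i)"
proof -
  have "\<forall>j. 1 \<le> j \<and> j \<le> i \<longrightarrow> t j \<le> g i j \<and> g i j \<le> t (j + n - i)"
    using \<open>i \<le> n\<close>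
  proof (induction rule: inc_induct)
    case base
    then show ?case using patternsD(1)[OF g] by auto
  next
    case (step i)
    have "t j \<le> g i j \<and> g i j \<le> t (j + n - i)" if "1 \<le> j" "j \<le> i" for j
    proof -
      have "t j \<le> g (Suc i) j" "g (Suc i) (Suc j) \<le> t (Suc j + n - Suc i)"
        using step that by auto
      with patternsD(2,3)[OF g that] step show ?thesis by fastforce
    qed
    then show ?case by blast
  qed
  then show "t j \<le> g i j" "g i j \<le> t (j + n - i)" using assms by auto
qed

lemma finite_patterns: "finite (patterns n t)"
proof -
  define B where "B = insert 0 {Min (t ` {1..n})..Max (t ` {1..n})}"
  define H where "H = {h :: nat \<Rightarrow> int. \<forall>j. (j \<in> {1..n} \<longrightarrow> h j \<in> B) \<and> (j \<notin> {1..n} \<longrightarrow> h j = 0)}"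
  have "finite H"
    unfolding H_def by (rule finite_set_of_finite_funs) (auto simp: B_def)
  then have "finite {g. \<forall>i. (i \<in> {..n} \<longrightarrow> g i \<in> H) \<and> (i \<notin> {..n} \<longrightarrow> g i = (\<lambda>_. 0))}"
    by (intro finite_set_of_finite_funs) auto
  moreover have "g i j \<in> B" if g: "g \<in> patterns n t" for g i j
  proof (cases "1 \<le> j \<and> j \<le> i \<and> i \<le> n")
    case True
    then have "t j \<le> g i j" "g i j \<le> t (j + n - i)"
      using pattern_bounds[OF g] by auto
    moreover have "Min (t ` {1..n}) \<le> t j" "t (j + n - i) \<le> Max (t ` {1..n})"
      using True by (auto intro!: Min_le Max_ge imageI)
    ultimately show ?thesis by (auto simp: B_def)
  next
    case False
    then show ?thesis using patternsD(4)[OF g] by (auto simp: B_def)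
  qed
  then have "patterns n t \<subseteq> {g. \<forall>i. (i \<in> {..n} \<longrightarrow> g i \<in> H) \<and> (i \<notin> {..n} \<longrightarrow> g i = (\<lambda>_. 0))}"
    unfolding H_def by (auto simp: patternsD(4))
  ultimately show ?thesis by (rule finite_subset[rotated])
qed

text \<open>For the exponents 0, 1, 2, ... every interval of the branching rule has one element,
  which leaves the Vandermonde recursion. So the prefactor of the branching rule is just what turns
  the denominator for n variables into the one for n + 1.\<close>

lemma power_det_Suc_id:
  "power_det (Suc n) x (\<lambda>j. j) = (\<Prod>i<n. x n - x i) * power_det n x (\<lambda>j. j)"
proof -
  define r where "r = (\<lambda>j\<in>{..<n}. j)"
  have r: "r j = j" if "j < n" for j
    using that by (simp add: r_def)
  have "(\<Pi>\<^sub>E j\<in>{..<n}. {j..<Suc j}) = (\<Pi>\<^sub>E j\<in>{..<n}. {r j})"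
    by (intro PiE_cong) (auto simp: r)
  also have "\<dots> = {r}"
    by (rule PiE_singleton) (auto simp: r_def extensional_def)
  finally have "power_det (Suc n) x (\<lambda>j. j) =
      (\<Prod>i<n. x n - x i) * (x n ^ (0 + (\<Sum>j<n. Suc j - 1 - r j)) * power_det n x r)"
    by (simp only: power_det_branching[of n "\<lambda>j. j"] le_SucI order.refl sum.insert finite.emptyI
        empty_iff if_False sum.empty add_0_right simp_thms)
  also have "(\<Sum>j<n. Suc j - 1 - r j) = 0"
    by (intro sum.neutral) (simp add: r)
  also have "power_det n x r = power_det n x (\<lambda>j. j)"
    by (intro power_det_cong) (simp_all add: r)
  finally show ?thesis by simp
qed

lemma power_det_id: "power_det n x (\<lambda>j. j) = (\<Prod>j<n. \<Prod>i<j. x j - x i)"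
  by (induction n) (simp_all add: power_det_Suc_id mult.commute)

lemma nonneg_if_Suc_mono:
  fixes t :: "nat \<Rightarrow> int"
  assumes mono: "\<And>j. 1 \<le> j \<Longrightarrow> j < n \<Longrightarrow> t j \<le> t (Suc j)" and t: "0 \<le> t 1"
  shows "1 \<le> j \<Longrightarrow> j \<le> n \<Longrightarrow> 0 \<le> t j"
proof (induction j rule: nat_induct_at_least)
  case (Suc j)
  then show ?case using mono[of j] by simp
qed (use t in simp)

text \<open>The strictly increasing exponents \<open>m\<close> in the branching rule encode the second row of a pattern,
  shifted by \<open>0, 1, 2, \<dots>\<close>.\<close>

lemma sum_patterns_Suc:
  fixes F :: "(nat \<Rightarrow> nat \<Rightarrow> int) \<Rightarrow> 'a::comm_monoid_add"
  assumes mono: "\<And>j. 1 \<le> j \<Longrightarrow> j \<le> n \<Longrightarrow> t j \<le> t (Suc j)" and t: "0 \<le> t 1"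
  defines "rw \<equiv> \<lambda>m j. int (m (j - 1)) - int (j - 1)"
    and "add_row \<equiv> \<lambda>g :: nat \<Rightarrow> nat \<Rightarrow> int. g(Suc n := \<lambda>j. if 1 \<le> j \<and> j \<le> Suc n then t j else 0)"
  shows "(\<Sum>g\<in>patterns (Suc n) t. F g) =
    (\<Sum>m\<in>(\<Pi>\<^sub>E j\<in>{..<n}. {nat (t (Suc j)) + j..<nat (t (Suc (Suc j))) + Suc j}).
       \<Sum>g\<in>patterns n (rw m). F (add_row g))"
proof -
  have tpos: "0 \<le> t j" if "1 \<le> j" "j \<le> Suc n" for j
    by (rule nonneg_if_Suc_mono[of "Suc n" t]) (use mono t that in auto)
  let ?M = "\<Pi>\<^sub>E j\<in>{..<n}. {nat (t (Suc j)) + j..<nat (t (Suc (Suc j))) + Suc j}"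
  have M: "t j \<le> rw m j \<and> rw m j \<le> t (Suc j)" if m: "m \<in> ?M" and j: "1 \<le> j" "j \<le> n" for m j
  proof -
    have "m (j - 1) \<in> {nat (t (Suc (j - 1))) + (j - 1)..<nat (t (Suc (Suc (j - 1)))) + Suc (j - 1)}"
      using m j by (intro PiE_mem[OF m]) auto
    then show ?thesis using j tpos[of j] tpos[of "Suc j"] by (auto simp: rw_def)
  qed
  have add_row: "add_row g \<in> patterns (Suc n) t" if m: "m \<in> ?M" and g: "g \<in> patterns n (rw m)" for m g
  proof (rule patternsI)
    fix i j assume ij: "1 \<le> j" "j \<le> i" "i < Suc n"
    have gn: "g n j = rw m j" if "i = n" using g ij that by (auto simp: patternsD(1))
    show "add_row g (Suc i) j \<le> add_row g i j"
      using ij M[OF m, of j] gn patternsD(2)[OF g, of j i] by (cases "i = n") (auto simp: add_row_def)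
    show "add_row g i j \<le> add_row g (Suc i) (Suc j)"
      using ij M[OF m, of j] gn patternsD(3)[OF g, of j i] by (cases "i = n") (auto simp: add_row_def)
  qed (use patternsD(4)[OF g] in \<open>auto simp: add_row_def\<close>)
  have "(\<Sum>m\<in>?M. \<Sum>g\<in>patterns n (rw m). F (add_row g)) =
      (\<Sum>(m, g)\<in>Sigma ?M (\<lambda>m. patterns n (rw m)). F (add_row g))"
    by (intro sum.Sigma finite_PiE ballI finite_patterns) auto
  also have "\<dots> = (\<Sum>g\<in>patterns (Suc n) t. F g)"
  proof (rule sum.reindex_bij_witness)
    fix mg assume "mg \<in> Sigma ?M (\<lambda>m. patterns n (rw m))"
    then obtain m g where mg: "mg = (m, g)" and m: "m \<in> ?M" and g: "g \<in> patterns n (rw m)" by auto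
    show "(case mg of (m, g) \<Rightarrow> add_row g) \<in> patterns (Suc n) t" using add_row[OF m g] by (simp add: mg)
    have "g (Suc n) = (\<lambda>_. 0)" using patternsD(4)[OF g, of _ "Suc n"] by auto
    then have "(add_row g)(Suc n := \<lambda>_. 0) = g" by (auto simp: add_row_def)
    moreover have "(\<lambda>j\<in>{..<n}. nat (add_row g n (Suc j)) + j) = m"
    proof
      fix j show "(\<lambda>j\<in>{..<n}. nat (add_row g n (Suc j)) + j) j = m j"
      proof (cases "j < n")
        case True
        then have "add_row g n (Suc j) = rw m (Suc j)" using patternsD(1)[OF g, of "Suc j"] by (simp add: add_row_def)
        moreover have "0 \<le> rw m (Suc j)" using M[OF m, of "Suc j"] tpos[of "Suc j"] True by auto
        ultimately show ?thesis using True by (simp add: rw_def)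
      qed (use m in \<open>auto simp: PiE_iff extensional_def\<close>)
    qed
    ultimately show "(\<lambda>g. (\<lambda>j\<in>{..<n}. nat (g n (Suc j)) + j, g(Suc n := \<lambda>_. 0))) (case mg of (m, g) \<Rightarrow> add_row g) = mg"
      by (simp add: mg)
  next
    fix g assume g: "g \<in> patterns (Suc n) t"
    define m where "m = (\<lambda>j\<in>{..<n}. nat (g n (Suc j)) + j)"
    have gn: "t j \<le> g n j" "g n j \<le> t (Suc j)" if "1 \<le> j" "j \<le> n" for j
      using patternsD(2,3)[OF g, of j n] patternsD(1)[OF g] that by auto
    have "m \<in> ?M"
    proof (rule PiE_I)
      fix j assume "j \<in> {..<n}"
      then show "m j \<in> {nat (t (Suc j)) + j..<nat (t (Suc (Suc j))) + Suc j}"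
        using gn[of "Suc j"] tpos[of "Suc j"] by (auto simp: m_def)
    qed (auto simp: m_def)
    moreover have "g(Suc n := \<lambda>_. 0) \<in> patterns n (rw m)"
    proof (rule patternsI)
      fix j assume "1 \<le> j" "j \<le> n"
      then show "(g(Suc n := \<lambda>_. 0)) n j = rw m j"
        using gn(1)[of j] tpos[of j] by (auto simp: rw_def m_def)
    qed (use patternsD(2-4)[OF g] in auto)
    ultimately show "(\<lambda>j\<in>{..<n}. nat (g n (Suc j)) + j, g(Suc n := \<lambda>_. 0)) \<in> Sigma ?M (\<lambda>m. patterns n (rw m))"
      by (simp add: m_def)
    have "g (Suc n) = (\<lambda>j. if 1 \<le> j \<and> j \<le> Suc n then t j else 0)"
      using patternsD(1,4)[OF g] by (intro HOL.ext) auto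
    then show "(case (\<lambda>j\<in>{..<n}. nat (g n (Suc j)) + j, g(Suc n := \<lambda>_. 0)) of (m, g) \<Rightarrow> add_row g) = g"
      by (auto simp: add_row_def fun_eq_iff)
  qed auto
  finally show ?thesis by simp
qed

text \<open>The sum is the Schur polynomial of the partition with parts \<open>t\<close>, listed
  increasingly, and stating it as a product avoids division. \<open>nat\<close> loses nothing, since
  nonnegative entries make the row sums increase.\<close>

theorem power_det_eq_sum_patterns:
  assumes mono: "\<And>j. 1 \<le> j \<Longrightarrow> j < n \<Longrightarrow> t j \<le> t (Suc j)" and t: "n > 0 \<Longrightarrow> 0 \<le> t 1"
  shows "power_det n x (\<lambda>j. nat (t (Suc j)) + j) = power_det n x (\<lambda>j. j) *
    (\<Sum>g\<in>patterns n t. \<Prod>k<n. x k ^ nat (row_sum g (Suc k) - row_sum g k))"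
  using assms
proof (induction n arbitrary: t)
  case 0
  have "patterns 0 t = {\<lambda>_ _. 0}"
    by (auto simp: patterns_def fun_eq_iff)
  then show ?case by simp
next
  case (Suc n)
  define l where "l = (\<lambda>j. nat (t (Suc j)) + j)"
  define rw where "rw = (\<lambda>m j. int (m (j - 1)) - int (j - 1))"
  define add_row where "add_row = (\<lambda>g :: nat \<Rightarrow> nat \<Rightarrow> int. g(Suc n := \<lambda>j. if 1 \<le> j \<and> j \<le> Suc n then t j else 0))"
  have tpos: "0 \<le> t j" if "1 \<le> j" "j \<le> Suc n" for j
    by (rule nonneg_if_Suc_mono[of "Suc n" t]) (use Suc.prems that in auto)
  have l: "l j \<le> l (Suc j)" if "j < n" for j
    using Suc.prems(1)[of "Suc j"] that by (auto simp: l_def)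
  let ?M = "\<Pi>\<^sub>E j\<in>{..<n}. {l j..<l (Suc j)}"
  have summand: "x n ^ (l 0 + (\<Sum>j<n. l (Suc j) - 1 - m j)) * power_det n x m =
      power_det n x (\<lambda>j. j) *
      (\<Sum>g\<in>patterns n (rw m). \<Prod>k<Suc n. x k ^ nat (row_sum (add_row g) (Suc k) - row_sum (add_row g) k))"
    if m: "m \<in> ?M" for m
  proof -
    have mj: "l j \<le> m j" "m j < l (Suc j)" if "j < n" for j
      using PiE_mem[OF m, of j] that by auto
    have rw: "0 \<le> rw m j" if "1 \<le> j" "j \<le> n" for j
    proof -
      have "l (j - 1) \<le> m (j - 1)" using that by (intro mj(1)) auto
      then show ?thesis by (simp add: rw_def l_def)
    qed
    have "power_det n x m = power_det n x (\<lambda>j. nat (rw m (Suc j)) + j)"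
    proof (rule power_det_cong)
      fix j assume "j < n"
      then show "m j = nat (rw m (Suc j)) + j" using mj[of j] by (auto simp: rw_def l_def)
    qed simp
    also have "\<dots> = power_det n x (\<lambda>j. j) *
      (\<Sum>g\<in>patterns n (rw m). \<Prod>k<n. x k ^ nat (row_sum g (Suc k) - row_sum g k))"
    proof (rule Suc.IH)
      fix j assume "1 \<le> j" "j < n"
      then show "rw m j \<le> rw m (Suc j)"
        using mj(2)[of "j - 1"] mj(1)[of j] less_imp_diff_less[of j n 1] by (simp add: rw_def)
    qed (use rw in auto)
    finally have *: "power_det n x m = \<dots>" .
    have "x n ^ (l 0 + (\<Sum>j<n. l (Suc j) - 1 - m j)) *
        (\<Prod>k<n. x k ^ nat (row_sum g (Suc k) - row_sum g k)) =
      (\<Prod>k<Suc n. x k ^ nat (row_sum (add_row g) (Suc k) - row_sum (add_row g) k))"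
      if g: "g \<in> patterns n (rw m)" for g
    proof -
      \<comment> \<open>No subtraction of naturals truncates, because
        \<open>m j < l (Suc j)\<close>; the summands are differences of interlaced entries of two
        rows.\<close>
      have "int (\<Sum>j<n. l (Suc j) - 1 - m j) = (\<Sum>j<n. t (Suc (Suc j)) - rw m (Suc j))"
        unfolding of_nat_sum
      proof (rule sum.cong)
        fix j assume "j \<in> {..<n}"
        then show "int (l (Suc j) - 1 - m j) = t (Suc (Suc j)) - rw m (Suc j)"
          using mj[of j] tpos[of "Suc (Suc j)"] by (simp add: l_def rw_def)
      qed simp
      then have "int (l 0 + (\<Sum>j<n. l (Suc j) - 1 - m j)) =
          (\<Sum>j<Suc n. t (Suc j)) - (\<Sum>j<n. rw m (Suc j))"
        using tpos[of 1] by (simp add: sum_subtractf l_def sum.lessThan_Suc_shift del: sum.lessThan_Suc)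
      moreover have "row_sum (add_row g) (Suc n) = (\<Sum>j<Suc n. t (Suc j))"
        unfolding row_sum_def by (rule sum.reindex_bij_witness[of _ Suc "\<lambda>j. j - 1"]) (auto simp: add_row_def)
      moreover have "row_sum (add_row g) n = (\<Sum>j<n. rw m (Suc j))"
        unfolding row_sum_def
        by (rule sum.reindex_bij_witness[of _ Suc "\<lambda>j. j - 1"]) (auto simp: add_row_def patternsD(1)[OF g])
      ultimately have "l 0 + (\<Sum>j<n. l (Suc j) - 1 - m j) = nat (row_sum (add_row g) (Suc n) - row_sum (add_row g) n)"
        by linarith
      moreover have "row_sum (add_row g) k = row_sum g k" if "k \<le> n" for k
        using that by (simp add: row_sum_def add_row_def)
      ultimately show ?thesis by (simp add: mult.commute)
    qed
    then show ?thesis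
      unfolding * by (simp add: sum_distrib_left mult.left_commute)
  qed
  have "power_det (Suc n) x l = (\<Prod>i<n. x n - x i) * (\<Sum>m\<in>?M. power_det n x (\<lambda>j. j) *
      (\<Sum>g\<in>patterns n (rw m). \<Prod>k<Suc n. x k ^ nat (row_sum (add_row g) (Suc k) - row_sum (add_row g) k)))"
    using l by (simp only: power_det_branching sum.cong[OF refl summand])
  also have "\<dots> = power_det (Suc n) x (\<lambda>j. j) * (\<Sum>m\<in>?M.
      (\<Sum>g\<in>patterns n (rw m). \<Prod>k<Suc n. x k ^ nat (row_sum (add_row g) (Suc k) - row_sum (add_row g) k)))"
    by (simp only: power_det_Suc_id sum_distrib_left mult.assoc)
  also have "(\<Sum>m\<in>?M.
      (\<Sum>g\<in>patterns n (rw m). \<Prod>k<Suc n. x k ^ nat (row_sum (add_row g) (Suc k) - row_sum (add_row g) k))) =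
     (\<Sum>g\<in>patterns (Suc n) t. \<Prod>k<Suc n. x k ^ nat (row_sum g (Suc k) - row_sum g k))"
    unfolding l_def rw_def add_row_def
    by (rule sum_patterns_Suc[symmetric]) (use Suc.prems in auto)
  finally show ?case by (simp only: l_def)
qed

section \<open>Covering relations and ranks\<close>

text \<open>From every vertex a chain of edges climbs to \<open>T\<close>, so the graph is
  connected; climbing from \<open>B\<close> shows that all values up to \<open>l\<close> occur.
  Hence the rank function is unique and \<open>rank_of\<close> and \<open>length_of\<close> can be
  evaluated, both for the whole poset and for a component in one colour.\<close>

lemma rank_of_raising:
  assumes le: "\<And>x. x \<in> V \<Longrightarrow> \<rho> x \<le> l"
    and T: "T \<in> V" "\<rho> T = l" and B: "B \<in> V" "\<rho> B = 0"
    and E: "\<And>x y. x \<in> V \<Longrightarrow> y \<in> V \<Longrightarrow> E x y \<Longrightarrow> \<rho> y = \<rho> x + 1"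
    and raise: "\<And>x. x \<in> V \<Longrightarrow> x \<noteq> T \<Longrightarrow> \<exists>y\<in>V. E x y"
  shows "is_rank_function V E \<rho> l"
    and "length_of V E = l"
    and "x \<in> V \<Longrightarrow> rank_of V E x = \<rho> x"
    and "x \<in> V \<Longrightarrow> y \<in> V \<Longrightarrow> (\<lambda>u v. u \<in> V \<and> v \<in> V \<and> (E u v \<or> E v u))\<^sup>*\<^sup>* x y"
proof -
  have hit: "\<exists>x\<in>V. \<rho> x = k" if "k \<le> l" for k
    using that
  proof (induction k)
    case (Suc k)
    then obtain x where x: "x \<in> V" "\<rho> x = k" by auto
    then have "x \<noteq> T" using T Suc.prems by auto
    then obtain y where "y \<in> V" "E x y" using raise x by auto
    then show ?case using E x by auto
  qed (use B in auto)
  have "\<rho> ` V = {0..l}" using le hit by (auto simp: image_iff) metis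
  then show rk: "is_rank_function V E \<rho> l" using E by (auto simp: is_rank_function_def)
  let ?C = "\<lambda>u v. u \<in> V \<and> v \<in> V \<and> (E u v \<or> E v u)"
  have top: "?C\<^sup>*\<^sup>* x T" if "x \<in> V" for x
    using that
  proof (induction "l - \<rho> x" arbitrary: x rule: less_induct)
    case less
    show ?case
    proof (cases "x = T")
      case False
      then obtain y where y: "y \<in> V" "E x y" using raise less by auto
      then have "\<rho> y = \<rho> x + 1" "\<rho> y \<le> l" using E[OF less(2) y] le[OF y(1)] by auto
      then have "?C\<^sup>*\<^sup>* y T" using less y by auto
      then show ?thesis using y less by (intro converse_rtranclp_into_rtranclp[of ?C x y T]) auto
    qed simp
  qed
  have sym: "symp ?C" by (auto intro: sympI)
  have conn: "?C\<^sup>*\<^sup>* x y" if "x \<in> V" "y \<in> V" for x y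
    using top[OF that(1)] sympD[OF symp_rtranclp[OF sym] top[OF that(2)]] by (rule rtranclp_trans)
  then show "x \<in> V \<Longrightarrow> y \<in> V \<Longrightarrow> ?C\<^sup>*\<^sup>* x y" .
  show "length_of V E = l"
    unfolding length_of_def
  proof (rule the_equality)
    fix l' assume "\<exists>\<rho>. is_rank_function V E \<rho> l'"
    then show "l' = l" using rank_function_unique(1)[OF rk _ conn] by metis
  qed (use rk in blast)
  show "rank_of V E x = \<rho> x" if "x \<in> V"
    unfolding rank_of_def
  proof (rule the_equality)
    fix r assume "\<exists>\<rho> l. is_rank_function V E \<rho> l \<and> \<rho> x = r"
    then show "r = \<rho> x" using rank_function_unique(2)[OF rk _ conn that] by metis
  qed (use rk in blast)
qed

section \<open>Single-entry moves and the covering relation\<close>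

definition raise :: "(nat \<Rightarrow> nat \<Rightarrow> int) \<Rightarrow> nat \<Rightarrow> nat \<Rightarrow> nat \<Rightarrow> nat \<Rightarrow> int" where
  "raise g i j = g(i := (g i)(j := g i j + 1))"

lemma raise_apply: "raise g i j k l = (if k = i \<and> l = j then g i j + 1 else g k l)"
  by (simp add: raise_def)

lemma raise_inj: "raise g i j = raise g k l \<longleftrightarrow> i = k \<and> j = l"
proof
  assume "raise g i j = raise g k l"
  then have "raise g i j i j = raise g k l i j" by simp
  then show "i = k \<and> j = l" by (auto simp: raise_apply split: if_splits)
qed simp

lemma pattern_color_raise: "pattern_color g (raise g i j) = i"
  unfolding pattern_color_def raise_def[symmetric] by (auto simp: raise_inj)

lemma less_raise: "g < raise g i j"
proof -
  have "g \<le> raise g i j" by (auto simp: le_fun_def raise_apply)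
  moreover have "\<not> raise g i j \<le> g"
  proof
    assume "raise g i j \<le> g"
    then have "raise g i j i j \<le> g i j" by (auto simp: le_fun_def)
    then show False by (simp add: raise_apply)
  qed
  ultimately show ?thesis by (simp add: less_le_not_le)
qed

lemma nothing_between_raise:
  assumes "g < h" "h \<le> raise g i j" shows "h = raise g i j"
proof -
  have le: "g k l \<le> h k l" "h k l \<le> raise g i j k l" for k l
    using assms by (auto simp: le_fun_def less_le_not_le)
  have eq: "h k l = g k l" if "\<not> (k = i \<and> l = j)" for k l
    using le[of k l] that by (simp add: raise_apply split: if_splits)
  have "h i j \<noteq> g i j"
  proof
    assume "h i j = g i j"
    then have "h k l = g k l" for k l using eq[of k l] by auto
    then have "h = g" by (auto simp: fun_eq_iff)
    then show False using assms by simp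
  qed
  then have "h i j = g i j + 1" using le[of i j] by (simp add: raise_apply)
  then show ?thesis using eq by (auto simp: fun_eq_iff raise_apply)
qed

text \<open>Row \<open>n\<close> and the entries outside the triangle are prescribed, so only the
  remaining entries can move.\<close>

lemma raise_position:
  assumes g: "g \<in> patterns n t" and h: "raise g i j \<in> patterns n t"
  shows "1 \<le> j" "j \<le> i" "i < n"
proof -
  have "1 \<le> j \<and> j \<le> i \<and> i \<le> n"
    using patternsD(4)[OF g, of j i] patternsD(4)[OF h, of j i] by (auto simp: raise_apply)
  moreover have "i \<noteq> n"
    using patternsD(1)[OF g, of j] patternsD(1)[OF h, of j] calculation by (auto simp: raise_apply)
  ultimately show "1 \<le> j" "j \<le> i" "i < n" by auto
qed

lemma raise_in_patterns:
  assumes g: "g \<in> patterns n t" and pos: "1 \<le> j" "j \<le> i" "i < n"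
    and lt: "g i j < g (Suc i) (Suc j)" "j < i \<Longrightarrow> g i j < g (i - 1) j"
  shows "raise g i j \<in> patterns n t"
proof (rule patternsI)
  fix k l assume kl: "1 \<le> l" "l \<le> k" "k < n"
  show "raise g i j (Suc k) l \<le> raise g i j k l"
    using patternsD(2)[OF g kl] lt(2) kl by (auto simp: raise_apply)
  show "raise g i j k l \<le> raise g i j (Suc k) (Suc l)"
    using patternsD(3)[OF g kl] lt(1) kl by (auto simp: raise_apply)
qed (use patternsD(1,4)[OF g] pos in \<open>auto simp: raise_apply\<close>)

text \<open>Among the entries where \<open>s\<close> lies strictly below \<open>u\<close>, one with \<open>2j - i\<close> maximal can be raised:
  both inequalities that might forbid it lead to entries with a larger value of \<open>2j - i\<close>.\<close>

lemma exists_raise_le: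
  assumes s: "s \<in> patterns n t" and u: "u \<in> patterns n t" and "s < u"
  shows "\<exists>i j. raise s i j \<in> patterns n t \<and> raise s i j \<le> u"
proof -
  define D where "D = {(i, j). 1 \<le> j \<and> j \<le> i \<and> i < n \<and> s i j < u i j}"
  have le: "s i j \<le> u i j" for i j using \<open>s < u\<close> by (auto simp: less_le_not_le le_fun_def)
  have outside: "s i j = u i j" if "\<not> (1 \<le> j \<and> j \<le> i \<and> i < n)" for i j
  proof (cases "1 \<le> j \<and> j \<le> i \<and> i \<le> n")
    case True
    then show ?thesis using that patternsD(1)[OF s, of j] patternsD(1)[OF u, of j] by (cases "i = n") auto
  qed (simp add: patternsD(4)[OF s] patternsD(4)[OF u])
  have "\<exists>i j. s i j \<noteq> u i j" using \<open>s < u\<close> by (metis less_irrefl HOL.ext)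
  then obtain i0 j0 where "s i0 j0 \<noteq> u i0 j0" by auto
  then have "(i0, j0) \<in> D" using le[of i0 j0] outside[of j0 i0] by (auto simp: D_def)
  \<comment> \<open>The added \<open>n\<close> keeps 2j - i from truncating in the naturals; on
    \<open>D\<close> the value stays below 3n + 1.\<close>
  then have "\<exists>p. p \<in> D \<and> (\<forall>q. q \<in> D \<longrightarrow> 2 * snd q + n - fst q \<le> 2 * snd p + n - fst p)"
    by (intro ex_has_greatest_nat[of _ _ _ "3 * n + 1"]) (auto simp: D_def)
  then obtain i j where ij: "(i, j) \<in> D"
    and max: "\<And>k l. (k, l) \<in> D \<Longrightarrow> 2 * l + n - k \<le> 2 * j + n - i" by auto
  have pos: "1 \<le> j" "j \<le> i" "i < n" and lt: "s i j < u i j" using ij by (auto simp: D_def)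
  have up: "s i j < s (Suc i) (Suc j)"
  proof (rule ccontr)
    assume "\<not> ?thesis"
    then have "s i j = s (Suc i) (Suc j)" using patternsD(3)[OF s pos] by simp
    moreover have "u i j \<le> u (Suc i) (Suc j)" using patternsD(3)[OF u pos] .
    ultimately have "(Suc i, Suc j) \<in> D" using lt pos outside[of "Suc j" "Suc i"] by (force simp: D_def)
    then show False using max[of "Suc i" "Suc j"] pos by auto
  qed
  have dn: "s i j < s (i - 1) j" if "j < i"
  proof (rule ccontr)
    assume "\<not> ?thesis"
    moreover have "Suc (i - 1) = i" "j \<le> i - 1" "i - 1 < n" using that pos by auto
    ultimately have "s i j = s (i - 1) j" "u i j \<le> u (i - 1) j"
      using patternsD(2)[OF s, of j "i - 1"] patternsD(2)[OF u, of j "i - 1"] pos by auto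
    then have "(i - 1, j) \<in> D" using lt pos that by (auto simp: D_def)
    then show False using max[of "i - 1" j] pos that by auto
  qed
  have "raise s i j \<in> patterns n t"
    using up dn by (rule raise_in_patterns[OF s pos])
  moreover have "raise s i j \<le> u"
    using le lt by (auto simp: le_fun_def raise_apply)
  ultimately show ?thesis by blast
qed

text \<open>Every strict inequality between patterns starts with a single raise, by
  \<open>exists_raise_le\<close>, so a covering can only be that raise.\<close>

lemma covers_patterns_iff:
  "covers (patterns n t) s u \<longleftrightarrow> s \<in> patterns n t \<and> u \<in> patterns n t \<and> (\<exists>i j. u = raise s i j)"
proof (intro iffI conjI)
  assume c: "covers (patterns n t) s u"
  then show su: "s \<in> patterns n t" "u \<in> patterns n t" by (auto simp: covers_def)
  obtain i j where ij: "raise s i j \<in> patterns n t" "raise s i j \<le> u"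
    using c exists_raise_le[OF su] by (auto simp: covers_def)
  then have "u = raise s i j"
    using c less_raise[of s i j] by (auto simp: covers_def order.order_iff_strict)
  then show "\<exists>i j. u = raise s i j" by blast
next
  assume "s \<in> patterns n t \<and> u \<in> patterns n t \<and> (\<exists>i j. u = raise s i j)"
  then show "covers (patterns n t) s u"
    using less_raise[of s] nothing_between_raise[of s] unfolding covers_def
    by (metis less_imp_le less_irrefl)
qed

lemma color_edge_patterns_iff:
  "color_edge (patterns n t) pattern_color i s u \<longleftrightarrow>
     s \<in> patterns n t \<and> u \<in> patterns n t \<and> (\<exists>j. u = raise s i j)"
  by (auto simp: color_edge_def covers_patterns_iff pattern_color_raise)

lemma row_sum_raise:
  assumes "1 \<le> j" "j \<le> i" shows "row_sum (raise g i j) k = row_sum g k + (if k = i then 1 else 0)"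
proof (cases "k = i")
  case True
  have "row_sum (raise g i j) i = (\<Sum>l=1..i. g i l + (if l = j then 1 else 0))"
    unfolding row_sum_def by (intro sum.cong) (auto simp: raise_apply)
  also have "\<dots> = row_sum g i + 1" using assms by (simp add: sum.distrib row_sum_def)
  finally show ?thesis using True by simp
qed (simp add: row_sum_def raise_apply)

definition total :: "nat \<Rightarrow> (nat \<Rightarrow> nat \<Rightarrow> int) \<Rightarrow> int" where
  "total n g = (\<Sum>i=1..<n. row_sum g i)"

lemma total_raise:
  assumes "1 \<le> j" "j \<le> i" "i < n" shows "total n (raise g i j) = total n g + 1"
  using assms by (simp add: total_def row_sum_raise sum.distrib)

lemma total_mono: "(\<And>i j. 1 \<le> j \<Longrightarrow> j \<le> i \<Longrightarrow> i < n \<Longrightarrow> g i j \<le> h i j) \<Longrightarrow> total n g \<le> total n h"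
  unfolding total_def row_sum_def by (intro sum_mono) auto

lemma inf_sup_patterns:
  assumes g: "g \<in> patterns n t" and h: "h \<in> patterns n t"
  shows "inf g h \<in> patterns n t" "sup g h \<in> patterns n t"
proof -
  have z: "g i j = 0 \<and> h i j = 0" if "\<not> (1 \<le> j \<and> j \<le> i \<and> i \<le> n)" for i j
    using patternsD(4)[OF g that] patternsD(4)[OF h that] by simp
  note d = patternsD(1-3)[OF g] patternsD(1-3)[OF h]
  show "inf g h \<in> patterns n t"
  proof (rule patternsI)
    fix i j assume ij: "1 \<le> j" "j \<le> i" "i < n"
    show "inf g h (Suc i) j \<le> inf g h i j" "inf g h i j \<le> inf g h (Suc i) (Suc j)"
      using d(2,3,5,6)[OF ij] by (auto simp: inf_min)
  qed (use d(1,4) z in simp_all)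
  show "sup g h \<in> patterns n t"
  proof (rule patternsI)
    fix i j assume ij: "1 \<le> j" "j \<le> i" "i < n"
    show "sup g h (Suc i) j \<le> sup g h i j" "sup g h i j \<le> sup g h (Suc i) (Suc j)"
      using d(2,3,5,6)[OF ij] by (auto simp: sup_max)
  qed (use d(1,4) z in simp_all)
qed

text \<open>The operations are inherited from the ambient lattice. The point is that the abstract
  join and meet, chosen as some least upper and some greatest lower bound, agree with
  \<open>sup\<close> and \<open>inf\<close>; this is uniqueness of such bounds.\<close>

lemma distributive_lattice_closed:
  fixes R :: "'a::{distrib_lattice} set"
  assumes "\<And>x y. x \<in> R \<Longrightarrow> y \<in> R \<Longrightarrow> inf x y \<in> R" "\<And>x y. x \<in> R \<Longrightarrow> y \<in> R \<Longrightarrow> sup x y \<in> R"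
  shows "distributive_lattice R"
proof -
  define L where "L = \<lparr>carrier = R, eq = ((=) :: 'a \<Rightarrow> 'a \<Rightarrow> bool), le = ((\<le>) :: 'a \<Rightarrow> 'a \<Rightarrow> bool)\<rparr>"
  have L_carrier: "carrier L = R" by (simp add: L_def)
  interpret L: partial_order L
    by unfold_locales (auto simp: L_def)
  have lub: "least L (sup x y) (Upper L {x, y})" and glb: "greatest L (inf x y) (Lower L {x, y})"
    if "x \<in> R" "y \<in> R" for x y
    using assms that by (auto simp: least_def greatest_def Upper_def Lower_def L_def)
  interpret L: Lattice.lattice L
    by unfold_locales (metis L_carrier lub glb)+
  have "x \<squnion>\<^bsub>L\<^esub> y = sup x y" "x \<sqinter>\<^bsub>L\<^esub> y = inf x y" if "x \<in> R" "y \<in> R" for x y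
  proof -
    have eq: "a = b" if "a .=\<^bsub>L\<^esub> b" for a b using that by (simp add: L_def)
    show "x \<squnion>\<^bsub>L\<^esub> y = sup x y"
      using that lub L.sup_of_two_least unfolding join_def L_carrier
      by (intro eq L.weak_least_unique) auto
    show "x \<sqinter>\<^bsub>L\<^esub> y = inf x y"
      using that glb L.inf_of_two_greatest unfolding meet_def L_carrier
      by (intro eq L.weak_greatest_unique) auto
  qed
  then show ?thesis
    unfolding distributive_lattice_def Let_def L_def[symmetric]
    using assms L.lattice_axioms by (simp add: inf_sup_distrib1)
qed

section \<open>Extreme patterns, ranks and components in one colour\<close>

locale pattern_poset =
  fixes n :: nat and t :: "nat \<Rightarrow> int"
  assumes mono: "\<And>j. 1 \<le> j \<Longrightarrow> j < n \<Longrightarrow> t j \<le> t (Suc j)"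
begin

definition bottom :: "nat \<Rightarrow> nat \<Rightarrow> int" where
  "bottom i j = (if 1 \<le> j \<and> j \<le> i \<and> i \<le> n then t j else 0)"

definition top :: "nat \<Rightarrow> nat \<Rightarrow> int" where
  "top i j = (if 1 \<le> j \<and> j \<le> i \<and> i \<le> n then t (j + n - i) else 0)"

lemma bottom_in: "bottom \<in> patterns n t"
  using mono by (intro patternsI) (auto simp: bottom_def)

lemma top_in: "top \<in> patterns n t"
proof (rule patternsI)
  fix i j assume ij: "1 \<le> j" "j \<le> i" "i < n"
  then have "j + n - i = Suc (j + n - Suc i)" by simp
  then show "top (Suc i) j \<le> top i j"
    using mono[of "j + n - Suc i"] ij by (auto simp: top_def)
qed (auto simp: top_def)

lemma bottom_le: "g \<in> patterns n t \<Longrightarrow> bottom \<le> g"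
  by (auto simp: le_fun_def bottom_def patternsD(4) pattern_bounds)

lemma le_top: "g \<in> patterns n t \<Longrightarrow> g \<le> top"
  by (auto simp: le_fun_def top_def patternsD(4) pattern_bounds)

lemma total_bounds:
  assumes "g \<in> patterns n t"
  shows "total n bottom \<le> total n g" "total n g \<le> total n top"
  using bottom_le[OF assms] le_top[OF assms] by (auto intro!: total_mono simp: le_fun_def)

lemma exists_raise:
  assumes g: "g \<in> patterns n t" and "g \<noteq> top"
  shows "\<exists>h\<in>patterns n t. covers (patterns n t) g h"
proof -
  have "g < top" using le_top[OF g] assms(2) by simp
  then show ?thesis using exists_raise_le[OF g top_in] covers_patterns_iff g by blast
qed

lemma total_covers:
  assumes "covers (patterns n t) g h" shows "total n h = total n g + 1"
proof -
  obtain i j where "g \<in> patterns n t" "raise g i j \<in> patterns n t" "h = raise g i j"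
    using assms by (auto simp: covers_patterns_iff)
  then show ?thesis using raise_position[of g n t i j] by (simp add: total_raise)
qed

lemma rank_patterns:
  shows "ranked_poset (patterns n t)"
    and "length_of (patterns n t) (covers (patterns n t)) = nat (total n top - total n bottom)"
    and "g \<in> patterns n t \<Longrightarrow>
      rank_of (patterns n t) (covers (patterns n t)) g = nat (total n g - total n bottom)"
proof -
  let ?P = "patterns n t"
  let ?r = "\<lambda>g. nat (total n g - total n bottom)"
  have *: "\<And>g. g \<in> ?P \<Longrightarrow> ?r g \<le> ?r top" "?r bottom = 0"
    "\<And>g h. g \<in> ?P \<Longrightarrow> h \<in> ?P \<Longrightarrow> covers ?P g h \<Longrightarrow> ?r h = ?r g + 1"
    using total_bounds total_covers by (force intro: nat_mono)+
  note rank = rank_of_raising[of ?P ?r "?r top" top bottom "covers ?P",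
    OF *(1) top_in refl bottom_in *(2,3) exists_raise]
  show "ranked_poset ?P"
    unfolding ranked_poset_def using rank(1) finite_patterns by blast
  show "length_of ?P (covers ?P) = ?r top" "g \<in> ?P \<Longrightarrow> rank_of ?P (covers ?P) g = ?r g"
    using rank(2,3) by auto
qed

text \<open>Row i of \<open>bottom\<close> holds the i smallest entries of \<open>t\<close> and row
  n - i of \<open>top\<close> the n - i largest, together all of \<open>t\<close>. The identity
  fixes the constant in the eigenvalue 2 \<rho> - l in \<open>card_rank_le\<close>.\<close>

lemma total_bottom_top: "total n bottom + total n top = int (n - 1) * (\<Sum>j=1..n. t j)"
proof -
  have "total n top = (\<Sum>i=1..<n. \<Sum>j=n-i+1..n. t j)"
    unfolding total_def row_sum_def
    by (intro sum.cong refl sum.reindex_bij_witness[of _ "\<lambda>j. j + i - n" "\<lambda>j. j + n - i" for i])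
       (auto simp: top_def)
  also have "\<dots> = (\<Sum>i=1..<n. \<Sum>j=i+1..n. t j)"
    by (rule sum.reindex_bij_witness[of _ "\<lambda>i. n - i" "\<lambda>i. n - i"]) auto
  finally have "total n bottom + total n top = (\<Sum>i=1..<n. (\<Sum>j=1..i. t j) + (\<Sum>j=i+1..n. t j))"
    by (simp add: total_def row_sum_def bottom_def sum.distrib)
  also have "\<dots> = (\<Sum>i=1..<n. \<Sum>j=1..n. t j)"
  proof (intro sum.cong refl)
    fix i assume "i \<in> {1..<n}"
    then have "{1..n} = {1..i} \<union> {i+1..n}" by auto
    then show "(\<Sum>j=1..i. t j) + (\<Sum>j=i+1..n. t j) = (\<Sum>j=1..n. t j)"
      by (simp add: sum.union_disjoint)
  qed
  finally show ?thesis by simp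
qed

text \<open>A component of colour \<open>i\<close> is a product of chains: the entries of row \<open>i\<close> vary independently
  between bounds given by the two neighbouring rows.\<close>

lemma m_of_patterns:
  assumes g: "g \<in> patterns n t" and i: "1 \<le> i" "i < n"
  shows "m_of (patterns n t) pattern_color i g = 2 * row_sum g i - row_sum g (Suc i) - row_sum g (i - 1)"
proof -
  let ?P = "patterns n t"
  \<comment> \<open>Entry j of row i is bounded below by entry j of row i + 1 and entry j - 1 of row
    i - 1, and above by entry j + 1 of row i + 1 and entry j of row i - 1. The bound from row i - 1
    is missing below for j = 1 and above for j = i.\<close>
  define lo where "lo j = (if j = 1 then g (Suc i) 1 else max (g (Suc i) j) (g (i - 1) (j - 1)))" for j
  define hi where "hi j = (if j = i then g (Suc i) (Suc i) else min (g (Suc i) (Suc j)) (g (i - 1) j))" for j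
  define rep where "rep r = g(i := \<lambda>j. if 1 \<le> j \<and> j \<le> i then r j else 0)" for r
  define V where "V = {h \<in> ?P. \<forall>k. k \<noteq> i \<longrightarrow> h k = g k}"
  let ?E = "color_edge ?P pattern_color i"
  have rep_in: "rep r \<in> V" if r: "\<And>j. 1 \<le> j \<Longrightarrow> j \<le> i \<Longrightarrow> lo j \<le> r j \<and> r j \<le> hi j" for r
  proof -
    have "rep r \<in> ?P"
    proof (rule patternsI)
      fix k l assume kl: "1 \<le> l" "l \<le> k" "k < n"
      consider "k = i" | "Suc k = i" | "k \<noteq> i" "Suc k \<noteq> i" by auto
      then have "rep r (Suc k) l \<le> rep r k l \<and> rep r k l \<le> rep r (Suc k) (Suc l)"
      proof cases
        case 1
        then show ?thesis using r[of l] kl by (auto simp: rep_def lo_def hi_def split: if_splits)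
      next
        case 2
        then show ?thesis using r[of l] r[of "Suc l"] kl by (auto simp: rep_def lo_def hi_def split: if_splits)
      next
        case 3
        then show ?thesis using patternsD(2,3)[OF g kl] by (auto simp: rep_def)
      qed
      then show "rep r (Suc k) l \<le> rep r k l" "rep r k l \<le> rep r (Suc k) (Suc l)" by auto
    qed (use i patternsD(1,4)[OF g] in \<open>auto simp: rep_def\<close>)
    then show ?thesis by (simp add: V_def rep_def)
  qed
  have bounds: "lo j \<le> h i j \<and> h i j \<le> hi j" if "h \<in> V" "1 \<le> j" "j \<le> i" for h j
  proof -
    have h: "h \<in> ?P" "h (Suc i) = g (Suc i)" "h (i - 1) = g (i - 1)" using that i by (auto simp: V_def)
    have "h (Suc i) j \<le> h i j" "h i j \<le> h (Suc i) (Suc j)"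
      using patternsD(2,3)[OF h(1)] that i by auto
    moreover have "h (i - 1) (j - 1) \<le> h i j" if "j \<noteq> 1"
      using patternsD(3)[OF h(1), of "j - 1" "i - 1"] that \<open>1 \<le> j\<close> \<open>j \<le> i\<close> i by auto
    moreover have "h i j \<le> h (i - 1) j" if "j \<noteq> i"
      using patternsD(2)[OF h(1), of j "i - 1"] that \<open>1 \<le> j\<close> \<open>j \<le> i\<close> i by auto
    ultimately show ?thesis unfolding h(2,3) by (auto simp: lo_def hi_def)
  qed
  have rep_eq: "h = rep (h i)" if "h \<in> V" for h
    using that patternsD(4)[of h n t _ i] i by (auto simp: V_def rep_def fun_eq_iff)
  have gV: "g \<in> V" using g by (simp add: V_def)
  have lohi: "lo j \<le> hi j" if "1 \<le> j" "j \<le> i" for j using bounds[OF gV that] by auto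
  have rs_rep: "row_sum (rep r) i = (\<Sum>j=1..i. r j)" for r
    unfolding row_sum_def by (intro sum.cong) (auto simp: rep_def)
  let ?r = "\<lambda>h. nat (row_sum h i - (\<Sum>j=1..i. lo j))"
  have rs_bounds: "(\<Sum>j=1..i. lo j) \<le> row_sum h i \<and> row_sum h i \<le> (\<Sum>j=1..i. hi j)" if "h \<in> V" for h
    unfolding row_sum_def using bounds[OF that] by (auto intro!: sum_mono)
  have 1: "?r h \<le> ?r (rep hi)" if "h \<in> V" for h
    unfolding rs_rep using rs_bounds[OF that] by (intro nat_mono) simp
  have 2: "rep hi \<in> V" "rep lo \<in> V" using lohi by (auto intro: rep_in)
  have 3: "?r (rep lo) = 0" by (simp add: rs_rep)
  have 4: "?r h' = ?r h + 1" if h: "h \<in> V" "h' \<in> V" "?E h h'" for h h'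
  proof -
    obtain j where j: "h' = raise h i j" "h \<in> ?P" "raise h i j \<in> ?P"
      using h(3) by (auto simp: color_edge_patterns_iff)
    then have "row_sum h' i = row_sum h i + 1"
      using raise_position[OF j(2,3)] by (simp add: row_sum_raise)
    then show ?thesis using rs_bounds[OF h(1)] by linarith
  qed
  have 5: "\<exists>h'\<in>V. ?E h h'" if h: "h \<in> V" "h \<noteq> rep hi" for h
  proof -
    have "\<exists>j. 1 \<le> j \<and> j \<le> i \<and> h i j \<noteq> hi j"
    proof (rule ccontr)
      assume "\<not> ?thesis"
      then have "rep (h i) = rep hi" by (auto simp: rep_def fun_eq_iff)
      then show False using rep_eq[OF h(1)] h(2) by simp
    qed
    then obtain j where j: "1 \<le> j" "j \<le> i" "h i j < hi j" using bounds[OF h(1)] by force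
    have "raise h i j = rep ((h i)(j := h i j + 1))"
      using j by (subst rep_eq[OF h(1)]) (auto simp: rep_def raise_def fun_eq_iff)
    moreover have "rep ((h i)(j := h i j + 1)) \<in> V"
      using bounds[OF h(1)] j by (intro rep_in) force
    ultimately have "raise h i j \<in> V" by simp
    then show ?thesis using h by (auto simp: color_edge_patterns_iff V_def)
  qed
  note rank = rank_of_raising[of V ?r "?r (rep hi)" "rep hi" "rep lo" ?E, OF 1 2(1) refl 2(2) 3 4 5]
  have len: "length_of V ?E = ?r (rep hi)"
    by (rule rank(2)) assumption+
  have rk: "rank_of V ?E g = ?r g"
    by (rule rank(3)) (rule gV | assumption)+
  have "color_component ?P pattern_color i g = V"
  proof (intro equalityI subsetI)
    fix h assume "h \<in> color_component ?P pattern_color i g"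
    then have "(\<lambda>u v. ?E u v \<or> ?E v u)\<^sup>*\<^sup>* g h" by (simp add: color_component_def)
    then show "h \<in> V"
    proof (induction rule: rtranclp_induct)
      case (step y z)
      then have "z k = y k" if "k \<noteq> i" for k
        using that by (auto simp: color_edge_patterns_iff raise_def)
      then show ?case using step by (auto simp: V_def color_edge_patterns_iff)
    qed (rule gV)
  next
    fix h assume "h \<in> V"
    then have "(\<lambda>u v. u \<in> V \<and> v \<in> V \<and> (?E u v \<or> ?E v u))\<^sup>*\<^sup>* g h"
      by - (rule rank(4), (rule gV | assumption)+)
    then have "(\<lambda>u v. ?E u v \<or> ?E v u)\<^sup>*\<^sup>* g h" by (rule rtranclp_mono[THEN predicate2D, rotated]) auto
    then show "h \<in> color_component ?P pattern_color i g" by (simp add: color_component_def)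
  qed
  then have "m_of ?P pattern_color i g = 2 * int (?r g) - int (?r (rep hi))"
    by (simp add: m_of_def len rk)
  also have "\<dots> = 2 * row_sum g i - ((\<Sum>j=1..i. lo j) + (\<Sum>j=1..i. hi j))"
    using rs_bounds[OF gV] rs_bounds[OF 2(1)] by (simp add: rs_rep)
  also have "(\<Sum>j=1..i. lo j) + (\<Sum>j=1..i. hi j) = row_sum g (Suc i) + row_sum g (i - 1)"
  proof -
    obtain k where k: "i = Suc k" using i by (cases i) auto
    have "(\<Sum>j=1..i. lo j) = g (Suc i) 1 + (\<Sum>j=1..k. lo (Suc j))"
      unfolding k by (subst sum.atLeast_Suc_atMost) (auto simp: lo_def sum.shift_bounds_cl_Suc_ivl k simp del: sum.cl_ivl_Suc)
    moreover have "(\<Sum>j=1..i. hi j) = (\<Sum>j=1..k. hi j) + g (Suc i) (Suc i)"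
      by (simp add: k hi_def)
    \<comment> \<open>\<open>lo (Suc j)\<close> and \<open>hi j\<close> are the maximum and the
      minimum of the same two entries, so their sum is free of case distinctions.\<close>
    moreover have "(\<Sum>j=1..k. lo (Suc j)) + (\<Sum>j=1..k. hi j) = (\<Sum>j=1..k. g (Suc i) (Suc j) + g k j)"
      unfolding sum.distrib[symmetric] by (intro sum.cong refl) (auto simp: lo_def hi_def k)
    moreover have "(\<Sum>j=1..Suc (Suc m). f j) = f 1 + (\<Sum>j=1..m. f (Suc j)) + f (Suc (Suc m))"
      for f :: "nat \<Rightarrow> int" and m
      by (induction m) simp_all
    then have "row_sum g (Suc i) = g (Suc i) 1 + (\<Sum>j=1..k. g (Suc i) (Suc j)) + g (Suc i) (Suc i)"
      unfolding row_sum_def k .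
    ultimately show ?thesis by (simp add: row_sum_def k sum.distrib)
  qed
  finally show ?thesis by simp
qed

end

section \<open>Partial fractions and strings\<close>

text \<open>\<open>p\<close> equals its interpolation polynomial on \<open>Z\<close>, a combination
  of monic polynomials of degree \<open>card Z - 1\<close>; both sides are its coefficient in that
  degree.\<close>

lemma Lagrange_leading_coeff:
  fixes p :: "'a::field poly"
  assumes Z: "finite Z" and deg: "degree p < card Z"
  shows "(\<Sum>z\<in>Z. poly p z / (\<Prod>y\<in>Z - {z}. z - y)) = coeff p (card Z - 1)"
proof -
  define w where "w z = (\<Prod>y\<in>Z - {z}. z - y)" for z
  define q where "q z = (\<Prod>y\<in>Z - {z}. [:- y, 1:])" for z :: 'a
  define L where "L = (\<Sum>z\<in>Z. smult (poly p z / w z) (q z))"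
  have w: "w z \<noteq> 0" for z using Z by (auto simp: w_def)
  have q: "degree (q z) = card Z - 1" "lead_coeff (q z) = 1" if "z \<in> Z" for z
  proof -
    show "degree (q z) = card Z - 1"
      using Z that unfolding q_def by (auto simp: degree_prod_eq_sum_degree)
    show "lead_coeff (q z) = 1"
      unfolding q_def lead_coeff_prod by simp
  qed
  have "poly L x = poly p x" if x: "x \<in> Z" for x
  proof -
    have "poly L x = (\<Sum>z\<in>Z. if z = x then poly p x else 0)"
      unfolding L_def poly_sum
    proof (intro sum.cong refl)
      fix z assume z: "z \<in> Z"
      have "poly (q z) x = (if z = x then w x else 0)"
        using x z Z by (auto simp: q_def w_def poly_prod prod_zero_iff)
      then show "poly (smult (poly p z / w z) (q z)) x = (if z = x then poly p x else 0)"
        using w[of x] by simp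
    qed
    then show ?thesis using Z x by simp
  qed
  moreover have "degree L < card Z"
  proof -
    have "degree L \<le> card Z - 1"
      unfolding L_def by (intro degree_sum_le Z) (use q in auto)
    then show ?thesis using deg by linarith
  qed
  ultimately have "L = p" using deg by (intro poly_eqI_degree[of Z]) auto
  then have "coeff p (card Z - 1) = coeff L (card Z - 1)" by simp
  also have "\<dots> = (\<Sum>z\<in>Z. poly p z / w z)"
    unfolding L_def coeff_sum using q by (intro sum.cong) auto
  finally show ?thesis by (simp add: w_def)
qed

lemma coeffs_prod_linear:
  fixes r :: "'b \<Rightarrow> 'a::field"
  assumes "finite I"
  shows "degree (\<Prod>i\<in>I. [:- r i, 1:]) = card I"
    and "coeff (\<Prod>i\<in>I. [:- r i, 1:]) (card I) = 1"
    and "I \<noteq> {} \<Longrightarrow> coeff (\<Prod>i\<in>I. [:- r i, 1:]) (card I - 1) = - (\<Sum>i\<in>I. r i)"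
proof -
  show deg: "degree (\<Prod>i\<in>I. [:- r i, 1:]) = card I" for I
    by (simp add: degree_prod_eq_sum_degree)
  have lead: "coeff (\<Prod>i\<in>I. [:- r i, 1:]) (card I) = 1" for I
    using lead_coeff_prod[of "\<lambda>i. [:- r i, 1:]" I] by (simp add: deg)
  then show "coeff (\<Prod>i\<in>I. [:- r i, 1:]) (card I) = 1" .
  show "I \<noteq> {} \<Longrightarrow> coeff (\<Prod>i\<in>I. [:- r i, 1:]) (card I - 1) = - (\<Sum>i\<in>I. r i)"
    using assms
  proof (induction I rule: finite_induct)
    case (insert x I)
    then show ?case
      using lead[of I] by (cases "I = {}"; cases "card I") auto
  qed simp
qed

text \<open>The residues of a quotient of monic polynomials of equal degree add up to the
  coefficient of 1/z at infinity. Algebraically: subtracting the polynomial with roots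
  \<open>Z\<close> keeps the values on \<open>Z\<close> and lowers the degree, so
  \<open>Lagrange_leading_coeff\<close> applies, and the coefficient it returns is a difference of
  two next-to-leading ones.\<close>

lemma sum_residues:
  fixes r :: "'b \<Rightarrow> 'a::field"
  assumes Z: "finite Z" and I: "finite I" and card: "card I = card Z"
  shows "(\<Sum>z\<in>Z. (\<Prod>i\<in>I. z - r i) / (\<Prod>y\<in>Z - {z}. z - y)) = \<Sum>Z - (\<Sum>i\<in>I. r i)"
proof (cases "Z = {}")
  case True
  then show ?thesis using I card by simp
next
  case False
  then have ne: "I \<noteq> {}" "card Z > 0" using Z I card by auto
  define f where "f = (\<Prod>i\<in>I. [:- r i, 1:]) - (\<Prod>z\<in>Z. [:- z, 1:])"
  note c = coeffs_prod_linear[OF I, of r] coeffs_prod_linear[OF Z, of "\<lambda>z. z"]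
  have "degree f \<le> card Z"
    unfolding f_def by (rule degree_diff_le) (use c card in auto)
  moreover have "coeff f (card Z) = 0" using c card by (simp add: f_def)
  ultimately have "degree f < card Z"
    using ne by (metis degree_0 leading_coeff_0_iff le_neq_implies_less)
  then have "(\<Sum>z\<in>Z. poly f z / (\<Prod>y\<in>Z - {z}. z - y)) = coeff f (card Z - 1)"
    by (rule Lagrange_leading_coeff[OF Z])
  moreover have "poly f z = (\<Prod>i\<in>I. z - r i)" if "z \<in> Z" for z
    using Z that by (auto simp: f_def poly_prod prod_zero_iff)
  moreover have "coeff f (card Z - 1) = \<Sum>Z - (\<Sum>i\<in>I. r i)"
    using c(3)[OF ne(1)] c(6)[OF False] card by (simp add: f_def)
  ultimately show ?thesis by simp
qed

text \<open>A common point of \<open>A\<close> and \<open>A'\<close> is a double pole, compensated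
  by a double zero of the numerator. Removing these points \<open>U\<close> from all four sets
  leaves simple poles, to which \<open>sum_residues\<close> applies. The summands at points of
  \<open>U\<close> have denominator zero and contribute 0.\<close>

lemma sum_residues_overlap:
  fixes A A' N N' :: "'a::field set"
  assumes fin: "finite A" "finite A'" "finite N" "finite N'"
    and sub: "A \<inter> A' \<subseteq> N" "A \<inter> A' \<subseteq> N'" and card: "card N + card N' = card A + card A'"
  shows "(\<Sum>x\<in>A. (\<Prod>b\<in>N. x - b) * (\<Prod>b\<in>N'. x - b) / ((\<Prod>y\<in>A - {x}. x - y) * (\<Prod>y\<in>A'. x - y)))
       + (\<Sum>x\<in>A'. (\<Prod>b\<in>N. x - b) * (\<Prod>b\<in>N'. x - b) / ((\<Prod>y\<in>A. x - y) * (\<Prod>y\<in>A' - {x}. x - y)))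
       = \<Sum>A + \<Sum>A' - \<Sum>N - \<Sum>N'"
proof -
  define U where "U = A \<inter> A'"
  define Z where "Z = (A - U) \<union> (A' - U)"
  \<comment> \<open>A disjoint sum counts zeros shared by \<open>N\<close> and \<open>N'\<close>
    outside \<open>U\<close> twice.\<close>
  define I where "I = (N - U) <+> (N' - U)"
  define r where "r = (case_sum id id :: 'a + 'a \<Rightarrow> 'a)"
  let ?R = "\<lambda>x. (\<Prod>i\<in>I. x - r i) / (\<Prod>y\<in>Z - {x}. x - y)"
  have U: "finite U" "U \<subseteq> A" "U \<subseteq> A'" "U \<subseteq> N" "U \<subseteq> N'" using fin sub by (auto simp: U_def)
  have I: "finite I" and Z: "finite Z" using fin by (auto simp: I_def Z_def)
  have disj: "(A - U) \<inter> (A' - U) = {}" by (auto simp: U_def)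
  have "card I + 2 * card U = card Z + 2 * card U"
    using card U fin card_mono[OF fin(1) U(2)] card_mono[OF fin(2) U(3)]
      card_mono[OF fin(3) U(4)] card_mono[OF fin(4) U(5)]
    by (simp add: I_def Z_def card_Plus card_Un_disjoint[OF _ _ disj] card_Diff_subset)
  then have "(\<Sum>x\<in>Z. ?R x) = \<Sum>Z - (\<Sum>i\<in>I. r i)"
    by (intro sum_residues I Z) simp
  moreover have "\<Sum>Z = \<Sum>A - \<Sum>U + (\<Sum>A' - \<Sum>U)"
    unfolding Z_def using fin U by (subst sum.union_disjoint) (auto simp: disj sum_diff)
  moreover have "(\<Sum>i\<in>I. r i) = (\<Sum>N - \<Sum>U) + (\<Sum>N' - \<Sum>U)"
    unfolding I_def using fin U by (subst sum.Plus) (auto simp: r_def sum_diff)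
  moreover have "(\<Sum>x\<in>Z. ?R x) = (\<Sum>x\<in>A - U. ?R x) + (\<Sum>x\<in>A' - U. ?R x)"
    unfolding Z_def using fin by (subst sum.union_disjoint) (auto simp: disj)
  moreover have split: "(\<Prod>y\<in>X. x - y) = (\<Prod>y\<in>X - U. x - y) * (\<Prod>y\<in>U. x - y)"
    if "finite X" "U \<subseteq> X" for X and x :: 'a
    using prod.subset_diff[OF that(2,1), of "\<lambda>y. x - y"] .
  have num: "(\<Prod>b\<in>N. x - b) * (\<Prod>b\<in>N'. x - b) = (\<Prod>i\<in>I. x - r i) * (\<Prod>y\<in>U. x - y) ^ 2" for x
    unfolding I_def using fin U by (simp add: prod.Plus r_def split[of N] split[of N'] power2_eq_square mult_ac)
  have nz: "(\<Prod>y\<in>U. x - y) ^ 2 \<noteq> 0" if "x \<notin> U" for x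
    using U(1) that by auto
  have cancel: "(\<Prod>b\<in>N. x - b) * (\<Prod>b\<in>N'. x - b) / ((\<Prod>y\<in>X - {x}. x - y) * (\<Prod>y\<in>X'. x - y)) = ?R x"
    if x: "x \<in> X - U" and X: "(X = A \<and> X' = A') \<or> (X = A' \<and> X' = A)" for X X' x
  proof -
    have *: "finite X" "finite X'" "U \<subseteq> X" "U \<subseteq> X'" "x \<notin> X'" "x \<notin> U" "(X - U) \<inter> (X' - U) = {}"
      using X x fin U by (auto simp: U_def)
    have "(\<Prod>y\<in>X - {x}. x - y) = (\<Prod>y\<in>X - {x} - U. x - y) * (\<Prod>y\<in>U. x - y)"
      using * by (intro split) auto
    moreover have "(\<Prod>y\<in>Z - {x}. x - y) = (\<Prod>y\<in>X - {x} - U. x - y) * (\<Prod>y\<in>X' - U. x - y)"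
    proof -
      have "Z - {x} = (X - {x} - U) \<union> (X' - U)" using X * by (auto simp: Z_def)
      then show ?thesis using * by (simp only:) (subst prod.union_disjoint, auto)
    qed
    ultimately show ?thesis
      using nz[OF *(6)] split[OF *(2,4), of x] by (simp add: num power2_eq_square mult_ac)
  qed
  have "(\<Sum>x\<in>A. (\<Prod>b\<in>N. x - b) * (\<Prod>b\<in>N'. x - b) / ((\<Prod>y\<in>A - {x}. x - y) * (\<Prod>y\<in>A'. x - y)))
      = (\<Sum>x\<in>A - U. ?R x)"
  proof (rule sum.mono_neutral_cong_right)
    show "\<forall>x\<in>A - (A - U). (\<Prod>b\<in>N. x - b) * (\<Prod>b\<in>N'. x - b) / ((\<Prod>y\<in>A - {x}. x - y) * (\<Prod>y\<in>A'. x - y)) = 0"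
      using fin by (auto simp: U_def)
  qed (use fin cancel in auto)
  moreover have "(\<Sum>x\<in>A'. (\<Prod>b\<in>N. x - b) * (\<Prod>b\<in>N'. x - b) / ((\<Prod>y\<in>A. x - y) * (\<Prod>y\<in>A' - {x}. x - y)))
      = (\<Sum>x\<in>A' - U. ?R x)"
  proof (rule sum.mono_neutral_cong_right)
    show "\<forall>x\<in>A' - (A' - U). (\<Prod>b\<in>N. x - b) * (\<Prod>b\<in>N'. x - b) / ((\<Prod>y\<in>A. x - y) * (\<Prod>y\<in>A' - {x}. x - y)) = 0"
      using fin by (auto simp: U_def)
  qed (use fin cancel[of _ A' A] in \<open>auto simp: mult.commute\<close>)
  ultimately show ?thesis by simp
qed

text \<open>Where two of the points \<open>a j\<close> differ by \<open>1\<close>, a denominator vanishes and the quotient is \<open>0\<close> by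
  convention; this is the correct value, as the corresponding poles are cancelled by the numerator.\<close>

lemma sum_residues_shift:
  fixes a :: "'i \<Rightarrow> 'a::field" and b :: "'j \<Rightarrow> 'a" and c :: "'k \<Rightarrow> 'a"
  assumes fin: "finite I" "finite J" "finite K"
    and inj: "inj_on a I" "inj_on b J" "inj_on c K"
    and card: "card J + card K = 2 * card I"
    and adj: "\<And>j k. j \<in> I \<Longrightarrow> k \<in> I \<Longrightarrow> a j = a k + 1 \<Longrightarrow> a j \<in> b ` J \<and> a k \<in> c ` K"
  shows "(\<Sum>j\<in>I. (\<Prod>k\<in>J. a j - b k) * (\<Prod>k\<in>K. a j - 1 - c k) /
            ((\<Prod>k\<in>I - {j}. a j - a k) * (\<Prod>k\<in>I. a j - 1 - a k)))
       + (\<Sum>j\<in>I. (\<Prod>k\<in>J. a j + 1 - b k) * (\<Prod>k\<in>K. a j - c k) /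
            ((\<Prod>k\<in>I. a j + 1 - a k) * (\<Prod>k\<in>I - {j}. a j - a k)))
       = 2 * (\<Sum>j\<in>I. a j) + of_nat (card I) - (\<Sum>k\<in>J. b k) - (\<Sum>k\<in>K. c k) - of_nat (card K)"
proof -
  \<comment> \<open>The poles are the points and their shifts by 1, and the zeros \<open>c k\<close>
    are shifted as well: \<open>a j - 1 - c k\<close> is the difference of \<open>a j\<close> and
    \<open>c k + 1\<close>. Poles coincide exactly when \<open>a j = a k + 1\<close>.\<close>
  let ?A = "a ` I" let ?A' = "(\<lambda>j. a j + 1) ` I" let ?N = "b ` J" let ?N' = "(\<lambda>k. c k + 1) ` K"
  have inj': "inj_on (\<lambda>j. a j + 1) I" "inj_on (\<lambda>k. c k + 1) K"
    using inj by (auto simp: inj_on_def)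
  have pI': "(\<Prod>y\<in>f ` I - {f j}. x - y) = (\<Prod>k\<in>I - {j}. x - f k)" if "inj_on f I" "j \<in> I" for f x j
  proof -
    have "f ` I - {f j} = f ` (I - {j})" using that by (auto simp: inj_on_def)
    then show ?thesis using that by (simp only:) (simp add: prod.reindex inj_on_diff)
  qed
  have "(\<Sum>x\<in>?A. (\<Prod>b\<in>?N. x - b) * (\<Prod>b\<in>?N'. x - b) / ((\<Prod>y\<in>?A - {x}. x - y) * (\<Prod>y\<in>?A'. x - y)))
       + (\<Sum>x\<in>?A'. (\<Prod>b\<in>?N. x - b) * (\<Prod>b\<in>?N'. x - b) / ((\<Prod>y\<in>?A. x - y) * (\<Prod>y\<in>?A' - {x}. x - y)))
       = \<Sum>?A + \<Sum>?A' - \<Sum>?N - \<Sum>?N'"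
  proof (rule sum_residues_overlap)
    show "?A \<inter> ?A' \<subseteq> ?N" "?A \<inter> ?A' \<subseteq> ?N'" using adj by (fastforce simp: image_iff)+
    show "card ?N + card ?N' = card ?A + card ?A'"
      using inj inj' card by (simp add: card_image)
  qed (use fin in auto)
  moreover have "\<Sum>?A + \<Sum>?A' - \<Sum>?N - \<Sum>?N' =
      2 * (\<Sum>j\<in>I. a j) + of_nat (card I) - (\<Sum>k\<in>J. b k) - (\<Sum>k\<in>K. c k) - of_nat (card K)"
    using inj inj' by (simp add: sum.reindex sum.distrib)
  moreover have "(\<Sum>x\<in>?A. (\<Prod>b\<in>?N. x - b) * (\<Prod>b\<in>?N'. x - b) / ((\<Prod>y\<in>?A - {x}. x - y) * (\<Prod>y\<in>?A'. x - y))) =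
      (\<Sum>j\<in>I. (\<Prod>k\<in>J. a j - b k) * (\<Prod>k\<in>K. a j - 1 - c k) /
            ((\<Prod>k\<in>I - {j}. a j - a k) * (\<Prod>k\<in>I. a j - 1 - a k)))"
    using inj inj' by (simp add: sum.reindex prod.reindex pI' algebra_simps cong: sum.cong)
  moreover have "(\<Sum>x\<in>?A'. (\<Prod>b\<in>?N. x - b) * (\<Prod>b\<in>?N'. x - b) / ((\<Prod>y\<in>?A. x - y) * (\<Prod>y\<in>?A' - {x}. x - y))) =
      (\<Sum>j\<in>I. (\<Prod>k\<in>J. a j + 1 - b k) * (\<Prod>k\<in>K. a j - c k) /
            ((\<Prod>k\<in>I. a j + 1 - a k) * (\<Prod>k\<in>I - {j}. a j - a k)))"
    using inj inj' pI'[OF inj'(1)] by (simp add: sum.reindex prod.reindex cong: sum.cong)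
  ultimately show ?thesis by simp
qed

section \<open>Linear equations and strings of lowering operators\<close>

lemma underdetermined_homogeneous:
  fixes M :: "'a \<Rightarrow> 'b \<Rightarrow> 'f::field"
  assumes "finite B" "finite A" "card B < card A"
  shows "\<exists>v. (\<forall>b\<in>B. (\<Sum>a\<in>A. v a * M a b) = 0) \<and> (\<exists>a\<in>A. v a \<noteq> 0)"
  using assms
proof (induction B arbitrary: A M rule: finite_induct)
  case empty
  then have "A \<noteq> {}" by auto
  then show ?case by (intro exI[of _ "\<lambda>_. 1"]) auto
next
  case (insert b B)
  show ?case
  proof (cases "\<forall>a\<in>A. M a b = 0")
    case True
    have "card B < card A" using insert by simp
    then show ?thesis using insert.IH[of A M] insert.prems True by auto
  next
    case False
    then obtain p where p: "p \<in> A" "M p b \<noteq> 0" by auto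
    \<comment> \<open>One step of Gaussian elimination: equation \<open>b\<close> with pivot
      \<open>p\<close> removes the unknown \<open>p\<close> from the other equations, and its value
      \<open>- s\<close> is recovered by back substitution.\<close>
    define M' where "M' a c = M a c - M a b / M p b * M p c" for a c
    have "card B < card (A - {p})" using insert p by simp
    then obtain v a0 where v: "\<And>c. c \<in> B \<Longrightarrow> (\<Sum>a\<in>A - {p}. v a * M' a c) = 0"
      and a0: "a0 \<in> A - {p}" "v a0 \<noteq> 0"
      using insert.IH[of "A - {p}" M'] insert.prems by auto
    define s where "s = (\<Sum>a\<in>A - {p}. v a * M a b) / M p b"
    define v' where "v' = v(p := - s)"
    have split: "(\<Sum>a\<in>A. v' a * M a c) = - s * M p c + (\<Sum>a\<in>A - {p}. v a * M a c)" for c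
      using insert.prems p by (subst sum.remove[of _ p]) (auto simp: v'_def intro!: sum.cong)
    have "(\<Sum>a\<in>A. v' a * M a c) = 0" if "c \<in> insert b B" for c
    proof (cases "c = b")
      case True
      then show ?thesis using p by (simp add: split s_def)
    next
      case False
      then have "(\<Sum>a\<in>A - {p}. v a * M a c - v a * (M a b / M p b * M p c)) = 0"
        using v[of c] that by (simp add: M'_def right_diff_distrib)
      moreover have "(\<Sum>a\<in>A - {p}. v a * (M a b / M p b * M p c)) = s * M p c"
        unfolding s_def sum_divide_distrib sum_distrib_right by (intro sum.cong) simp_all
      ultimately show ?thesis by (simp add: split sum_subtractf)
    qed
    moreover have "v' a0 \<noteq> 0" "a0 \<in> A" using a0 by (auto simp: v'_def)
    ultimately show ?thesis by blast
  qed
qed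

text \<open>A nonzero vector \<open>v\<close> of rank \<open>r\<close> killed by \<open>E\<close> would generate an infinite string: \<open>E F\<^sup>k\<^sup>+\<^sup>1 v\<close> is a
  negative multiple of \<open>F\<^sup>k v\<close> as long as the eigenvalues \<open>2 \<rho> - l\<close> met on the way down are negative.\<close>

lemma sl2_card_le:
  fixes e f :: "'a \<Rightarrow> 'a \<Rightarrow> real" and \<rho> :: "'a \<Rightarrow> nat"
  assumes P: "finite P"
    and e: "\<And>x y. x \<in> P \<Longrightarrow> y \<in> P \<Longrightarrow> e y x \<noteq> 0 \<Longrightarrow> \<rho> y = \<rho> x + 1"
    and f: "\<And>x y. x \<in> P \<Longrightarrow> y \<in> P \<Longrightarrow> f y x \<noteq> 0 \<Longrightarrow> \<rho> x = \<rho> y + 1"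
    and comm: "\<And>v y. y \<in> P \<Longrightarrow>
       (\<Sum>x\<in>P. e y x * (\<Sum>z\<in>P. f x z * v z)) - (\<Sum>x\<in>P. f y x * (\<Sum>z\<in>P. e x z * v z))
         = (2 * real (\<rho> y) - real l) * v y"
    and r: "2 * r < l"
  shows "card {x\<in>P. \<rho> x = r} \<le> card {x\<in>P. \<rho> x = Suc r}"
proof (rule ccontr)
  define E where "E v y = (\<Sum>x\<in>P. e y x * v x)" for v y
  define F where "F v y = (\<Sum>x\<in>P. f y x * v x)" for v y
  assume "\<not> ?thesis"
  \<comment> \<open>If the rank numbers dropped, the condition that \<open>E\<close> kills
    \<open>u\<close> would have more unknowns than equations.\<close>
  then obtain u x0 where u: "\<And>y. y \<in> P \<Longrightarrow> \<rho> y = Suc r \<Longrightarrow> (\<Sum>x | x \<in> P \<and> \<rho> x = r. u x * e y x) = 0"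
    and x0: "x0 \<in> P" "\<rho> x0 = r" "u x0 \<noteq> 0"
    using underdetermined_homogeneous[of "{x\<in>P. \<rho> x = Suc r}" "{x\<in>P. \<rho> x = r}" "\<lambda>x y. e y x"] P by auto
  define v where "v k = (F ^^ k) (\<lambda>x. if \<rho> x = r then u x else 0)" for k
  have vS: "v (Suc k) = F (v k)" for k by (simp add: v_def)
  have E_cong: "E w y = E w' y" if "\<And>x. x \<in> P \<Longrightarrow> w x = w' x" for w w' y
    unfolding E_def using that by (intro sum.cong) auto
  have F_cong: "F w y = F w' y" if "\<And>x. x \<in> P \<Longrightarrow> w x = w' x" for w w' y
    unfolding F_def using that by (intro sum.cong) auto
  have EF: "E (F w) y = F (E w) y + (2 * real (\<rho> y) - real l) * w y" if "y \<in> P" for w y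
    using comm[OF that, of w] by (simp add: E_def F_def)
  have supp: "\<rho> y + k = r" if "y \<in> P" "v k y \<noteq> 0" for k y
    using that
  proof (induction k arbitrary: y)
    case 0
    then show ?case by (simp add: v_def split: if_splits)
  next
    case (Suc k)
    have "(\<Sum>x\<in>P. f y x * v k x) \<noteq> 0"
      using Suc.prems(2) unfolding vS F_def .
    then obtain x where "x \<in> P" "f y x * v k x \<noteq> 0"
      by (rule sum.not_neutral_contains_not_neutral)
    then have "x \<in> P" "f y x \<noteq> 0" "v k x \<noteq> 0" by auto
    then show ?case using f[of x y] Suc.IH[of x] Suc.prems by simp
  qed
  have E0: "E (v 0) y = 0" if y: "y \<in> P" for y
  proof (cases "\<rho> y = Suc r")
    case True
    have "E (v 0) y = (\<Sum>x | x \<in> P \<and> \<rho> x = r. u x * e y x)"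
      unfolding E_def v_def using P by (intro sum.mono_neutral_cong_right) auto
    then show ?thesis using u[OF y True] by simp
  next
    case False
    then show ?thesis unfolding E_def using e[OF _ y] by (intro sum.neutral) (auto simp: v_def)
  qed
  \<comment> \<open>The constant \<open>c\<close> for \<open>v k\<close> is the sum of 2 (r - m) - l
    over m \<le> k, and each step down adds one more negative term.\<close>
  have str: "(\<exists>y\<in>P. v k y \<noteq> 0) \<and> (\<exists>c<0. \<forall>y\<in>P. E (v (Suc k)) y = c * v k y)" for k
  proof (induction k)
    case 0
    have "E (v (Suc 0)) y = (2 * real r - real l) * v 0 y" if y: "y \<in> P" for y
    proof -
      have "F (E (v 0)) y = F (\<lambda>_. 0) y" by (rule F_cong) (rule E0)
      then show ?thesis
        unfolding vS using EF[OF y, of "v 0"] supp[OF y, of 0] by (cases "v 0 y = 0") (auto simp: F_def)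
    qed
    moreover have "2 * real r - real l < 0" using r by linarith
    moreover have "v 0 x0 \<noteq> 0" using x0 by (simp add: v_def)
    ultimately show ?case using x0 by blast
  next
    case (Suc k)
    then obtain y0 c where y0: "y0 \<in> P" "v k y0 \<noteq> 0" and c: "c < 0"
      and E: "\<And>y. y \<in> P \<Longrightarrow> E (v (Suc k)) y = c * v k y" by auto
    have "E (v (Suc k)) y0 \<noteq> 0" using E y0 c by simp
    then have "\<exists>y\<in>P. v (Suc k) y \<noteq> 0"
      unfolding E_def by (metis (no_types, lifting) mult_zero_right sum.neutral)
    moreover have "E (v (Suc (Suc k))) y = (c + (2 * (real r - real (Suc k)) - real l)) * v (Suc k) y"
      if y: "y \<in> P" for y
    proof -
      have "F (E (v (Suc k))) y = F (\<lambda>x. c * v k x) y" by (rule F_cong) (rule E)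
      also have "\<dots> = c * v (Suc k) y"
        by (simp add: vS F_def sum_distrib_left mult_ac)
      finally have "E (v (Suc (Suc k))) y = c * v (Suc k) y + (2 * real (\<rho> y) - real l) * v (Suc k) y"
        using EF[OF y, of "v (Suc k)"] by (simp add: vS[of "Suc k"])
      moreover have "real (\<rho> y) = real r - real (Suc k)" if "v (Suc k) y \<noteq> 0"
        using supp[OF y that] by linarith
      ultimately show ?thesis by (cases "v (Suc k) y = 0") (simp_all add: algebra_simps)
    qed
    moreover have "c + (2 * (real r - real (Suc k)) - real l) < 0"
    proof -
      have "2 * real r < real l" using r by linarith
      then show ?thesis using c by simp
    qed
    ultimately show ?case by blast
  qed
  \<comment> \<open>A nonzero value of \<open>v (Suc r)\<close> would have to sit r + 1 ranks below
    rank r.\<close>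
  from str[of "Suc r"] show False using supp by fastforce
qed

section \<open>Gelfand-Tsetlin operators\<close>

definition lower :: "(nat \<Rightarrow> nat \<Rightarrow> int) \<Rightarrow> nat \<Rightarrow> nat \<Rightarrow> nat \<Rightarrow> nat \<Rightarrow> int" where
  "lower g i j = g(i := (g i)(j := g i j - 1))"

lemma lower_apply: "lower g i j k l = (if k = i \<and> l = j then g i j - 1 else g k l)"
  by (simp add: lower_def)

lemma raise_lower [simp]: "raise (lower g i j) i j = g"
  by (auto simp: fun_eq_iff raise_apply lower_apply)

lemma lower_raise [simp]: "lower (raise g i j) i j = g"
  by (auto simp: fun_eq_iff raise_apply lower_apply)

lemma lower_raise_commute: "(i, j) \<noteq> (k, l) \<Longrightarrow> lower (raise g k l) i j = raise (lower g i j) k l"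
  by (auto simp: fun_eq_iff raise_apply lower_apply)

text \<open>The two middle corners of a square of moves determine the other two as meet and join. If
  both lie in a sublattice, so does the whole square; in \<open>card_rank_le\<close> this excludes
  that only one of the two paths between them exists.\<close>

lemma inf_sup_raise:
  assumes "(i, j) \<noteq> (k, l)"
  shows "inf (raise g i j) (raise g k l) = g" "sup (raise g i j) (raise g k l) = raise (raise g i j) k l"
  using assms by (auto simp: fun_eq_iff raise_apply inf_min sup_max)

lemma lower_in_patterns:
  assumes g: "g \<in> patterns n t" and pos: "1 \<le> j" "j \<le> i" "i < n"
    and lt: "g (Suc i) j < g i j" "1 < j \<Longrightarrow> g (i - 1) (j - 1) < g i j"
  shows "lower g i j \<in> patterns n t"
proof (rule patternsI)
  fix k l assume kl: "1 \<le> l" "l \<le> k" "k < n"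
  show "lower g i j (Suc k) l \<le> lower g i j k l"
    using patternsD(2)[OF g kl] lt(1) kl by (auto simp: lower_apply)
  show "lower g i j k l \<le> lower g i j (Suc k) (Suc l)"
    using patternsD(3)[OF g kl] lt(2) kl by (auto simp: lower_apply)
qed (use patternsD(1,4)[OF g] pos in \<open>auto simp: lower_apply\<close>)

text \<open>Gelfand-Tsetlin coordinates for increasing rows. Adding \<open>j\<close> makes the rows
  strictly increasing when the top row is increasing, so differences within a row of a pattern can
  serve as denominators.\<close>

definition shifted :: "(nat \<Rightarrow> nat \<Rightarrow> int) \<Rightarrow> nat \<Rightarrow> nat \<Rightarrow> real" where
  "shifted g i j = of_int (g i j) + of_nat j"

text \<open>Matrix entries of the raising and lowering operators of colour \<open>i\<close> in the Gelfand-Tsetlin basis,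
  in a normalisation free of square roots.\<close>

definition up_coeff :: "(nat \<Rightarrow> nat \<Rightarrow> int) \<Rightarrow> nat \<Rightarrow> nat \<Rightarrow> real" where
  "up_coeff g i j = - (\<Prod>k=1..Suc i. shifted g i j + 1 - shifted g (Suc i) k) /
     (\<Prod>k\<in>{1..i} - {j}. shifted g i j - shifted g i k)"

definition down_coeff :: "(nat \<Rightarrow> nat \<Rightarrow> int) \<Rightarrow> nat \<Rightarrow> nat \<Rightarrow> real" where
  "down_coeff g i j = (\<Prod>k=1..i - 1. shifted g i j - 1 - shifted g (i - 1) k) /
     (\<Prod>k\<in>{1..i} - {j}. shifted g i j - shifted g i k)"

lemma shifted_raise:
  "shifted (raise g i j) k l = (if k = i \<and> l = j then shifted g i j + 1 else shifted g k l)"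
  by (simp add: shifted_def raise_apply)

lemma shifted_lower:
  "shifted (lower g i j) k l = (if k = i \<and> l = j then shifted g i j - 1 else shifted g k l)"
  by (simp add: shifted_def lower_apply)

lemma sum_shifted: "(\<Sum>j=1..i. shifted g i j) = of_int (row_sum g i) + (\<Sum>j=1..i. real j)"
  by (simp add: shifted_def row_sum_def sum.distrib)

text \<open>The two paths from \<open>raise w k l\<close> to \<open>raise w i j\<close>, through the
  bottom \<open>w\<close> and through the top of the square, carry the same coefficient. Raising
  involves rows i and i + 1 only, lowering rows k - 1 and k, so the two moves interact only if k = i
  or k = i + 1.\<close>

lemma up_down_commute:
  assumes ne: "(i, j) \<noteq> (k, l)" and pos: "1 \<le> j" "j \<le> i" "1 \<le> l" "l \<le> k"
  shows "up_coeff w i j * down_coeff (raise w k l) k l =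
    down_coeff (raise (raise w i j) k l) k l * up_coeff (raise w k l) i j"
proof -
  let ?s = "shifted w"
  consider "i = k" "j \<noteq> l" | "k = Suc i" | "k \<noteq> i" "k \<noteq> Suc i" using ne by auto
  then show ?thesis
  proof cases
    case 1
    have D: "{1..k} - {j} = insert l ({1..k} - {j, l})" "{1..k} - {l} = insert j ({1..k} - {j, l})"
      using pos 1 by auto
    have "k - 1 \<noteq> k" using pos by simp
    have prod_j: "(\<Prod>x\<in>{1..k} - {j}. h x) = h l * (\<Prod>x\<in>{1..k} - {j, l}. h x)" for h :: "nat \<Rightarrow> real"
      by (subst D(1)) (rule prod.insert, auto)
    have prod_l: "(\<Prod>x\<in>{1..k} - {l}. h x) = h j * (\<Prod>x\<in>{1..k} - {j, l}. h x)" for h :: "nat \<Rightarrow> real"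
      by (subst D(2)) (rule prod.insert, auto)
    define p where "p = (\<Prod>x\<in>{1..k} - {j, l}. ?s k j - ?s k x)"
    define q where "q = (\<Prod>x\<in>{1..k} - {j, l}. ?s k l + 1 - ?s k x)"
    define N where "N = (\<Prod>x=1..Suc k. ?s k j + 1 - ?s (Suc k) x)"
    define M where "M = (\<Prod>x=1..k-1. ?s k l - ?s (k - 1) x)"
    have "up_coeff w i j = - N / ((?s k j - ?s k l) * p)"
      unfolding up_coeff_def 1 N_def p_def prod_j ..
    moreover have "down_coeff (raise w k l) k l = M / ((?s k l + 1 - ?s k j) * q)"
      unfolding down_coeff_def prod_l M_def q_def using 1 \<open>k - 1 \<noteq> k\<close>
      by (simp add: shifted_raise cong: prod.cong_simp)
    moreover have "down_coeff (raise (raise w i j) k l) k l = M / ((?s k l - ?s k j) * q)"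
      unfolding down_coeff_def prod_l M_def q_def using 1 \<open>k - 1 \<noteq> k\<close>
      by (simp add: shifted_raise cong: prod.cong_simp)
    moreover have "up_coeff (raise w k l) i j = - N / ((?s k j - (?s k l + 1)) * p)"
      unfolding up_coeff_def 1 prod_j N_def p_def using 1
      by (simp add: shifted_raise cong: prod.cong_simp)
    \<comment> \<open>Two sign changes compensate, so the denominators agree as products, even where
      they vanish.\<close>
    moreover have "((?s k j - ?s k l) * p) * ((?s k l + 1 - ?s k j) * q) =
        ((?s k l - ?s k j) * q) * ((?s k j - (?s k l + 1)) * p)"
      by (simp add: algebra_simps)
    ultimately show ?thesis by (simp only: times_divide_times_eq mult.commute[of M])
  next
    case 2
    have I: "{1..Suc i} = insert l ({1..Suc i} - {l})" "{1..i} = insert j ({1..i} - {j})"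
      using pos 2 by auto
    have up1: "(\<Prod>m=1..Suc i. ?s i j + 1 - ?s (Suc i) m) =
        (?s i j + 1 - ?s (Suc i) l) * (\<Prod>m\<in>{1..Suc i} - {l}. ?s i j + 1 - ?s (Suc i) m)"
      by (subst I(1)) (rule prod.insert, auto)
    have up2: "(\<Prod>m=1..Suc i. ?s i j + 1 - shifted (raise w k l) (Suc i) m) =
        (?s i j - ?s (Suc i) l) * (\<Prod>m\<in>{1..Suc i} - {l}. ?s i j + 1 - ?s (Suc i) m)"
      by (subst I(1), subst prod.insert) (auto simp: shifted_raise 2)
    have dn1: "(\<Prod>m=1..i. ?s (Suc i) l - ?s i m) =
        (?s (Suc i) l - ?s i j) * (\<Prod>m\<in>{1..i} - {j}. ?s (Suc i) l - ?s i m)"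
      by (subst I(2)) (rule prod.insert, auto)
    have dn2: "(\<Prod>m=1..i. ?s (Suc i) l - shifted (raise (raise w i j) k l) i m) =
        (?s (Suc i) l - (?s i j + 1)) * (\<Prod>m\<in>{1..i} - {j}. ?s (Suc i) l - ?s i m)"
      by (subst I(2), subst prod.insert) (auto simp: shifted_raise 2)
    \<comment> \<open>Only the factors that pair the two moved entries change: (X + 1 - Y) (Y - X)
      becomes (Y - X - 1) (X - Y), again two sign changes.\<close>
    define X where "X = ?s i j" define Y where "Y = ?s (Suc i) l"
    have "up_coeff w i j * down_coeff (raise w k l) k l =
        - ((X + 1 - Y) * (\<Prod>m\<in>{1..Suc i} - {l}. ?s i j + 1 - ?s (Suc i) m)) /
          (\<Prod>m\<in>{1..i} - {j}. ?s i j - ?s i m) *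
        (((Y - X) * (\<Prod>m\<in>{1..i} - {j}. ?s (Suc i) l - ?s i m)) /
          (\<Prod>m\<in>{1..Suc i} - {l}. ?s (Suc i) l + 1 - ?s (Suc i) m))"
      using dn1 unfolding up_coeff_def down_coeff_def up1 X_def Y_def
      by (simp add: shifted_raise 2 cong: prod.cong_simp)
    also have "\<dots> = ((Y - (X + 1)) * (\<Prod>m\<in>{1..i} - {j}. ?s (Suc i) l - ?s i m)) /
          (\<Prod>m\<in>{1..Suc i} - {l}. ?s (Suc i) l + 1 - ?s (Suc i) m) *
        (- ((X - Y) * (\<Prod>m\<in>{1..Suc i} - {l}. ?s i j + 1 - ?s (Suc i) m)) /
          (\<Prod>m\<in>{1..i} - {j}. ?s i j - ?s i m))"
      by (simp add: algebra_simps add_divide_distrib diff_divide_distrib)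
    also have "\<dots> = down_coeff (raise (raise w i j) k l) k l * up_coeff (raise w k l) i j"
      using dn2 up2 unfolding up_coeff_def down_coeff_def X_def Y_def
      by (simp add: shifted_raise 2 cong: prod.cong_simp)
    finally show ?thesis .
  next
    case 3
    have k: "k - Suc 0 \<noteq> k" "k - Suc 0 \<noteq> i" using pos 3 by auto
    have "up_coeff (raise w k l) i j = up_coeff w i j"
      using 3 by (simp add: up_coeff_def shifted_raise cong: prod.cong_simp)
    moreover have "down_coeff (raise (raise w i j) k l) k l = down_coeff (raise w k l) k l"
      using 3 k by (simp add: down_coeff_def shifted_raise cong: prod.cong_simp)
    ultimately show ?thesis by simp
  qed
qed

text \<open>The weights i (N - i) vanish at 0 and have second difference -2. Moving the second
  difference from \<open>S\<close> to them leaves twice the sum of \<open>S\<close> and boundary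
  terms, of which one vanishes for \<open>N = Suc m\<close>.\<close>

lemma sum_by_parts:
  fixes S :: "nat \<Rightarrow> real"
  assumes "S 0 = 0"
  shows "(\<Sum>i=1..<Suc m. real i * (real N - real i) * (2 * S i - S (Suc i) - S (i - 1))) =
    2 * (\<Sum>i=1..<Suc m. S i) + real (Suc m) * (real N - real (Suc m)) * S m
      - real m * (real N - real m) * S (Suc m)"
  by (induction m) (use assms in \<open>auto simp: algebra_simps\<close>)

section \<open>The commutator relation on patterns\<close>

context pattern_poset
begin

lemma shifted_less:
  assumes g: "g \<in> patterns n t" and "1 \<le> j" "j < k" "k \<le> i" "i \<le> n"
  shows "shifted g i j + 1 \<le> shifted g i k"
proof -
  have "g i j \<le> g i k"
    using \<open>j < k\<close>[THEN less_imp_le] \<open>k \<le> i\<close>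
  proof (induction rule: dec_induct)
    case (step m)
    have "g i m \<le> g i (Suc m)"
    proof (cases "i = n")
      case True
      then show ?thesis using patternsD(1)[OF g] mono[of m] step assms by auto
    next
      case False
      then show ?thesis
        using patternsD(3)[OF g, of m i] patternsD(2)[OF g, of "Suc m" i] step assms by auto
    qed
    then show ?case using step by simp
  qed simp
  then show ?thesis using assms by (simp add: shifted_def)
qed

lemma inj_shifted:
  assumes "g \<in> patterns n t" "i \<le> n" shows "inj_on (shifted g i) {1..i}"
proof (rule inj_onI)
  fix j k assume "j \<in> {1..i}" "k \<in> {1..i}" "shifted g i j = shifted g i k"
  then show "j = k"
    using shifted_less[OF assms(1), of j k i] shifted_less[OF assms(1), of k j i] assms(2)
    by (cases j k rule: linorder_cases) auto
qed

text \<open>The diagonal entry of the commutator in one colour is a sum of residues at the points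
  \<open>?a j\<close> (first down, then up) and \<open>?a j + 1\<close> (first up, then down). Its
  value is the weight coordinate found in \<open>m_of_patterns\<close>.\<close>

lemma up_down_diagonal:
  assumes g: "g \<in> patterns n t" and i: "1 \<le> i" "i < n"
  shows "(\<Sum>j=1..i. (if lower g i j \<in> patterns n t then up_coeff (lower g i j) i j * down_coeff g i j else 0)
           - (if raise g i j \<in> patterns n t then down_coeff (raise g i j) i j * up_coeff g i j else 0))
     = of_int (2 * row_sum g i - row_sum g (Suc i) - row_sum g (i - 1))"
proof -
  have "i - Suc 0 \<noteq> i" using i by simp
  let ?a = "shifted g i" let ?b = "shifted g (Suc i)" let ?c = "shifted g (i - 1)"
  let ?I = "{1..i}"
  let ?r1 = "\<lambda>j. (\<Prod>k=1..Suc i. ?a j - ?b k) * (\<Prod>k=1..i-1. ?a j - 1 - ?c k) /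
            ((\<Prod>k\<in>?I - {j}. ?a j - ?a k) * (\<Prod>k\<in>?I. ?a j - 1 - ?a k))"
  let ?r2 = "\<lambda>j. (\<Prod>k=1..Suc i. ?a j + 1 - ?b k) * (\<Prod>k=1..i-1. ?a j - ?c k) /
            ((\<Prod>k\<in>?I. ?a j + 1 - ?a k) * (\<Prod>k\<in>?I - {j}. ?a j - ?a k))"
  have "(\<Sum>j\<in>?I. ?r1 j) + (\<Sum>j\<in>?I. ?r2 j) =
      2 * (\<Sum>j\<in>?I. ?a j) + of_nat (card ?I) - (\<Sum>k=1..Suc i. ?b k) - (\<Sum>k=1..i-1. ?c k) - of_nat (card {1..i-1})"
  proof (rule sum_residues_shift)
    show "card {1..Suc i} + card {1..i-1} = 2 * card ?I" using i by simp
    show "inj_on ?a ?I" "inj_on ?b {1..Suc i}" "inj_on ?c {1..i-1}"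
      using i by (intro inj_shifted[OF g]; simp)+
    \<comment> \<open>Colliding poles come from equal neighbouring entries of row i. Interlacing
      squeezes one entry of each adjacent row to the same value, which supplies the zeros that
      \<open>sum_residues_shift\<close> asks for.\<close>
    fix j k assume jk: "j \<in> ?I" "k \<in> ?I" "?a j = ?a k + 1"
    have "k < j" using jk shifted_less[OF g, of j k i] i by (cases k j rule: linorder_cases) auto
    moreover have "\<not> Suc k < j"
      using jk shifted_less[OF g, of k "Suc k" i] shifted_less[OF g, of "Suc k" j i] i by auto
    ultimately have j: "j = Suc k" by simp
    then have "g i j = g i k" using jk(3) by (simp add: shifted_def)
    moreover have "g i k \<le> g (Suc i) j" "g (Suc i) j \<le> g i j"
      using patternsD(2,3)[OF g] jk i j by auto
    moreover have "g i k \<le> g (i - 1) k" "g (i - 1) k \<le> g i j"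
      using patternsD(2,3)[OF g, of k "i - 1"] jk i j by auto
    ultimately have "?a j = ?b j" "?a k = ?c k" by (simp_all add: shifted_def)
    moreover have "j \<in> {1..Suc i}" "k \<in> {1..i-1}" using jk j by auto
    ultimately show "?a j \<in> ?b ` {1..Suc i} \<and> ?a k \<in> ?c ` {1..i-1}" by blast
  qed simp_all
  \<comment> \<open>The shifts cancel: i (i + 1) + i equals (i + 1) (i + 2) / 2 + i (i - 1) / 2 + (i
    - 1).\<close>
  also have "\<dots> = of_int (2 * row_sum g i - row_sum g (Suc i) - row_sum g (i - 1))"
    using i unfolding sum_shifted by (cases i) auto
  finally have res: "(\<Sum>j\<in>?I. ?r1 j + ?r2 j) = \<dots>" by (simp only: sum.distrib)
  have "(if lower g i j \<in> patterns n t then up_coeff (lower g i j) i j * down_coeff g i j else 0) = ?r1 j"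
    if j: "j \<in> ?I" for j
  proof (cases "lower g i j \<in> patterns n t")
    case True
    \<comment> \<open>The factor for k = j is -1 and absorbs the minus sign of
      \<open>up_coeff\<close>. For raising it is 1, so the sign remains and the difference of the
      two terms becomes a sum of residues.\<close>
    have "(\<Prod>k\<in>?I. ?a j - 1 - ?a k) = - (\<Prod>k\<in>?I - {j}. ?a j - 1 - ?a k)"
      using j by (subst prod.remove[of _ j]) auto
    then show ?thesis
      using True \<open>i - Suc 0 \<noteq> i\<close> by (simp add: up_coeff_def down_coeff_def shifted_lower mult_ac cong: prod.cong_simp)
  next
    case False
    \<comment> \<open>A forbidden move means that the entry already touches a neighbour, and the
      numerator contains the factor for that neighbour.\<close>
    then have "g i j = g (Suc i) j \<or> (1 < j \<and> g i j = g (i - 1) (j - 1))"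
      using lower_in_patterns[OF g, of j i] patternsD(2)[OF g, of j i]
        patternsD(3)[OF g, of "j - 1" "i - 1"] j i by fastforce
    then have "(\<Prod>k=1..Suc i. ?a j - ?b k) = 0 \<or> (\<Prod>k=1..i-1. ?a j - 1 - ?c k) = 0"
    proof
      assume "g i j = g (Suc i) j"
      then have "(\<Prod>k=1..Suc i. ?a j - ?b k) = 0"
        using j by (intro prod_zero bexI[of _ j]) (auto simp: shifted_def)
      then show ?thesis ..
    next
      assume "1 < j \<and> g i j = g (i - 1) (j - 1)"
      then have "(\<Prod>k=1..i-1. ?a j - 1 - ?c k) = 0"
        using j by (intro prod_zero bexI[of _ "j - 1"]) (auto simp: shifted_def of_nat_diff)
      then show ?thesis ..
    qed
    then show ?thesis using False by auto
  qed
  moreover have "(if raise g i j \<in> patterns n t then down_coeff (raise g i j) i j * up_coeff g i j else 0) = - ?r2 j"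
    if j: "j \<in> ?I" for j
  proof (cases "raise g i j \<in> patterns n t")
    case True
    have "(\<Prod>k\<in>?I. ?a j + 1 - ?a k) = (\<Prod>k\<in>?I - {j}. ?a j + 1 - ?a k)"
      using j by (subst prod.remove[of _ j]) auto
    then show ?thesis
      using True \<open>i - Suc 0 \<noteq> i\<close> by (simp add: up_coeff_def down_coeff_def shifted_raise mult_ac cong: prod.cong_simp)
  next
    case False
    then have "g i j = g (Suc i) (Suc j) \<or> (j < i \<and> g i j = g (i - 1) j)"
      using raise_in_patterns[OF g, of j i] patternsD(3)[OF g, of j i]
        patternsD(2)[OF g, of j "i - 1"] j i by fastforce
    then have "(\<Prod>k=1..Suc i. ?a j + 1 - ?b k) = 0 \<or> (\<Prod>k=1..i-1. ?a j - ?c k) = 0"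
    proof
      assume "g i j = g (Suc i) (Suc j)"
      then have "(\<Prod>k=1..Suc i. ?a j + 1 - ?b k) = 0"
        using j by (intro prod_zero bexI[of _ "Suc j"]) (auto simp: shifted_def)
      then show ?thesis ..
    next
      assume "j < i \<and> g i j = g (i - 1) j"
      then have "(\<Prod>k=1..i-1. ?a j - ?c k) = 0"
        using j by (intro prod_zero bexI[of _ j]) (auto simp: shifted_def)
      then show ?thesis ..
    qed
    then show ?thesis using False by auto
  qed
  ultimately show ?thesis unfolding res[symmetric] by (intro sum.cong) auto
qed

text \<open>The weights \<open>i (n - i)\<close> are the coefficients of the sum of the positive coroots: with them the
  commutator \<open>[E, F]\<close> acts on patterns of rank \<open>\<rho>\<close> as \<open>2 \<rho> - l\<close>.\<close>

lemma card_rank_le: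
  assumes r: "2 * r < nat (total n top - total n bottom)"
  shows "card {g \<in> patterns n t. nat (total n g - total n bottom) = r}
    \<le> card {g \<in> patterns n t. nat (total n g - total n bottom) = Suc r}"
proof -
  let ?P = "patterns n t"
  let ?\<rho> = "\<lambda>g. nat (total n g - total n bottom)"
  let ?l = "nat (total n top - total n bottom)"
  define X where "X = (SIGMA i:{1..<n}. {1..i})"
  define R where "R g p = raise g (fst p) (snd p)" for g and p :: "nat \<times> nat"
  define L where "L g p = lower g (fst p) (snd p)" for g and p :: "nat \<times> nat"
  define U where "U g p = up_coeff g (fst p) (snd p)" for g and p :: "nat \<times> nat"
  \<comment> \<open>The weights sit on the lowering side only. Off the diagonal both paths lower the
    same position, so the same weight appears in both.\<close>
  define D where "D g p = real (fst p) * (real n - real (fst p)) * down_coeff g (fst p) (snd p)"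
    for g and p :: "nat \<times> nat"
  define e where "e y x = (\<Sum>p\<in>X. if x = L y p then U x p else 0)" for y x
  define f where "f y x = (\<Sum>p\<in>X. if x = R y p then D x p else 0)" for y x
  have X: "finite X" by (simp add: X_def)
  have P: "finite ?P" by (rule finite_patterns)
  have RL: "R (L g p) p = g" "L (R g p) p = g" for g p by (simp_all add: R_def L_def)
  have e_sum: "(\<Sum>x\<in>?P. e y x * w x) = (\<Sum>p\<in>X. if L y p \<in> ?P then U (L y p) p * w (L y p) else 0)" for y w
  proof -
    have "(\<Sum>x\<in>?P. e y x * w x) = (\<Sum>p\<in>X. \<Sum>x\<in>?P. if x = L y p then U x p * w x else 0)"
      unfolding e_def sum_distrib_right by (subst sum.swap) (intro sum.cong refl, auto)
    also have "\<dots> = (\<Sum>p\<in>X. if L y p \<in> ?P then U (L y p) p * w (L y p) else 0)"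
      using P by (intro sum.cong refl) simp
    finally show ?thesis .
  qed
  have f_sum: "(\<Sum>x\<in>?P. f y x * w x) = (\<Sum>p\<in>X. if R y p \<in> ?P then D (R y p) p * w (R y p) else 0)" for y w
  proof -
    have "(\<Sum>x\<in>?P. f y x * w x) = (\<Sum>p\<in>X. \<Sum>x\<in>?P. if x = R y p then D x p * w x else 0)"
      unfolding f_def sum_distrib_right by (subst sum.swap) (intro sum.cong refl, auto)
    also have "\<dots> = (\<Sum>p\<in>X. if R y p \<in> ?P then D (R y p) p * w (R y p) else 0)"
      using P by (intro sum.cong refl) simp
    finally show ?thesis .
  qed
  have rank_R: "?\<rho> (R g p) = ?\<rho> g + 1" if "g \<in> ?P" "p \<in> X" for g p
    using total_raise[of "snd p" "fst p" n g] total_bounds(1)[OF that(1)] that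
    by (auto simp: X_def R_def nat_add_distrib)
  show ?thesis
  proof (rule sl2_card_le[OF P _ _ _ r, of e _ f])
    fix x y assume xy: "x \<in> ?P" "y \<in> ?P"
    {
      assume "e y x \<noteq> 0"
      then obtain p where "p \<in> X" "(if x = L y p then U x p else 0) \<noteq> 0"
        unfolding e_def by (rule sum.not_neutral_contains_not_neutral)
      then have "p \<in> X" "x = L y p" by (auto split: if_splits)
      then show "?\<rho> y = ?\<rho> x + 1" using rank_R[OF xy(1), of p] RL by simp
    next
      assume "f y x \<noteq> 0"
      then obtain p where "p \<in> X" "(if x = R y p then D x p else 0) \<noteq> 0"
        unfolding f_def by (rule sum.not_neutral_contains_not_neutral)
      then have "p \<in> X" "x = R y p" by (auto split: if_splits)
      then show "?\<rho> x = ?\<rho> y + 1" using rank_R[OF xy(2), of p] by simp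
    }
  next
    fix v :: "(nat \<Rightarrow> nat \<Rightarrow> int) \<Rightarrow> real" and y assume y: "y \<in> ?P"
    define T1 where "T1 p q = (if L y p \<in> ?P \<and> R (L y p) q \<in> ?P
      then U (L y p) p * D (R (L y p) q) q * v (R (L y p) q) else 0)" for p q
    define T2 where "T2 p q = (if R y q \<in> ?P \<and> L (R y q) p \<in> ?P
      then D (R y q) q * U (L (R y q) p) p * v (L (R y q) p) else 0)" for p q
    have off: "T1 p q = T2 p q" if pq: "p \<in> X" "q \<in> X" "p \<noteq> q" for p q
    proof -
      define w where "w = L y p"
      have yw: "y = R w p" by (simp add: w_def RL)
      have comm: "L (R y q) p = R w q"
        using pq(3) lower_raise_commute by (auto simp: L_def R_def w_def prod_eq_iff)
      have "w = inf y (R w q)" "R y q = sup y (R w q)"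
        using pq(3) inf_sup_raise unfolding yw R_def by (auto simp: prod_eq_iff)
      then have "R w q \<in> ?P \<Longrightarrow> w \<in> ?P \<and> R y q \<in> ?P"
        using inf_sup_patterns[OF y, of "R w q"] by metis
      moreover have "U w p * D (R w q) q = D (R y q) q * U (R w q) p"
        using up_down_commute[of "fst p" "snd p" "fst q" "snd q" w] pq
        by (auto simp: X_def U_def D_def R_def yw prod_eq_iff)
      ultimately show ?thesis by (auto simp: T1_def T2_def comm w_def[symmetric])
    qed
    let ?d = "\<lambda>i j. (if lower y i j \<in> ?P then up_coeff (lower y i j) i j * down_coeff y i j else 0)
           - (if raise y i j \<in> ?P then down_coeff (raise y i j) i j * up_coeff y i j else 0)"
    have diag: "T1 p p - T2 p p = real (fst p) * (real n - real (fst p)) * ?d (fst p) (snd p) * v y" for p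
      using y by (auto simp: T1_def T2_def RL U_def D_def) (auto simp: L_def R_def algebra_simps)
    have "(\<Sum>x\<in>?P. e y x * (\<Sum>z\<in>?P. f x z * v z)) = (\<Sum>p\<in>X. \<Sum>q\<in>X. T1 p q)"
      unfolding e_sum f_sum T1_def by (auto simp: sum_distrib_left mult_ac intro!: sum.cong)
    moreover have "(\<Sum>x\<in>?P. f y x * (\<Sum>z\<in>?P. e x z * v z)) = (\<Sum>q\<in>X. \<Sum>p\<in>X. T2 p q)"
      unfolding e_sum f_sum T2_def by (auto simp: sum_distrib_left mult_ac intro!: sum.cong)
    moreover have "(\<Sum>q\<in>X. \<Sum>p\<in>X. T2 p q) = (\<Sum>p\<in>X. \<Sum>q\<in>X. T2 p q)"
      by (rule sum.swap)
    ultimately have "(\<Sum>x\<in>?P. e y x * (\<Sum>z\<in>?P. f x z * v z)) - (\<Sum>x\<in>?P. f y x * (\<Sum>z\<in>?P. e x z * v z))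
        = (\<Sum>p\<in>X. \<Sum>q\<in>X. T1 p q - T2 p q)"
      by (simp add: sum_subtractf)
    also have "\<dots> = (\<Sum>p\<in>X. \<Sum>q\<in>X. if q = p then T1 p p - T2 p p else 0)"
      using off by (intro sum.cong refl) auto
    also have "\<dots> = (\<Sum>p\<in>X. real (fst p) * (real n - real (fst p)) * ?d (fst p) (snd p) * v y)"
      using X by (intro sum.cong refl) (simp add: diag)
    also have "\<dots> = (\<Sum>i=1..<n. \<Sum>j=1..i. real i * (real n - real i) * ?d i j * v y)"
      unfolding X_def by (subst sum.Sigma) (auto simp: case_prod_unfold)
    also have "\<dots> = (\<Sum>i=1..<n. real i * (real n - real i) * (\<Sum>j=1..i. ?d i j)) * v y"
      by (simp add: sum_distrib_left sum_distrib_right)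
    also have "(\<Sum>i=1..<n. real i * (real n - real i) * (\<Sum>j=1..i. ?d i j)) =
        (\<Sum>i=1..<n. real i * (real n - real i) *
           (2 * real_of_int (row_sum y i) - real_of_int (row_sum y (Suc i)) - real_of_int (row_sum y (i - 1))))"
      by (intro sum.cong refl) (use up_down_diagonal[OF y] in simp)
    also have "\<dots> = 2 * real_of_int (total n y) - real (n - 1) * real_of_int (row_sum y n)"
    proof (cases n)
      case (Suc m)
      then show ?thesis
        using sum_by_parts[of "\<lambda>i. real_of_int (row_sum y i)" "Suc m" m] by (simp add: total_def)
    qed (simp add: total_def)
    also have "\<dots> = 2 * real (?\<rho> y) - real ?l"
    proof -
      have "row_sum y n = (\<Sum>j=1..n. t j)"
        using patternsD(1)[OF y] by (simp add: row_sum_def)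
      then have "total n bottom + total n top = int (n - 1) * row_sum y n"
        using total_bottom_top by simp
      then have "2 * total n y - int (n - 1) * row_sum y n = 2 * int (?\<rho> y) - int ?l"
        using total_bounds[OF y] by linarith
      then have "real_of_int (2 * total n y - int (n - 1) * row_sum y n) = real_of_int (2 * int (?\<rho> y) - int ?l)"
        by (rule arg_cong)
      then show ?thesis by simp
    qed
    finally show "(\<Sum>x\<in>?P. e y x * (\<Sum>z\<in>?P. f x z * v z)) - (\<Sum>x\<in>?P. f y x * (\<Sum>z\<in>?P. e x z * v z))
        = (2 * real (?\<rho> y) - real ?l) * v y" .
  qed
qed

end

section \<open>Weights and alternants\<close>

lemma lookup_eps: "Poly_Mapping.lookup (eps k) m = (if k = m then 1 else 0)"
  by (simp add: eps_def lookup_single when_def)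

lemma eps_diff_inject:
  assumes "i \<noteq> j" "eps i - eps j = eps k - eps l"
  shows "i = k" "j = l"
proof -
  have "Poly_Mapping.lookup (eps i - eps j) m = Poly_Mapping.lookup (eps k - eps l) m" for m
    by (simp add: assms(2))
  from this[of i] this[of j] show "i = k" "j = l"
    using assms(1) by (simp_all add: lookup_minus lookup_eps split: if_splits)
qed

lemma inprod_coroot:
  assumes "i \<noteq> j"
  shows "inprod v (coroot (eps i - eps j)) = Poly_Mapping.lookup v i - Poly_Mapping.lookup v j"
proof -
  have sup: "inprod u w = (\<Sum>k\<in>A. Poly_Mapping.lookup u k * Poly_Mapping.lookup w k)"
    if "finite A" "Poly_Mapping.keys w \<subseteq> A" for u w A
    unfolding inprod_def using that
    by (intro sum.mono_neutral_cong) (auto simp: in_keys_iff)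
  have k1: "Poly_Mapping.keys (eps i - eps j) \<subseteq> {i, j}"
    by (auto simp: in_keys_iff lookup_minus lookup_eps split: if_splits)
  have k2: "Poly_Mapping.keys (coroot (eps i - eps j)) \<subseteq> {i, j}"
    using k1 by (auto simp: in_keys_iff coroot_def)
  have "inprod (eps i - eps j) (eps i - eps j) = 2"
    by (subst sup[OF _ k1]) (use assms in \<open>auto simp: lookup_minus lookup_eps\<close>)
  then show ?thesis
    by (subst sup[OF _ k2]) (use assms in \<open>auto simp: lookup_minus lookup_eps coroot_def\<close>)
qed

section \<open>Coordinates on the hyperplane of coordinate sum zero\<close>

lemma euclid_space_closed:
  shows "0 \<in> euclid_space n"
    and "u \<in> euclid_space n \<Longrightarrow> v \<in> euclid_space n \<Longrightarrow> u + v \<in> euclid_space n"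
    and "u \<in> euclid_space n \<Longrightarrow> scal c u \<in> euclid_space n"
proof -
  assume "u \<in> euclid_space n"
  then show "scal c u \<in> euclid_space n"
    by (auto simp: euclid_space_def in_keys_iff simp flip: sum_distrib_left)
  assume "v \<in> euclid_space n"
  with \<open>u \<in> euclid_space n\<close> show "u + v \<in> euclid_space n"
    using Poly_Mapping.keys_add[of u v] by (auto simp: euclid_space_def lookup_add sum.distrib)
qed (simp add: euclid_space_def)

lemma euclid_space_sum: "(\<And>i. i \<in> I \<Longrightarrow> f i \<in> euclid_space n) \<Longrightarrow> sum f I \<in> euclid_space n"
  by (induction I rule: infinite_finite_induct) (auto intro: euclid_space_closed)

text \<open>Pairings with the simple coroots determine the vector: equal consecutive differences
  leave a constant, which the zero coordinate sum kills.\<close>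

lemma euclid_space_eqI:
  assumes u: "u \<in> euclid_space n" and v: "v \<in> euclid_space n"
    and eq: "\<And>j. 1 \<le> j \<Longrightarrow> j < n \<Longrightarrow>
      Poly_Mapping.lookup u j - Poly_Mapping.lookup u (Suc j) =
      Poly_Mapping.lookup v j - Poly_Mapping.lookup v (Suc j)"
  shows "u = v"
proof (rule poly_mapping_eqI)
  fix k
  define d where "d k = Poly_Mapping.lookup u k - Poly_Mapping.lookup v k" for k
  have const: "d (Suc m) = d 1" if "Suc m \<le> n" for m
    using that
  proof (induction m)
    case (Suc m)
    then show ?case using eq[of "Suc m"] by (auto simp: d_def)
  qed simp
  have const': "d m = d 1" if "m \<in> {1..n}" for m
    using const[of "m - 1"] that by auto
  have "real n * d 1 = (\<Sum>m=1..n. d m)"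
    by (subst sum.cong[OF refl const']) simp_all
  also have "\<dots> = 0" using u v by (simp add: d_def sum_subtractf euclid_space_def)
  finally have "n = 0 \<or> d 1 = 0" by simp
  moreover have "d k = 0" if "k \<notin> {1..n}"
  proof -
    have "k \<notin> Poly_Mapping.keys u" "k \<notin> Poly_Mapping.keys v"
      using u v that by (auto simp: euclid_space_def)
    then show ?thesis by (simp add: d_def in_keys_iff)
  qed
  ultimately have "d k = 0" using const'[of k] by (cases "k \<in> {1..n}") auto
  then show "Poly_Mapping.lookup u k = Poly_Mapping.lookup v k" by (simp add: d_def)
qed

text \<open>The orthogonal projection to the hyperplane of the vector with coordinates
  \<open>c 0\<close>, ..., \<open>c (n - 1)\<close>. Constants added to \<open>c\<close> disappear,
  so weights can be given by natural numbers and their exponentials by monomials.\<close>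

definition coord_vec :: "nat \<Rightarrow> (nat \<Rightarrow> real) \<Rightarrow> vect" where
  "coord_vec n c = (\<Sum>j<n. scal (c j) (eps (Suc j) - scal (1 / real n) (\<Sum>m<n. eps (Suc m))))"

lemma lookup_coord_vec:
  "Poly_Mapping.lookup (coord_vec n c) k = (if k \<in> {1..n} then c (k - 1) - (\<Sum>j<n. c j) / real n else 0)"
proof -
  have 1: "(\<Sum>m<n. if Suc m = k then f m else 0) = (if k \<in> {1..n} then f (k - 1) else 0)"
    for f :: "nat \<Rightarrow> real"
  proof -
    have "(\<Sum>m<n. if Suc m = k then f m else 0) = (\<Sum>m<n. if m = k - 1 then if k = 0 then 0 else f (k - 1) else 0)"
      by (intro sum.cong) auto
    then show ?thesis by auto
  qed
  have "Poly_Mapping.lookup (coord_vec n c) k =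
      (\<Sum>j<n. (if Suc j = k then c j else 0) - c j * (\<Sum>m<n. if Suc m = k then 1 else 0) / real n)"
    unfolding coord_vec_def lookup_sum lookup_scal lookup_minus lookup_eps
    by (intro sum.cong) (auto simp: algebra_simps)
  also have "\<dots> = (if k \<in> {1..n} then c (k - 1) else 0) - (\<Sum>j<n. c j) * (if k \<in> {1..n} then 1 else 0) / real n"
    unfolding sum_subtractf 1 by (simp add: sum_distrib_right sum_divide_distrib)
  finally show ?thesis by auto
qed

lemma coord_vec_in_euclid_space: "n \<ge> 1 \<Longrightarrow> coord_vec n c \<in> euclid_space n"
proof -
  assume n: "n \<ge> 1"
  have "(\<Sum>k=1..n. c (k - 1)) = (\<Sum>j<n. c j)"
    by (rule sum.reindex_bij_witness[of _ Suc "\<lambda>k. k - 1"]) auto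
  then have "(\<Sum>k=1..n. Poly_Mapping.lookup (coord_vec n c) k) = 0"
    using n by (simp add: lookup_coord_vec sum_subtractf)
  moreover have "Poly_Mapping.keys (coord_vec n c) \<subseteq> {1..n}"
    by (auto simp: in_keys_iff lookup_coord_vec split: if_splits)
  ultimately show ?thesis by (simp add: euclid_space_def)
qed

lemma fund_weight:
  assumes "i \<in> {1..n-1}"
  shows "fund_weight n i \<in> euclid_space n"
    and "j \<in> {1..n-1} \<Longrightarrow> Poly_Mapping.lookup (fund_weight n i) j - Poly_Mapping.lookup (fund_weight n i) (Suc j) =
      (if i = j then 1 else 0)"
  using theI'[OF fund_weight_unique[OF assms], folded fund_weight_def]
  by (auto simp: inprod_coroot_simple)

lemma sum_fund_weight:
  defines "w \<equiv> \<lambda>n m. \<Sum>i=1..n-1. scal (m i) (fund_weight n i)"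
  shows "w n m \<in> euclid_space n"
    and "j \<in> {1..n-1} \<Longrightarrow> Poly_Mapping.lookup (w n m) j - Poly_Mapping.lookup (w n m) (Suc j) = m j"
proof -
  show "w n m \<in> euclid_space n"
    unfolding w_def by (intro euclid_space_sum euclid_space_closed fund_weight)
  assume j: "j \<in> {1..n-1}"
  have "Poly_Mapping.lookup (w n m) j - Poly_Mapping.lookup (w n m) (Suc j) =
      (\<Sum>i=1..n-1. m i * (Poly_Mapping.lookup (fund_weight n i) j - Poly_Mapping.lookup (fund_weight n i) (Suc j)))"
    by (simp add: w_def lookup_sum sum_subtractf right_diff_distrib)
  also have "\<dots> = (\<Sum>i=1..n-1. if i = j then m i else 0)"
    using fund_weight(2)[OF _ j] by (intro sum.cong) auto
  finally show "Poly_Mapping.lookup (w n m) j - Poly_Mapping.lookup (w n m) (Suc j) = m j"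
    using j by simp
qed

lemma sum_fund_weight_eq_coord_vec:
  assumes n: "n \<ge> 1" and c: "\<And>i. 1 \<le> i \<Longrightarrow> i < n \<Longrightarrow> m i = c (i - 1) - c i"
  shows "(\<Sum>i=1..n-1. scal (m i) (fund_weight n i)) = coord_vec n c"
proof (rule euclid_space_eqI[OF sum_fund_weight(1) coord_vec_in_euclid_space[OF n]])
  fix j assume j: "1 \<le> j" "j < n"
  then have "j \<in> {1..n-1}" by auto
  note sum_fund_weight(2)[OF this, of m]
  then show "Poly_Mapping.lookup (\<Sum>i=1..n-1. scal (m i) (fund_weight n i)) j -
        Poly_Mapping.lookup (\<Sum>i=1..n-1. scal (m i) (fund_weight n i)) (Suc j) =
      Poly_Mapping.lookup (coord_vec n c) j - Poly_Mapping.lookup (coord_vec n c) (Suc j)"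
    using j c[OF j] by (simp add: lookup_coord_vec)
qed

section \<open>The Weyl group as the symmetric group\<close>

definition lift_perm :: "(nat \<Rightarrow> nat) \<Rightarrow> nat \<Rightarrow> nat" where
  "lift_perm p k = (case k of 0 \<Rightarrow> 0 | Suc i \<Rightarrow> Suc (p i))"

lemma lift_perm_simps [simp]: "lift_perm p 0 = 0" "lift_perm p (Suc i) = Suc (p i)"
  by (simp_all add: lift_perm_def)

lemma inj_lift_perm: "inj p \<Longrightarrow> inj (lift_perm p)"
proof (rule injI)
  fix k m assume "inj p" "lift_perm p k = lift_perm p m"
  then show "k = m" by (cases k; cases m) (auto dest: injD)
qed

text \<open>\<open>map_key\<close> precomposes, so the inverse is needed to send
  \<open>eps (Suc j)\<close> to \<open>eps (Suc (p j))\<close>. Permutations live on {0..<n}, as in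
  determinants, and \<open>lift_perm\<close> moves them to the coordinates 1, ..., n.\<close>

definition perm_act :: "(nat \<Rightarrow> nat) \<Rightarrow> vect \<Rightarrow> vect" where
  "perm_act p = Poly_Mapping.map_key (lift_perm (Hilbert_Choice.inv p))"

lemma lookup_perm_act:
  assumes "p permutes {0..<n}"
  shows "Poly_Mapping.lookup (perm_act p v) k = Poly_Mapping.lookup v (lift_perm (Hilbert_Choice.inv p) k)"
proof -
  have "inj (lift_perm (Hilbert_Choice.inv p))"
    using assms by (intro inj_lift_perm permutes_inj[OF permutes_inv])
  then show ?thesis by (simp add: perm_act_def map_key.rep_eq)
qed

lemma perm_act_eps:
  assumes "p permutes {0..<n}" shows "perm_act p (eps (Suc j)) = eps (Suc (p j))"
proof (rule poly_mapping_eqI)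
  fix k
  have "j = Hilbert_Choice.inv p m \<longleftrightarrow> p j = m" for m
    using permutes_inv_eq[OF assms, of m j] by auto
  then show "Poly_Mapping.lookup (perm_act p (eps (Suc j))) k = Poly_Mapping.lookup (eps (Suc (p j))) k"
    by (cases k) (simp_all add: lookup_perm_act[OF assms] lookup_eps)
qed

lemma perm_act_id: "perm_act id = id"
proof
  fix v
  have "id permutes {0..<0 :: nat}" by (rule permutes_id)
  moreover have "lift_perm id k = k" for k by (cases k) auto
  ultimately show "perm_act id v = id v" by (intro poly_mapping_eqI) (simp add: lookup_perm_act)
qed

lemma reflection_perm_act:
  assumes p: "p permutes {0..<n}" and ab: "a < n" "b < n" "a \<noteq> b"
  shows "reflection (eps (Suc a) - eps (Suc b)) \<circ> perm_act p = perm_act (Transposition.transpose a b \<circ> p)"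
proof
  fix v
  have tp: "Transposition.transpose a b \<circ> p permutes {0..<n}"
    using ab by (intro permutes_compose[OF p] permutes_swap_id) auto
  have inv: "Hilbert_Choice.inv (Transposition.transpose a b \<circ> p) = Hilbert_Choice.inv p \<circ> Transposition.transpose a b"
    using p by (subst o_inv_distrib) (auto simp: permutes_bij)
  show "(reflection (eps (Suc a) - eps (Suc b)) \<circ> perm_act p) v = perm_act (Transposition.transpose a b \<circ> p) v"
  proof (rule poly_mapping_eqI)
    fix k
    show "Poly_Mapping.lookup ((reflection (eps (Suc a) - eps (Suc b)) \<circ> perm_act p) v) k =
        Poly_Mapping.lookup (perm_act (Transposition.transpose a b \<circ> p) v) k"
      using ab by (cases k)
        (auto simp: reflection_def inprod_coroot lookup_minus lookup_eps lookup_perm_act[OF p]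
          lookup_perm_act[OF tp] inv transpose_def)
  qed
qed

text \<open>Reflections act as transpositions, and both the Weyl group and
  \<open>permutes_induct\<close> build their elements by composing with one more of these on the
  left.\<close>

lemma weyl_group_eq: "weyl_group n = perm_act ` {p. p permutes {0..<n}}"
proof (intro equalityI subsetI)
  fix w assume "w \<in> weyl_group n"
  then show "w \<in> perm_act ` {p. p permutes {0..<n}}"
  proof induction
    case weyl_id
    show ?case by (metis perm_act_id image_eqI mem_Collect_eq permutes_id)
  next
    case (weyl_refl w \<alpha>)
    then obtain p where p: "p permutes {0..<n}" "w = perm_act p" by auto
    from weyl_refl obtain i j where "\<alpha> = eps i - eps j" "i \<in> {1..n}" "j \<in> {1..n}" "i \<noteq> j"
      by (auto simp: roots_def)
    then have a: "\<alpha> = eps (Suc (i - 1)) - eps (Suc (j - 1))" "i - 1 < n" "j - 1 < n" "i - 1 \<noteq> j - 1" by auto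
    have "Transposition.transpose (i - 1) (j - 1) \<circ> p permutes {0..<n}"
      using a by (intro permutes_compose[OF p(1)] permutes_swap_id) auto
    then show ?case
      using reflection_perm_act[OF p(1) a(2-4)] unfolding p(2) a(1) by auto
  qed
next
  fix w assume "w \<in> perm_act ` {p. p permutes {0..<n}}"
  then obtain p where p: "p permutes {0..<n}" "w = perm_act p" by auto
  from p(1) finite_atLeastLessThan have "perm_act p \<in> weyl_group n"
  proof (induction rule: permutes_induct)
    case id
    show ?case unfolding perm_act_id by (rule weyl_group.weyl_id)
  next
    case (swap a b p)
    have "eps (Suc a) - eps (Suc b) \<in> roots n"
      using swap unfolding roots_def by (intro CollectI exI[of _ "Suc a"] exI[of _ "Suc b"]) auto
    then have "reflection (eps (Suc a) - eps (Suc b)) \<circ> perm_act p \<in> weyl_group n"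
      using swap by (intro weyl_group.weyl_refl)
    moreover have "a < n" "b < n" using swap by auto
    ultimately show ?case
      using reflection_perm_act[OF \<open>p permutes {0..<n}\<close>] \<open>a \<noteq> b\<close> by metis
  qed
  then show "w \<in> weyl_group n" by (simp add: p(2))
qed

lemma inj_perm_act: "inj_on perm_act {p. p permutes {0..<n}}"
proof (rule inj_onI)
  fix p q assume p: "p \<in> {p. p permutes {0..<n}}" and q: "q \<in> {p. p permutes {0..<n}}"
    and eq: "perm_act p = perm_act q"
  have "eps (Suc (p j)) = eps (Suc (q j))" for j
    using p q eq perm_act_eps[of p n j] perm_act_eps[of q n j] by simp
  then show "p = q"
    by (intro HOL.ext) (metis lookup_eps nat.inject zero_neq_one)
qed

text \<open>A permutation matrix has a single nonzero term in the Leibniz formula.\<close>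

lemma weyl_det_perm_act:
  assumes p: "p permutes {0..<n}" shows "weyl_det n (perm_act p) = sign p"
proof -
  have "det (mat n n (\<lambda>(i, j). Poly_Mapping.lookup (perm_act p (eps (Suc j))) (Suc i))) =
    (\<Sum>q | q permutes {0..<n}. of_int (sign q) * (\<Prod>j<n. if p j = q j then 1 else 0 :: real))"
    by (subst det_col[of _ n])
       (auto intro!: sum.cong prod.cong simp: perm_act_eps[OF p] lookup_eps dest: permutes_lessI)
  also have "\<dots> = (\<Sum>q\<in>{p}. of_int (sign q) * (\<Prod>j<n. if p j = q j then 1 else 0 :: real))"
  proof (intro sum.mono_neutral_right ballI)
    fix q assume q: "q \<in> {q. q permutes {0..<n}} - {p}"
    have "\<exists>j<n. p j \<noteq> q j"
    proof (rule ccontr)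
      assume "\<not> ?thesis"
      then have "p j = q j" for j
        using permutes_not_in[OF p, of j] permutes_not_in[of q "{0..<n}" j] q by (cases "j < n") auto
      then show False using q by auto
    qed
    then obtain j where "j < n" "p j \<noteq> q j" by blast
    then have "(\<Prod>j<n. if p j = q j then 1 else 0 :: real) = 0"
      by (intro prod_zero bexI[of _ j]) auto
    then show "of_int (sign q) * (\<Prod>j<n. if p j = q j then 1 else 0 :: real) = 0" by simp
  qed (use p in \<open>auto simp: finite_permutations\<close>)
  finally show ?thesis by (simp add: weyl_det_def)
qed

section \<open>Exponentials, and alternants as determinants of powers\<close>

lemma expo_0 [simp]: "expo 0 = 1"
  by (simp add: expo_def)

lemma expo_add: "expo (u + v) = expo u * expo v"
  by (simp add: expo_def mult_single)

lemma expo_sum: "expo (sum f I) = (\<Prod>i\<in>I. expo (f i))"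
  by (induction I rule: infinite_finite_induct) (auto simp: expo_add)

lemma expo_scal: "expo (scal (real k) v) = expo v ^ k"
proof (induction k)
  case 0
  have "scal 0 v = 0" by (intro poly_mapping_eqI) simp
  then show ?case by simp
next
  case (Suc k)
  have "scal (real (Suc k)) v = v + scal (real k) v"
    by (intro poly_mapping_eqI) (simp add: lookup_add algebra_simps)
  then show ?case using Suc by (simp add: expo_add)
qed

definition expo_var :: "nat \<Rightarrow> nat \<Rightarrow> group_ring_elt" where
  "expo_var n j = expo (coord_vec n (\<lambda>i. if i = j then 1 else 0))"

lemma coord_vec_sum:
  "coord_vec n c = (\<Sum>j<n. scal (c j) (coord_vec n (\<lambda>i. if i = j then 1 else 0)))"
proof (rule poly_mapping_eqI)
  fix k
  show "Poly_Mapping.lookup (coord_vec n c) k =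
      Poly_Mapping.lookup (\<Sum>j<n. scal (c j) (coord_vec n (\<lambda>i. if i = j then 1 else 0))) k"
  proof (cases "k \<in> {1..n}")
    case True
    have "(\<Sum>j<n. c j * (if k - 1 = j then 1 else 0)) = (\<Sum>j<n. if j = k - 1 then c (k - 1) else 0)"
      by (intro sum.cong) auto
    also have "\<dots> = c (k - 1)" using True by auto
    finally show ?thesis using True
      by (simp add: lookup_coord_vec lookup_sum right_diff_distrib sum_subtractf sum_divide_distrib)
  next
    case False
    then have "Poly_Mapping.lookup (coord_vec n c') k = 0" for c'
      by (simp only: lookup_coord_vec if_False)
    then show ?thesis by (simp add: lookup_sum)
  qed
qed

lemma expo_coord_vec: "expo (coord_vec n (\<lambda>j. real (l j))) = (\<Prod>j<n. expo_var n j ^ l j)"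
  by (subst coord_vec_sum) (simp add: expo_sum expo_scal expo_var_def)

lemma perm_act_coord_vec:
  assumes p: "p permutes {0..<n}"
  shows "perm_act p (coord_vec n c) = coord_vec n (\<lambda>j. c (Hilbert_Choice.inv p j))"
proof (rule poly_mapping_eqI)
  fix k
  have ip: "Hilbert_Choice.inv p permutes {0..<n}" by (rule permutes_inv[OF p])
  have "(\<Sum>j<n. c (Hilbert_Choice.inv p j)) = (\<Sum>j<n. c j)"
    using sum.permute[of "Hilbert_Choice.inv p" "{..<n}" c] ip by (simp add: lessThan_atLeast0 o_def)
  moreover have "Hilbert_Choice.inv p j < n \<longleftrightarrow> j < n" for j
    using permutes_in_image[OF ip, of j] by simp
  ultimately show "Poly_Mapping.lookup (perm_act p (coord_vec n c)) k =
      Poly_Mapping.lookup (coord_vec n (\<lambda>j. c (Hilbert_Choice.inv p j))) k"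
    by (cases k) (auto simp: lookup_perm_act[OF p] lookup_coord_vec less_eq_Suc_le[symmetric])
qed

lemma alternant_coord_vec:
  "alternant n (coord_vec n (\<lambda>j. real (l j))) = power_det n (expo_var n) l"
proof -
  have "alternant n (coord_vec n (\<lambda>j. real (l j))) =
      (\<Sum>p | p permutes {0..<n}. of_int (sign p) * expo (perm_act p (coord_vec n (\<lambda>j. real (l j)))))"
    unfolding alternant_def weyl_group_eq
    by (subst sum.reindex[OF inj_perm_act]) (auto simp: weyl_det_perm_act intro!: sum.cong)
  also have "\<dots> = (\<Sum>p | p permutes {0..<n}. of_int (sign p) * (\<Prod>j<n. expo_var n (p j) ^ l j))"
  proof (intro sum.cong refl arg_cong2[of _ _ _ _ "(*)"])
    fix p assume "p \<in> {p. p permutes {0..<n}}"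
    then have p: "p permutes {0..<n}" by simp
    \<comment> \<open>Reindexing by \<open>p\<close> moves the permutation from the exponents to the
      variables, as in the Leibniz formula.\<close>
    have "(\<Prod>j<n. expo_var n j ^ l (Hilbert_Choice.inv p j)) = (\<Prod>j<n. expo_var n (p j) ^ l (Hilbert_Choice.inv p (p j)))"
      using prod.permute[of p "{..<n}" "\<lambda>j. expo_var n j ^ l (Hilbert_Choice.inv p j)"] p
      by (simp add: lessThan_atLeast0 o_def)
    then show "expo (perm_act p (coord_vec n (\<lambda>j. real (l j)))) = (\<Prod>j<n. expo_var n (p j) ^ l j)"
      using permutes_inverses(2)[OF p]
      by (simp add: perm_act_coord_vec[OF p] expo_coord_vec[of n "\<lambda>j. l (Hilbert_Choice.inv p j)"])
  qed
  finally show ?thesis by (simp add: power_det_Leibniz)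
qed

text \<open>The variables are not independent, as their product is 1. It is enough that they are
  pairwise distinct, because the group ring has no zero divisors.\<close>

lemma power_det_expo_var_nonzero: "power_det n (expo_var n) (\<lambda>j. j) \<noteq> 0"
proof -
  have "expo_var n j \<noteq> expo_var n i" if "i < j" "j < n" for i j
  proof
    assume "expo_var n j = expo_var n i"
    then have "coord_vec n (\<lambda>m. if m = j then 1 else 0) = coord_vec n (\<lambda>m. if m = i then 1 else 0)"
      unfolding expo_var_def expo_def by (metis lookup_single_eq lookup_single_not_eq zero_neq_one)
    then have "Poly_Mapping.lookup (coord_vec n (\<lambda>m. if m = j then 1 else 0)) (Suc j) =
        Poly_Mapping.lookup (coord_vec n (\<lambda>m. if m = i then 1 else 0)) (Suc j)" by simp
    then show False using that by (simp add: lookup_coord_vec)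
  qed
  then show ?thesis by (auto simp: power_det_id)
qed

lemma power_det_permute:
  assumes q: "q permutes {0..<n}"
  shows "power_det n x (\<lambda>j. l (q j)) = of_int (sign q) * power_det n x l"
proof -
  let ?G = "\<lambda>p. \<Prod>j<n. x (p j) ^ l j"
  have iq: "Hilbert_Choice.inv q permutes {0..<n}" by (rule permutes_inv[OF q])
  have "(\<Prod>j<n. x (p j) ^ l (q j)) = ?G (p \<circ> Hilbert_Choice.inv q)" for p
    using prod.permute[of q "{..<n}" "\<lambda>j. x (p (Hilbert_Choice.inv q j)) ^ l j"] q permutes_inverses(2)[OF q]
    by (simp add: lessThan_atLeast0 o_def)
  then have "power_det n x (\<lambda>j. l (q j)) = (\<Sum>p | p permutes {0..<n}. of_int (sign p) * ?G (p \<circ> Hilbert_Choice.inv q))"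
    by (simp add: power_det_Leibniz)
  also have "\<dots> = (\<Sum>p | p permutes {0..<n}. of_int (sign q) * (of_int (sign (p \<circ> Hilbert_Choice.inv q)) * ?G (p \<circ> Hilbert_Choice.inv q)))"
  proof (intro sum.cong refl)
    fix p assume "p \<in> {p. p permutes {0..<n}}"
    then have "sign (p \<circ> Hilbert_Choice.inv q) = sign p * sign q"
      using permutes_imp_permutation[of "{0..<n}"] q iq by (simp add: sign_compose sign_inverse)
    then have "sign q * sign (p \<circ> Hilbert_Choice.inv q) = sign p"
      by (simp add: mult.commute)
    then have "(of_int (sign p) :: 'a) = of_int (sign q) * of_int (sign (p \<circ> Hilbert_Choice.inv q))"
      by (metis of_int_mult)
    then show "of_int (sign p) * ?G (p \<circ> Hilbert_Choice.inv q) = of_int (sign q) * (of_int (sign (p \<circ> Hilbert_Choice.inv q)) * ?G (p \<circ> Hilbert_Choice.inv q))"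
      by (simp only: mult.assoc)
  qed
  also have "\<dots> = of_int (sign q) * (\<Sum>p | p permutes {0..<n}. of_int (sign p) * ?G p)"
    unfolding sum_distrib_left[symmetric]
    using sum_permutations_compose_right[OF iq, of "\<lambda>p. of_int (sign p) * ?G p"] by simp
  finally show ?thesis by (simp add: power_det_Leibniz)
qed

text \<open>Rows of patterns are increasing, whereas the coordinates of a dominant weight are decreasing. The
  reversal contributes the same sign to both alternants of a Weyl bialternant.\<close>

definition rev_perm :: "nat \<Rightarrow> nat \<Rightarrow> nat" where
  "rev_perm n j = (if j < n then n - 1 - j else j)"

lemma rev_perm_permutes: "rev_perm n permutes {0..<n}"
proof (rule bij_imp_permutes)
  show "bij_betw (rev_perm n) {0..<n} {0..<n}"
    by (rule bij_betw_byWitness[of _ "rev_perm n"]) (auto simp: rev_perm_def)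
qed (auto simp: rev_perm_def)

lemma power_det_rev:
  assumes "\<And>j. j < n \<Longrightarrow> l' j = l (n - 1 - j)"
  shows "power_det n x l' = of_int (sign (rev_perm n)) * power_det n x l"
proof -
  have "power_det n x l' = power_det n x (\<lambda>j. l (rev_perm n j))"
    using assms by (intro power_det_cong) (auto simp: rev_perm_def)
  then show ?thesis by (simp add: power_det_permute[OF rev_perm_permutes])
qed

lemma weyl_bialternant_eqI:
  assumes "\<chi> \<in> group_ring n" "alternant n (weyl_vector n) \<noteq> 0"
    and "alternant n (weyl_vector n) * \<chi> = alternant n (lam + weyl_vector n)"
  shows "weyl_bialternant n lam = \<chi>"
  unfolding weyl_bialternant_def
proof (rule the_equality)
  fix \<chi>' assume "\<chi>' \<in> group_ring n \<and> alternant n (weyl_vector n) * \<chi>' = alternant n (lam + weyl_vector n)"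
  then have "alternant n (weyl_vector n) * \<chi>' = alternant n (weyl_vector n) * \<chi>" using assms by simp
  then show "\<chi>' = \<chi>" using assms(2) by simp
qed (use assms in simp)

section \<open>The principal specialisation\<close>

text \<open>Partial coordinate sums are nonnegative on simple roots, hence on positive roots,
  whereas for j < i the sum of the first j coordinates of eps i - eps j is -1. Conversely, eps i -
  eps j with i < j telescopes into simple roots.\<close>

lemma pos_roots_eq: "pos_roots n = {eps i - eps j | i j. 1 \<le> i \<and> i < j \<and> j \<le> n}"
proof (intro equalityI subsetI)
  fix \<alpha> assume "\<alpha> \<in> pos_roots n"
  then obtain c :: "nat \<Rightarrow> nat" where "\<alpha> \<in> roots n"
    and \<alpha>: "\<alpha> = (\<Sum>k=1..n-1. scal (real (c k)) (simple_root k))"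
    unfolding pos_roots_def by blast
  then obtain i j where ij: "\<alpha> = eps i - eps j" "i \<in> {1..n}" "j \<in> {1..n}" "i \<noteq> j"
    unfolding roots_def by blast
  have "\<not> j < i"
  proof
    assume "j < i"
    have "(\<Sum>m=1..j. Poly_Mapping.lookup \<alpha> m) = (\<Sum>m=1..j. - (if m = j then 1 else 0))"
      unfolding ij(1) by (intro sum.cong) (use \<open>j < i\<close> in \<open>auto simp: lookup_minus lookup_eps\<close>)
    also have "\<dots> = -1" using ij by (simp add: sum_negf)
    finally have "(\<Sum>m=1..j. Poly_Mapping.lookup \<alpha> m) = -1" .
    moreover have "(\<Sum>m=1..j. Poly_Mapping.lookup \<alpha> m) =
        (\<Sum>k=1..n-1. real (c k) * (\<Sum>m=1..j. (if m = k then 1 else 0) - (if m = Suc k then 1 else 0)))"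
      unfolding \<alpha> lookup_sum sum_distrib_left
      by (subst sum.swap) (auto simp: simple_root_def lookup_minus lookup_eps intro!: sum.cong)
    moreover have "0 \<le> \<dots>"
    proof (rule sum_nonneg, rule mult_nonneg_nonneg)
      fix k assume "k \<in> {1..n-1}"
      have "(\<Sum>m=1..j. (if m = k then 1 else 0) - (if m = Suc k then 1 else 0)) =
          (if k \<in> {1..j} then 1 else 0) - (if Suc k \<in> {1..j} then 1 else (0 :: real))"
        unfolding sum_subtractf by (simp only: sum.delta finite_atLeastAtMost)
      then show "0 \<le> (\<Sum>m=1..j. (if m = k then 1 else 0) - (if m = Suc k then 1 else (0 :: real)))"
        using \<open>k \<in> {1..n-1}\<close> by auto
    qed simp
    ultimately show False by simp
  qed
  then show "\<alpha> \<in> {eps i - eps j | i j. 1 \<le> i \<and> i < j \<and> j \<le> n}"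
    using ij by (intro CollectI exI[of _ i] exI[of _ j]) auto
next
  fix \<alpha> assume "\<alpha> \<in> {eps i - eps j | i j. 1 \<le> i \<and> i < j \<and> j \<le> n}"
  then obtain i j where ij: "\<alpha> = eps i - eps j" "1 \<le> i" "i < j" "j \<le> n" by auto
  define c :: "nat \<Rightarrow> nat" where "c k = (if i \<le> k \<and> k < j then 1 else 0)" for k
  have scal01: "scal 1 v = v" "scal 0 v = 0" for v by (intro poly_mapping_eqI; simp)+
  have "(\<Sum>k=1..n-1. scal (real (c k)) (simple_root k)) = (\<Sum>k=i..<j. simple_root k)"
    using ij by (intro sum.mono_neutral_cong_right) (auto simp: c_def scal01)
  also have "\<dots> = \<alpha>"
    using sum_Suc_diff'[of i j "\<lambda>k. - eps k"] ij by (simp add: simple_root_def)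
  finally have "\<alpha> = (\<Sum>k=1..n-1. scal (real (c k)) (simple_root k))" ..
  moreover have "\<alpha> \<in> roots n"
    using ij unfolding roots_def by (intro CollectI exI[of _ i] exI[of _ j]) auto
  ultimately show "\<alpha> \<in> pos_roots n" by (auto simp: pos_roots_def)
qed

text \<open>The indices are reversed to match the increasing rows of patterns: the coroot for (j, i)
  pairs with the shifted weight to a difference l j - l i, as computed in
  \<open>inprod_coord_vec_coroot\<close>.\<close>

lemma prod_pos_roots:
  "(\<Prod>\<alpha>\<in>pos_roots n. f \<alpha>) = (\<Prod>j<n. \<Prod>i<j. f (eps (n - j) - eps (n - i)))"
proof -
  let ?h = "\<lambda>(j, i). eps (n - j) - eps (n - i)"
  have img: "pos_roots n = ?h ` (SIGMA j:{..<n}. {..<j})"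
  proof (intro equalityI subsetI)
    fix \<alpha> assume "\<alpha> \<in> pos_roots n"
    then obtain i j where ij: "\<alpha> = eps i - eps j" "1 \<le> i" "i < j" "j \<le> n" by (auto simp: pos_roots_eq)
    then have "\<alpha> = ?h (n - i, n - j)" "(n - i, n - j) \<in> (SIGMA j:{..<n}. {..<j})" by auto
    then show "\<alpha> \<in> ?h ` (SIGMA j:{..<n}. {..<j})" by (rule image_eqI)
  next
    fix \<alpha> assume "\<alpha> \<in> ?h ` (SIGMA j:{..<n}. {..<j})"
    then obtain j i where "\<alpha> = eps (n - j) - eps (n - i)" "j < n" "i < j" by auto
    then show "\<alpha> \<in> pos_roots n"
      unfolding pos_roots_eq by (intro CollectI exI[of _ "n - j"] exI[of _ "n - i"]) auto
  qed
  have inj: "inj_on ?h (SIGMA j:{..<n}. {..<j})"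
  proof (rule inj_onI)
    fix p q assume "p \<in> (SIGMA j:{..<n}. {..<j})" "q \<in> (SIGMA j:{..<n}. {..<j})" "?h p = ?h q"
    then obtain j i l k where pq: "p = (j, i)" "q = (l, k)" "i < j" "j < n" "k < l" "l < n"
      and eq: "eps (n - j) - eps (n - i) = eps (n - l) - eps (n - k)" by auto
    have "n - j \<noteq> n - i" using pq by auto
    from eps_diff_inject[OF this eq] show "p = q" using pq by auto
  qed
  have "(\<Prod>\<alpha>\<in>pos_roots n. f \<alpha>) = (\<Prod>p\<in>(SIGMA j:{..<n}. {..<j}). f (?h p))"
    unfolding img by (simp add: prod.reindex[OF inj])
  also have "\<dots> = (\<Prod>j<n. \<Prod>i<j. f (eps (n - j) - eps (n - i)))"
    by (subst prod.Sigma) (auto simp: case_prod_unfold)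
  finally show ?thesis .
qed

section \<open>Polynomials in q and the specialised determinants\<close>

lemma coeff_RGF: "finite R \<Longrightarrow> coeff (RGF R) r = int (rank_number R r)"
proof -
  assume "finite R"
  have "coeff (RGF R) r = (\<Sum>x\<in>R. if rank_of R (covers R) x = r then 1 else 0)"
    unfolding RGF_def coeff_sum by (intro sum.cong) auto
  also have "\<dots> = int (card {x \<in> R. rank_of R (covers R) x = r})"
    using \<open>finite R\<close> by (simp add: sum.If_cases Int_def)
  finally show ?thesis by (simp add: rank_number_def)
qed

abbreviation qvar :: "int poly" where "qvar \<equiv> monom 1 (Suc 0)"

lemma monom_eq_qvar_power: "monom (1 :: int) k = qvar ^ k"
  by (simp add: monom_power)

lemma one_minus_qvar_power_nonzero: "d > 0 \<Longrightarrow> 1 - qvar ^ d \<noteq> 0"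
proof
  assume "d > 0" "1 - qvar ^ d = 0"
  then have "coeff (1 - qvar ^ d) 0 = 0" by simp
  then show False using \<open>d > 0\<close> by (simp flip: monom_eq_qvar_power)
qed

text \<open>Numerator and denominator of the product formula have equally many of these
  antipalindromic factors, so the signs cancel and the quotient is palindromic.\<close>

lemma reflect_poly_one_minus_qvar_power:
  assumes "d > 0" shows "reflect_poly (1 - qvar ^ d) = - (1 - qvar ^ d)"
proof -
  define p where "p = 1 - qvar ^ d"
  have c: "coeff p k = (if k = 0 then 1 else if k = d then -1 else 0)" for k
    using assms by (auto simp: p_def simp flip: monom_eq_qvar_power)
  have "degree p = d"
  proof (rule antisym)
    show "degree p \<le> d" by (rule degree_le) (simp add: c)
    show "d \<le> degree p" by (rule le_degree) (use assms in \<open>simp add: c\<close>)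
  qed
  then have "reflect_poly p = - p"
    by (intro poly_eqI) (use assms in \<open>auto simp: coeff_reflect_poly c\<close>)
  then show ?thesis by (simp add: p_def)
qed

text \<open>At powers of q variables and exponents trade roles: the matrix entry is also a power of
  q^(l j) with exponent n - 1 - i. So the transpose is a Vandermonde matrix in the q^(l j), up to
  reversal.\<close>

lemma power_det_principal:
  "power_det n (\<lambda>i. q ^ (n - 1 - i)) l = of_int (sign (rev_perm n)) * (\<Prod>j<n. \<Prod>i<j. q ^ l j - q ^ l i)"
proof -
  have "power_det n (\<lambda>i. q ^ (n - 1 - i)) l = det (mat n n (\<lambda>(i, j). (q ^ l j) ^ (n - 1 - i)))"
    unfolding power_det_def power_mult[symmetric] by (simp add: mult.commute)
  also have "mat n n (\<lambda>(i, j). (q ^ l j) ^ (n - 1 - i)) = transpose_mat (mat n n (\<lambda>(j, i). (q ^ l j) ^ (n - 1 - i)))"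
    by (intro eq_matI) auto
  also have "det \<dots> = power_det n (\<lambda>j. q ^ l j) (\<lambda>i. n - 1 - i)"
    unfolding power_det_def by (rule det_transpose[where n = n]) simp
  also have "\<dots> = of_int (sign (rev_perm n)) * power_det n (\<lambda>j. q ^ l j) (\<lambda>i. i)"
    by (rule power_det_rev) simp
  finally show ?thesis by (simp add: power_det_id)
qed

text \<open>Abel summation. For N = m = n it says that the monomial of a pattern specialises to q to
  the power \<open>total n g\<close>, which is the rank up to a constant.\<close>

lemma sum_by_parts_int:
  fixes S :: "nat \<Rightarrow> int"
  assumes "S 0 = 0"
  shows "(\<Sum>k<m. (int N - 1 - int k) * (S (Suc k) - S k)) = (\<Sum>i=1..<m. S i) + (int N - int m) * S m"
proof (induction m)
  case (Suc m)
  then show ?case using assms by (cases "m = 0") (auto simp: algebra_simps)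
qed (simp add: assms)

section \<open>Splitting property, product formula, symmetry and unimodality\<close>

context pattern_poset
begin

lemma t_nonneg: "0 \<le> t 1 \<Longrightarrow> 1 \<le> j \<Longrightarrow> j \<le> n \<Longrightarrow> 0 \<le> t j"
  by (rule nonneg_if_Suc_mono[of n t, OF mono])

lemma row_sum_le_Suc:
  assumes g: "g \<in> patterns n t" and t: "0 \<le> t 1" and i: "i < n"
  shows "row_sum g i \<le> row_sum g (Suc i)"
proof -
  have "row_sum g (Suc i) = g (Suc i) 1 + (\<Sum>j=1..i. g (Suc i) (Suc j))"
    unfolding row_sum_def by (subst sum.atLeast_Suc_atMost) (auto simp: sum.shift_bounds_cl_Suc_ivl simp del: sum.cl_ivl_Suc)
  moreover have "0 \<le> g (Suc i) 1" using pattern_bounds(1)[OF g, of "Suc i" 1] i t by simp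
  moreover have "row_sum g i \<le> (\<Sum>j=1..i. g (Suc i) (Suc j))"
    unfolding row_sum_def using patternsD(3)[OF g] i by (intro sum_mono) auto
  ultimately show ?thesis by simp
qed

lemma weight_of_patterns:
  assumes g: "g \<in> patterns n t" and t: "0 \<le> t 1" and n: "n \<ge> 1"
  shows "weight_of n (patterns n t) pattern_color g =
    coord_vec n (\<lambda>j. real (nat (row_sum g (Suc j) - row_sum g j)))"
  unfolding weight_of_def
proof (rule sum_fund_weight_eq_coord_vec[OF n])
  fix i assume i: "1 \<le> i" "i < n"
  have "row_sum g (i - 1) \<le> row_sum g (Suc (i - 1))" "row_sum g i \<le> row_sum g (Suc i)"
    using i by (intro row_sum_le_Suc[OF g t]; simp)+
  then show "real_of_int (m_of (patterns n t) pattern_color i g) =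
      real (nat (row_sum g (Suc (i - 1)) - row_sum g (i - 1))) - real (nat (row_sum g (Suc i) - row_sum g i))"
    using i by (simp add: m_of_patterns[OF g i])
qed

text \<open>By \<open>m_of_patterns\<close>, raising an entry of row i adds 2 to m_i and -1 to its
  neighbours m_(i-1) and m_(i+1). These are the pairings of \<open>simple_root i\<close> with the
  simple coroots.\<close>

lemma weight_of_raise:
  assumes s: "s \<in> patterns n t" and u: "raise s i j \<in> patterns n t" and t: "0 \<le> t 1"
  shows "weight_of n (patterns n t) pattern_color s + simple_root i =
    weight_of n (patterns n t) pattern_color (raise s i j)"
proof -
  note pos = raise_position[OF s u]
  have n: "n \<ge> 1" using pos by simp
  have "(\<Sum>k=1..n. Poly_Mapping.lookup (simple_root i) k) = 0"
    using pos by (simp add: simple_root_def lookup_minus lookup_eps sum_subtractf)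
  then have sr: "simple_root i \<in> euclid_space n"
    using pos by (auto simp: euclid_space_def in_keys_iff simple_root_def lookup_minus lookup_eps split: if_splits)
  show ?thesis
    unfolding weight_of_def
  proof (rule euclid_space_eqI[OF euclid_space_closed(2)[OF sum_fund_weight(1) sr] sum_fund_weight(1)])
    fix k assume k: "1 \<le> k" "k < n"
    then have k': "k \<in> {1..n-1}" by auto
    have "real_of_int (m_of (patterns n t) pattern_color k (raise s i j)) =
        real_of_int (m_of (patterns n t) pattern_color k s) +
        (Poly_Mapping.lookup (simple_root i) k - Poly_Mapping.lookup (simple_root i) (Suc k))"
      using k pos by (auto simp: m_of_patterns[OF s k] m_of_patterns[OF u k] row_sum_raise
          simple_root_def lookup_minus lookup_eps)
    then show "Poly_Mapping.lookup ((\<Sum>i=1..n-1. scal (real_of_int (m_of (patterns n t) pattern_color i s)) (fund_weight n i)) + simple_root i) k -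
         Poly_Mapping.lookup ((\<Sum>i=1..n-1. scal (real_of_int (m_of (patterns n t) pattern_color i s)) (fund_weight n i)) + simple_root i) (Suc k) =
         Poly_Mapping.lookup (\<Sum>ia=1..n-1. scal (real_of_int (m_of (patterns n t) pattern_color ia (raise s i j))) (fund_weight n ia)) k -
         Poly_Mapping.lookup (\<Sum>ia=1..n-1. scal (real_of_int (m_of (patterns n t) pattern_color ia (raise s i j))) (fund_weight n ia)) (Suc k)"
      using sum_fund_weight(2)[OF k', of "\<lambda>k. real_of_int (m_of (patterns n t) pattern_color k s)"]
        sum_fund_weight(2)[OF k', of "\<lambda>k. real_of_int (m_of (patterns n t) pattern_color k (raise s i j))"]
      by (simp add: lookup_add)
  qed
qed

lemma splitting_patterns:
  assumes t: "0 \<le> t 1" and n: "n \<ge> 1"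
    and lam: "lam + weyl_vector n = coord_vec n (\<lambda>j. real (nat (t (n - j)) + (n - 1 - j)))"
    and rho: "weyl_vector n = coord_vec n (\<lambda>j. real (n - 1 - j))"
  shows "splitting_distributive_lattice n lam (patterns n t) pattern_color"
proof -
  let ?P = "patterns n t"
  define \<chi> where "\<chi> = (\<Sum>x\<in>?P. expo (weight_of n ?P pattern_color x))"
  have "\<chi> \<in> group_ring n"
  proof -
    have "Poly_Mapping.keys \<chi> \<subseteq> (\<Union>x\<in>?P. Poly_Mapping.keys (expo (weight_of n ?P pattern_color x)))"
      unfolding \<chi>_def by (rule Poly_Mapping.keys_sum)
    also have "\<dots> \<subseteq> weight_lattice n"
      by (auto simp: expo_def weight_of_def weight_lattice_def)
    finally show ?thesis by (simp add: group_ring_def)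
  qed
  moreover have a0: "alternant n (weyl_vector n) =
      of_int (sign (rev_perm n)) * power_det n (expo_var n) (\<lambda>j. j)"
    unfolding rho alternant_coord_vec by (rule power_det_rev) simp
  then have "alternant n (weyl_vector n) \<noteq> 0"
    using power_det_expo_var_nonzero by (simp add: sign_def)
  moreover have "alternant n (weyl_vector n) * \<chi> = alternant n (lam + weyl_vector n)"
  proof -
    have "alternant n (lam + weyl_vector n) =
        of_int (sign (rev_perm n)) * power_det n (expo_var n) (\<lambda>j. nat (t (Suc j)) + j)"
      unfolding lam alternant_coord_vec by (rule power_det_rev) (simp add: Suc_diff_Suc)
    also have "power_det n (expo_var n) (\<lambda>j. nat (t (Suc j)) + j) = power_det n (expo_var n) (\<lambda>j. j) *
        (\<Sum>g\<in>?P. \<Prod>k<n. expo_var n k ^ nat (row_sum g (Suc k) - row_sum g k))"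
      using mono t by (intro power_det_eq_sum_patterns) auto
    also have "(\<Sum>g\<in>?P. \<Prod>k<n. expo_var n k ^ nat (row_sum g (Suc k) - row_sum g k)) = \<chi>"
      unfolding \<chi>_def by (intro sum.cong refl) (simp only: weight_of_patterns[OF _ t n] expo_coord_vec)
    finally show ?thesis by (simp add: a0 mult.assoc)
  qed
  ultimately have "weyl_bialternant n lam = \<chi>" by (rule weyl_bialternant_eqI)
  moreover have "pattern_color s u \<in> {1..n-1}" if "covers ?P s u" for s u
  proof -
    obtain i j where "s \<in> ?P" "raise s i j \<in> ?P" "u = raise s i j"
      using \<open>covers ?P s u\<close> by (auto simp: covers_patterns_iff)
    then show ?thesis using raise_position[of s n t i j] by (auto simp: pattern_color_raise)
  qed
  moreover have "weight_of n ?P pattern_color s + simple_root i = weight_of n ?P pattern_color u"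
    if "color_edge ?P pattern_color i s u" for i s u
    using that weight_of_raise t by (auto simp: color_edge_patterns_iff)
  ultimately have "splitting_poset n lam ?P pattern_color"
    unfolding splitting_poset_def \<chi>_def using rank_patterns(1) by auto
  moreover have "distributive_lattice ?P"
    by (intro distributive_lattice_closed inf_sup_patterns)
  ultimately show ?thesis by (simp add: splitting_distributive_lattice_def)
qed

lemma shifted_strict_mono: "0 \<le> t 1 \<Longrightarrow> i < j \<Longrightarrow> j < n \<Longrightarrow> nat (t (Suc i)) + i < nat (t (Suc j)) + j"
proof -
  assume t: "0 \<le> t 1" and "i < j" "j < n"
  from \<open>i < j\<close> have "Suc i \<le> j" by simp
  then show ?thesis using \<open>j < n\<close>
  proof (induction j rule: dec_induct)
    case base
    then show ?case using mono[of "Suc i"] by simp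
  next
    case (step m)
    then show ?case using mono[of "Suc m"] by simp
  qed
qed

text \<open>Normalising the Vandermonde factors to 1 - q^d splits off powers of q. Those coming from
  the entries of \<open>t\<close> multiply to q to the power \<open>total n bottom\<close>, exactly
  the offset between \<open>total\<close> and the rank, so they cancel.\<close>

lemma RGF_patterns:
  assumes t: "0 \<le> t 1" and n: "n \<ge> 1"
  defines "l \<equiv> \<lambda>j. nat (t (Suc j)) + j"
  shows "RGF (patterns n t) * (\<Prod>j<n. \<Prod>i<j. 1 - qvar ^ (j - i)) = (\<Prod>j<n. \<Prod>i<j. 1 - qvar ^ (l j - l i))"
proof -
  let ?P = "patterns n t"
  let ?V = "\<lambda>l. \<Prod>j<n. \<Prod>i<j. qvar ^ l j - qvar ^ l i"
  define N where "N = (\<Prod>j<n. \<Prod>i<j. - (qvar ^ i))"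
  have tb: "total n bottom = (\<Sum>j<n. \<Sum>i<j. t (Suc i))"
  proof -
    have "(\<Sum>j<n. \<Sum>i<j. t (Suc i)) = (\<Sum>j=1..<n. \<Sum>i<j. t (Suc i))"
      by (intro sum.mono_neutral_right) (auto simp: Suc_le_eq)
    also have "\<dots> = (\<Sum>j=1..<n. row_sum bottom j)"
      unfolding row_sum_def
      by (intro sum.cong refl sum.reindex_bij_witness[of _ "\<lambda>i. i - 1" Suc]) (auto simp: bottom_def)
    finally show ?thesis by (simp add: total_def)
  qed
  have tb_nonneg: "0 \<le> total n bottom"
    unfolding tb using t_nonneg[OF t] by (intro sum_nonneg) auto
  have "int (\<Sum>j<n. \<Sum>i<j. nat (t (Suc i))) = total n bottom"
    unfolding tb of_nat_sum using t_nonneg[OF t] by (intro sum.cong) auto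
  then have tb_nat: "(\<Sum>j<n. \<Sum>i<j. nat (t (Suc i))) = nat (total n bottom)"
    by (metis nat_int)
  have weight: "(\<Prod>k<n. (qvar ^ (n - 1 - k)) ^ nat (row_sum g (Suc k) - row_sum g k)) =
      qvar ^ nat (total n bottom) * monom 1 (rank_of ?P (covers ?P) g)" if g: "g \<in> ?P" for g
  proof -
    have "int (\<Sum>k<n. (n - 1 - k) * nat (row_sum g (Suc k) - row_sum g k)) =
        (\<Sum>k<n. (int n - 1 - int k) * (row_sum g (Suc k) - row_sum g k))"
      unfolding of_nat_sum
      by (intro sum.cong refl) (use row_sum_le_Suc[OF g t] in \<open>auto simp: of_nat_diff\<close>)
    also have "\<dots> = total n g"
      by (subst sum_by_parts_int) (simp_all add: total_def)
    finally have "(\<Sum>k<n. (n - 1 - k) * nat (row_sum g (Suc k) - row_sum g k)) =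
        nat (total n bottom) + nat (total n g - total n bottom)"
      using tb_nonneg total_bounds(1)[OF g] by linarith
    then have "(\<Prod>k<n. (qvar ^ (n - 1 - k)) ^ nat (row_sum g (Suc k) - row_sum g k)) =
        qvar ^ (nat (total n bottom) + nat (total n g - total n bottom))"
      by (simp only: power_mult[symmetric] power_sum[symmetric])
    then show ?thesis
      by (simp only: rank_patterns(3)[OF g] power_add monom_eq_qvar_power[of "nat (total n g - total n bottom)"])
  qed
  have factor: "qvar ^ a - qvar ^ b = - (qvar ^ b) * (1 - qvar ^ (a - b))" if "b \<le> a" for a b
    using that by (simp add: algebra_simps flip: power_add)
  have V_id: "?V (\<lambda>j. j) = N * (\<Prod>j<n. \<Prod>i<j. 1 - qvar ^ (j - i))"
    unfolding N_def prod.distrib[symmetric] by (intro prod.cong refl factor) auto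
  have "?V l = (\<Prod>j<n. \<Prod>i<j. - (qvar ^ i) * qvar ^ nat (t (Suc i)) * (1 - qvar ^ (l j - l i)))"
  proof (intro prod.cong refl)
    fix i j assume "j \<in> {..<n}" "i \<in> {..<j}"
    then have "l i < l j" using shifted_strict_mono[OF t] by (simp add: l_def)
    then have "qvar ^ l j - qvar ^ l i = - (qvar ^ l i) * (1 - qvar ^ (l j - l i))" by (intro factor) simp
    then show "qvar ^ l j - qvar ^ l i = - (qvar ^ i) * qvar ^ nat (t (Suc i)) * (1 - qvar ^ (l j - l i))"
      by (simp add: l_def power_add mult_ac)
  qed
  also have "\<dots> = N * qvar ^ nat (total n bottom) * (\<Prod>j<n. \<Prod>i<j. 1 - qvar ^ (l j - l i))"
    unfolding N_def prod.distrib tb_nat[symmetric] power_sum ..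
  finally have V_l: "?V l = \<dots>" .
  have "power_det n (\<lambda>i. qvar ^ (n - 1 - i)) l = power_det n (\<lambda>i. qvar ^ (n - 1 - i)) (\<lambda>j. j) *
    (\<Sum>g\<in>?P. \<Prod>k<n. (qvar ^ (n - 1 - k)) ^ nat (row_sum g (Suc k) - row_sum g k))"
    unfolding l_def using mono t by (intro power_det_eq_sum_patterns) auto
  also have "(\<Sum>g\<in>?P. \<Prod>k<n. (qvar ^ (n - 1 - k)) ^ nat (row_sum g (Suc k) - row_sum g k)) =
      qvar ^ nat (total n bottom) * RGF ?P"
    unfolding RGF_def sum_distrib_left by (intro sum.cong refl weight)
  finally have "?V l = ?V (\<lambda>j. j) * (qvar ^ nat (total n bottom) * RGF ?P)"
    unfolding power_det_principal by (simp add: mult.assoc sign_def split: if_splits)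
  then have "N * qvar ^ nat (total n bottom) * (\<Prod>j<n. \<Prod>i<j. 1 - qvar ^ (l j - l i)) =
      N * qvar ^ nat (total n bottom) * (RGF ?P * (\<Prod>j<n. \<Prod>i<j. 1 - qvar ^ (j - i)))"
    unfolding V_l V_id by (simp only: mult_ac)
  moreover have "N * qvar ^ nat (total n bottom) \<noteq> 0"
    by (simp add: N_def monom_eq_0_iff)
  ultimately show ?thesis by simp
qed

lemma rank_symmetric_patterns:
  assumes t: "0 \<le> t 1" and n: "n \<ge> 1"
  shows "rank_symmetric (patterns n t)"
proof -
  let ?P = "patterns n t"
  let ?p = "RGF ?P"
  define l where "l = nat (total n top - total n bottom)"
  define e where "e j = nat (t (Suc j)) + j" for j
  define A where "A = (\<Prod>j<n. \<Prod>i<j. 1 - qvar ^ (e j - e i))"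
  define B where "B = (\<Prod>j<n. \<Prod>i<j. 1 - qvar ^ (j - i))"
  define K where "K = (\<Prod>j<n. \<Prod>i<j. -1 :: int poly)"
  have pBA: "?p * B = A" unfolding A_def B_def e_def by (rule RGF_patterns[OF t n])
  have refl: "reflect_poly (\<Prod>j<n. \<Prod>i<j. 1 - qvar ^ d i j) = K * (\<Prod>j<n. \<Prod>i<j. 1 - qvar ^ d i j)"
    if "\<And>i j. i < j \<Longrightarrow> j < n \<Longrightarrow> d i j > 0" for d :: "nat \<Rightarrow> nat \<Rightarrow> nat"
    unfolding K_def prod.distrib[symmetric] reflect_poly_prod
    by (intro prod.cong refl) (use that reflect_poly_one_minus_qvar_power in simp)
  have "reflect_poly ?p * (K * B) = K * A"
    using arg_cong[OF pBA, of reflect_poly] refl[of "\<lambda>i j. j - i"] refl[of "\<lambda>i j. e j - e i"]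
      shifted_strict_mono[OF t]
    by (simp add: A_def B_def reflect_poly_mult e_def)
  then have "(K * B) * reflect_poly ?p = (K * B) * ?p"
    unfolding pBA[symmetric] by (simp only: mult_ac)
  moreover have "K * B \<noteq> 0"
    unfolding K_def B_def using one_minus_qvar_power_nonzero by simp
  ultimately have refl_p: "reflect_poly ?p = ?p" by simp
  have num: "rank_number ?P r = card {g \<in> ?P. nat (total n g - total n bottom) = r}" for r
    unfolding rank_number_def using rank_patterns(3) by (intro arg_cong[of _ _ card]) auto
  \<comment> \<open>\<open>reflect_poly\<close> reverses at the degree, which therefore has to be
    the length; \<open>top\<close> makes that coefficient nonzero.\<close>
  have "degree ?p = l"
  proof (rule antisym)
    show "degree ?p \<le> l"
    proof (rule degree_le, intro allI impI)
      fix r assume "l < r"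
      then have "{g \<in> ?P. nat (total n g - total n bottom) = r} = {}"
        using total_bounds(2) by (force simp: l_def)
      then show "coeff ?p r = 0" by (simp add: coeff_RGF finite_patterns num)
    qed
    show "l \<le> degree ?p"
    proof (rule le_degree)
      have "top \<in> {g \<in> ?P. nat (total n g - total n bottom) = l}" using top_in by (simp add: l_def)
      then have "rank_number ?P l \<noteq> 0" unfolding num using finite_patterns by (auto simp: card_eq_0_iff)
      then show "coeff ?p l \<noteq> 0" by (simp add: coeff_RGF finite_patterns)
    qed
  qed
  have "rank_number ?P i = rank_number ?P (l - i)" if "i \<le> l" for i
  proof -
    have "int (rank_number ?P i) = coeff (reflect_poly ?p) i"
      by (simp add: refl_p coeff_RGF finite_patterns)
    also have "\<dots> = int (rank_number ?P (l - i))"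
      using that by (simp add: coeff_reflect_poly \<open>degree ?p = l\<close> coeff_RGF finite_patterns)
    finally show ?thesis by simp
  qed
  then show ?thesis unfolding rank_symmetric_def Let_def rank_patterns(2) l_def by blast
qed

text \<open>\<open>card_rank_le\<close> gives the ascent below the middle rank, and rank symmetry
  mirrors it to the descent above.\<close>

lemma rank_unimodal_patterns:
  assumes t: "0 \<le> t 1" and n: "n \<ge> 1"
  shows "rank_unimodal (patterns n t)"
proof -
  let ?P = "patterns n t"
  define l where "l = nat (total n top - total n bottom)"
  have len: "length_of ?P (covers ?P) = l" by (simp add: rank_patterns(2) l_def)
  have num: "rank_number ?P r = card {g \<in> ?P. nat (total n g - total n bottom) = r}" for r
    unfolding rank_number_def using rank_patterns(3) by (intro arg_cong[of _ _ card]) auto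
  have up: "rank_number ?P i \<le> rank_number ?P (Suc i)" if "2 * i < l" for i
    unfolding num using that card_rank_le by (simp add: l_def)
  have sym: "rank_number ?P i = rank_number ?P (l - i)" if "i \<le> l" for i
    using rank_symmetric_patterns[OF t n] that unfolding rank_symmetric_def Let_def len by blast
  have down: "rank_number ?P (Suc i) \<le> rank_number ?P i" if "l div 2 \<le> i" "i < l" for i
  proof -
    have "rank_number ?P (l - Suc i) \<le> rank_number ?P (Suc (l - Suc i))"
      using that by (intro up) linarith
    then show ?thesis using that sym[of "Suc i"] sym[of i] by (simp add: Suc_diff_Suc)
  qed
  have "\<exists>m\<le>l. (\<forall>i<m. rank_number ?P i \<le> rank_number ?P (Suc i)) \<and>
             (\<forall>i. m \<le> i \<and> i < l \<longrightarrow> rank_number ?P (Suc i) \<le> rank_number ?P i)"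
    by (intro exI[of _ "l div 2"] conjI allI impI) (use up down in auto)
  then show ?thesis by (simp add: rank_unimodal_def len)
qed

end

section \<open>The given dominant weight in coordinates\<close>

lemma weyl_vector_coord_vec:
  assumes "n \<ge> 1" shows "weyl_vector n = coord_vec n (\<lambda>j. real (n - 1 - j))"
proof -
  have "scal 1 v = v" for v by (intro poly_mapping_eqI) simp
  then have "weyl_vector n = (\<Sum>i=1..n-1. scal 1 (fund_weight n i))"
    by (simp add: weyl_vector_def)
  also have "\<dots> = coord_vec n (\<lambda>j. real (n - 1 - j))"
    using assms by (intro sum_fund_weight_eq_coord_vec) auto
  finally show ?thesis .
qed

text \<open>The bound \<open>n+1-(n-j)\<close> is \<open>Suc j\<close> for \<open>j < n\<close>. It
  is left in this form to match the entry n - j of the top row, which is read backwards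
  here.\<close>

lemma dominant_plus_weyl_vector:
  assumes n: "n \<ge> 1"
  shows "(\<Sum>k=1..n-1. scal (real (a k)) (fund_weight n k)) + weyl_vector n =
    coord_vec n (\<lambda>j. real (nat (\<Sum>k=n+1-(n-j)..n-1. int (a k)) + (n - 1 - j)))"
proof -
  have "scal (real (a k)) v + v = scal (real (a k) + 1) v" for k v
    by (intro poly_mapping_eqI) (simp add: lookup_add algebra_simps)
  then have "(\<Sum>k=1..n-1. scal (real (a k)) (fund_weight n k)) + weyl_vector n =
      (\<Sum>k=1..n-1. scal (real (a k) + 1) (fund_weight n k))"
    by (simp add: weyl_vector_def flip: sum.distrib)
  also have "\<dots> = coord_vec n (\<lambda>j. real (nat (\<Sum>k=n+1-(n-j)..n-1. int (a k)) + (n - 1 - j)))"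
  proof (rule sum_fund_weight_eq_coord_vec[OF n])
    fix i assume i: "1 \<le> i" "i < n"
    have "n + 1 - (n - (i - 1)) = i" "n + 1 - (n - i) = Suc i" using i by auto
    moreover have "(\<Sum>k=i..n-1. int (a k)) = int (a i) + (\<Sum>k=Suc i..n-1. int (a k))"
      using i by (intro sum.atLeast_Suc_atMost) auto
    moreover have "0 \<le> (\<Sum>k=Suc i..n-1. int (a k))" by (intro sum_nonneg) auto
    ultimately show "real (a i) + 1 =
      real (nat (\<Sum>k=n+1-(n-(i-1))..n-1. int (a k)) + (n - 1 - (i - 1))) -
      real (nat (\<Sum>k=n+1-(n-i)..n-1. int (a k)) + (n - 1 - i))"
      using i by (simp add: nat_add_distrib of_nat_diff)
  qed
  finally show ?thesis .
qed

lemma inprod_coord_vec_coroot: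
  assumes "i < j" "j < n" "l i \<le> l j" and c: "\<And>k. k < n \<Longrightarrow> c (n - 1 - k) = real (l k)"
  shows "nat \<lfloor>inprod (coord_vec n c) (coroot (eps (n - j) - eps (n - i)))\<rfloor> = l j - l i"
proof -
  have "inprod (coord_vec n c) (coroot (eps (n - j) - eps (n - i))) = c (n - 1 - j) - c (n - 1 - i)"
    using assms by (subst inprod_coroot) (auto simp: lookup_coord_vec)
  also have "\<dots> = real (l j - l i)" using assms by (simp add: c of_nat_diff)
  finally show ?thesis by simp
qed

theorem theorem8p6:
  fixes n :: nat and a :: "nat \<Rightarrow> nat" and lam :: vect
  assumes "n \<ge> 2"
    and "lam = (\<Sum>k=1..n-1. scal (real (a k)) (fund_weight n k))"
  shows "splitting_distributive_lattice n lam (sl_patterns n a) pattern_color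
    \<and> rank_symmetric (sl_patterns n a)
    \<and> rank_unimodal (sl_patterns n a)
    \<and> to_fract (RGF (sl_patterns n a)) =
        to_fract (\<Prod>\<alpha>\<in>pos_roots n.
           1 - Polynomial.monom 1 (nat \<lfloor>inprod (lam + weyl_vector n) (coroot \<alpha>)\<rfloor>)) /
        to_fract (\<Prod>\<alpha>\<in>pos_roots n.
           1 - Polynomial.monom 1 (nat \<lfloor>inprod (weyl_vector n) (coroot \<alpha>)\<rfloor>))"
proof -
  have n: "n \<ge> 1" using assms(1) by simp
  define t where "t j = (\<Sum>k=n+1-j..n-1. int (a k))" for j
  define l where "l j = nat (t (Suc j)) + j" for j
  have P: "sl_patterns n a = patterns n t"
    using sl_patterns_eq[OF n, of a] by (simp only: t_def[abs_def])
  interpret pattern_poset n t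
  proof
    fix j assume "1 \<le> j" "j < n"
    then show "t j \<le> t (Suc j)"
      unfolding t_def by (intro sum_mono2) auto
  qed
  have t1: "0 \<le> t 1" by (simp add: t_def sum_nonneg)
  note rho = weyl_vector_coord_vec[OF n]
  have lam: "lam + weyl_vector n = coord_vec n (\<lambda>j. real (nat (t (n - j)) + (n - 1 - j)))"
    unfolding assms(2) t_def by (rule dominant_plus_weyl_vector[OF n])
  have "(\<Prod>\<alpha>\<in>pos_roots n. 1 - Polynomial.monom 1 (nat \<lfloor>inprod (lam + weyl_vector n) (coroot \<alpha>)\<rfloor>)) =
      (\<Prod>j<n. \<Prod>i<j. 1 - qvar ^ (l j - l i))"
    unfolding prod_pos_roots
  proof (intro prod.cong refl)
    fix i j assume ij: "j \<in> {..<n}" "i \<in> {..<j}"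
    then have "l i < l j" using shifted_strict_mono[OF t1] by (simp add: l_def)
    then have "nat \<lfloor>inprod (lam + weyl_vector n) (coroot (eps (n - j) - eps (n - i)))\<rfloor> = l j - l i"
      unfolding lam using ij by (intro inprod_coord_vec_coroot) (auto simp: l_def Suc_diff_Suc)
    then show "1 - Polynomial.monom 1 (nat \<lfloor>inprod (lam + weyl_vector n) (coroot (eps (n - j) - eps (n - i)))\<rfloor>) =
        1 - qvar ^ (l j - l i)"
      by (simp only: monom_eq_qvar_power[of "l j - l i"])
  qed
  moreover have "(\<Prod>\<alpha>\<in>pos_roots n. 1 - Polynomial.monom 1 (nat \<lfloor>inprod (weyl_vector n) (coroot \<alpha>)\<rfloor>)) =
      (\<Prod>j<n. \<Prod>i<j. 1 - qvar ^ (j - i))"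
    unfolding prod_pos_roots
  proof (intro prod.cong refl)
    fix i j assume ij: "j \<in> {..<n}" "i \<in> {..<j}"
    then have "nat \<lfloor>inprod (weyl_vector n) (coroot (eps (n - j) - eps (n - i)))\<rfloor> = j - i"
      unfolding rho using inprod_coord_vec_coroot[of i j n "\<lambda>j. j"] by simp
    then show "1 - Polynomial.monom 1 (nat \<lfloor>inprod (weyl_vector n) (coroot (eps (n - j) - eps (n - i)))\<rfloor>) =
        1 - qvar ^ (j - i)"
      by (simp only: monom_eq_qvar_power[of "j - i"])
  qed
  moreover have "(\<Prod>j<n. \<Prod>i<j. 1 - qvar ^ (j - i)) \<noteq> 0"
    using one_minus_qvar_power_nonzero by simp
  moreover have "to_fract (RGF (patterns n t)) * to_fract (\<Prod>j<n. \<Prod>i<j. 1 - qvar ^ (j - i)) =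
      to_fract (\<Prod>j<n. \<Prod>i<j. 1 - qvar ^ (l j - l i))"
    unfolding l_def to_fract_mult[symmetric] RGF_patterns[OF t1 n] ..
  ultimately show ?thesis
    unfolding P
    using splitting_patterns[OF t1 n lam rho] rank_symmetric_patterns[OF t1 n] rank_unimodal_patterns[OF t1 n]
    by (simp only: eq_divide_eq to_fract_eq_0_iff) simp
qed

end
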